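(* Let $x\le w$ in the affine Weyl group $W$ of type $\tilde A_2$, and suppose $x\mathcal B$ is a smooth point of $X_w$. Then $\ell(x)\ge\ell(w)-6$. More precisely, for non-spiral $w$: (a) If $w$ is of Type 1 in an even chamber, then $\ell(x)\ge\ell(w)-6$. (b) If $w$ is of Type 1 in an odd chamber, then $\ell(x)\ge\ell(w)-5$. (c) If $w$ is of Type 2 in an even chamber, then $\ell(x)\ge\ell(w)-5$. (d) If $w$ is of Type 2 in an odd chamber, then $\ell(x)\ge\ell(w)-4$.
   Context: Let $V\cong\mathbb R^2$ be a Euclidean plane with inner product $(\cdot,\cdot)$, containing the root system $\Phi=\{\pm\alpha_1,\pm\alpha_2,\pm\tilde\alpha\}$ of type $A_2$, with simple roots $\alpha_1,\alpha_2$, highest root $\tilde\alpha=\alpha_1+\alpha_2$, and $(\alpha,\alpha)=2$ for all $\alpha\in\Phi$. For $\alpha\in\Phi$, $k\in\mathbb Z$, $s_{\alpha,k}$ is the orthogonal reflection in $H_{\alpha,k}=\{v\mid(\alpha,v)=k\}$. $W$ is the group generated by all $s_{\alpha,k}$, with simple reflections $s_1=s_{\alpha_1,0}$, $s_2=s_{\alpha_2,0}$, $s_0=s_{\tilde\alpha,1}$, length $\ell$ and Bruhat order $\le$. Let $A_0=\{v\mid (v,\alpha_1)>0,(v,\alpha_2)>0,(v,\tilde\alpha)<1\}$; $w\in W$ is identified with the alcove $wA_0$. A fundamental root strip is $\{v\mid0\le(\alpha,v)\le1\}$, $\alpha\in\{\alpha_1,\alpha_2,\tilde\alpha\}$; $w$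 is spiral if $wA_0$ lies in one of them. Chambers are the six components of the complement of the union of the fundamental root strips: I: $(\alpha_1,v)>1,(\alpha_2,v)>1$; II: $(\alpha_1,v)<0,(\tilde\alpha,v)>1$; III: $(\alpha_2,v)>1,(\tilde\alpha,v)<0$; IV: $(\alpha_1,v)<0,(\alpha_2,v)<0$; V: $(\alpha_1,v)>1,(\tilde\alpha,v)<0$; VI: $(\alpha_2,v)<0,(\tilde\alpha,v)>1$. I, III, V are odd; II, IV, VI are even. An element $w\ne e$ is of Type $\tau$ if the number of simple reflections $s$ with $w<ws$ is exactly $\tau$. $\mathcal G$ is the Kac–Moody group over $\mathbb C$ of type $\tilde A_2$ with Weyl group $W$ and standard Borel $\mathcal B$; $X_w=\bigcup_{x\le w}\mathcal Bx\mathcal B/\mathcal B\subset\mathcal G/\mathcal B$ is the Schubert variety, of dimension $\ell(w)$. *)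

theory Defs
  imports "HOL-Analysis.Analysis" "HOL-Library.Poly_Mapping"
begin

section \<open>The affine Weyl group of type \<open>\<tilde>A\<^sub>2\<close>\<close>

text \<open>
  The three simple reflections, and the nodes of the affine diagram, are indexed by the
  numeral type \<open>3\<close>, whose elements are \<open>0\<close>, \<open>1\<close>, \<open>2\<close> with \<open>3 = 0\<close>.
\<close>

locale A2_plane =
  fixes \<alpha>\<^sub>1 \<alpha>\<^sub>2 :: "'v::euclidean_space"
  assumes dim_plane: "DIM('v) = 2"
    and norm_\<alpha>\<^sub>1: "\<alpha>\<^sub>1 \<bullet> \<alpha>\<^sub>1 = 2"
    and norm_\<alpha>\<^sub>2: "\<alpha>\<^sub>2 \<bullet> \<alpha>\<^sub>2 = 2"
    and inner_\<alpha>\<^sub>1_\<alpha>\<^sub>2: "\<alpha>\<^sub>1 \<bullet> \<alpha>\<^sub>2 = -1"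
begin

definition highest_root :: "'v" where
  "highest_root = \<alpha>\<^sub>1 + \<alpha>\<^sub>2"

definition pos_roots :: "'v set" where
  "pos_roots = {\<alpha>\<^sub>1, \<alpha>\<^sub>2, highest_root}"

definition roots :: "'v set" where
  "roots = pos_roots \<union> uminus ` pos_roots"

text \<open>The usual factor \<open>2 / (\<alpha>, \<alpha>)\<close> of an orthogonal reflection is \<open>1\<close> here.\<close>

definition refl :: "'v \<Rightarrow> int \<Rightarrow> 'v \<Rightarrow> 'v" where
  "refl \<alpha> k v = v - (\<alpha> \<bullet> v - of_int k) *\<^sub>R \<alpha>"

definition reflections :: "('v \<Rightarrow> 'v) set" where
  "reflections = {refl \<alpha> k | \<alpha> k. \<alpha> \<in> roots}"

text \<open>Reflections are involutions, so the monoid they generate is the group they generate.\<close>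

inductive_set W :: "('v \<Rightarrow> 'v) set" where
  W_id: "id \<in> W"
| W_step: "w \<in> W \<Longrightarrow> r \<in> reflections \<Longrightarrow> r \<circ> w \<in> W"

definition simple :: "3 \<Rightarrow> 'v \<Rightarrow> 'v" where
  "simple i = (if i = 0 then refl highest_root 1 else if i = 1 then refl \<alpha>\<^sub>1 0 else refl \<alpha>\<^sub>2 0)"

definition word :: "3 list \<Rightarrow> 'v \<Rightarrow> 'v" where
  "word is = foldr (\<lambda>i w. simple i \<circ> w) is id"

definition len :: "('v \<Rightarrow> 'v) \<Rightarrow> nat" where
  "len w = (LEAST n. \<exists>is. length is = n \<and> word is = w)"

definition bruhat_le :: "('v \<Rightarrow> 'v) \<Rightarrow> ('v \<Rightarrow> 'v) \<Rightarrow> bool" where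
  "bruhat_le = (\<lambda>u v. u \<in> W \<and> (\<exists>r\<in>reflections. v = r \<circ> u) \<and> len u < len v)\<^sup>*\<^sup>*"

definition bruhat_less :: "('v \<Rightarrow> 'v) \<Rightarrow> ('v \<Rightarrow> 'v) \<Rightarrow> bool" where
  "bruhat_less u v \<longleftrightarrow> bruhat_le u v \<and> u \<noteq> v"

definition has_type :: "('v \<Rightarrow> 'v) \<Rightarrow> nat \<Rightarrow> bool" where
  "has_type w \<tau> \<longleftrightarrow> w \<noteq> id \<and> card {s \<in> range simple. bruhat_less w (w \<circ> s)} = \<tau>"

definition A\<^sub>0 :: "'v set" where
  "A\<^sub>0 = {v. v \<bullet> \<alpha>\<^sub>1 > 0 \<and> v \<bullet> \<alpha>\<^sub>2 > 0 \<and> v \<bullet> highest_root < 1}"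

definition root_strip :: "'v \<Rightarrow> 'v set" where
  "root_strip \<alpha> = {v. 0 \<le> \<alpha> \<bullet> v \<and> \<alpha> \<bullet> v \<le> 1}"

definition spiral :: "('v \<Rightarrow> 'v) \<Rightarrow> bool" where
  "spiral w \<longleftrightarrow> (\<exists>\<alpha>\<in>pos_roots. w ` A\<^sub>0 \<subseteq> root_strip \<alpha>)"

definition chamber_I :: "'v set" where
  "chamber_I = {v. \<alpha>\<^sub>1 \<bullet> v > 1 \<and> \<alpha>\<^sub>2 \<bullet> v > 1}"

definition chamber_II :: "'v set" where
  "chamber_II = {v. \<alpha>\<^sub>1 \<bullet> v < 0 \<and> highest_root \<bullet> v > 1}"

definition chamber_III :: "'v set" where
  "chamber_III = {v. \<alpha>\<^sub>2 \<bullet> v > 1 \<and> highest_root \<bullet> v < 0}"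

definition chamber_IV :: "'v set" where
  "chamber_IV = {v. \<alpha>\<^sub>1 \<bullet> v < 0 \<and> \<alpha>\<^sub>2 \<bullet> v < 0}"

definition chamber_V :: "'v set" where
  "chamber_V = {v. \<alpha>\<^sub>1 \<bullet> v > 1 \<and> highest_root \<bullet> v < 0}"

definition chamber_VI :: "'v set" where
  "chamber_VI = {v. \<alpha>\<^sub>2 \<bullet> v < 0 \<and> highest_root \<bullet> v > 1}"

definition in_odd_chamber :: "('v \<Rightarrow> 'v) \<Rightarrow> bool" where
  "in_odd_chamber w \<longleftrightarrow> (\<exists>C\<in>{chamber_I, chamber_III, chamber_V}. w ` A\<^sub>0 \<subseteq> C)"

definition in_even_chamber :: "('v \<Rightarrow> 'v) \<Rightarrow> bool" where
  "in_even_chamber w \<longleftrightarrow> (\<exists>C\<in>{chamber_II, chamber_IV, chamber_VI}. w ` A\<^sub>0 \<subseteq> C)"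

end


section \<open>The Kac--Moody group of type \<open>\<tilde>A\<^sub>2\<close> and its flag variety\<close>

text \<open>
  The group is realised as \<open>SL\<^sub>3(\<complex>[t, t\<^sup>-\<^sup>1])\<close>, the split Kac--Moody group of type \<open>\<tilde>A\<^sub>2\<close> over \<open>\<complex>\<close>
  in the sense of Tits. Other versions of the group differ from it by a central extension, by
  the rotation torus, or by completion; the extra factors lie in the Borel subgroup, so the flag
  variety and its Schubert varieties are the same.

  A Laurent polynomial is the finitely supported map sending an exponent of \<open>t\<close> to its
  coefficient; multiplication of type \<^typ>\<open>(int, complex) poly_mapping\<close> is convolution.
  Since \<open>3 = 0\<close> in the index type, rows and columns are numbered \<open>1, 2, 3 = 0\<close>, in this order.
\<close>

type_synonym laurent = "(int, complex) poly_mapping"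
type_synonym loop_matrix = "laurent ^ 3 ^ 3"

abbreviation lcoeff :: "laurent \<Rightarrow> int \<Rightarrow> complex" where
  "lcoeff \<equiv> Poly_Mapping.lookup"

abbreviation lmonom :: "int \<Rightarrow> complex \<Rightarrow> laurent" where
  "lmonom \<equiv> Poly_Mapping.single"

definition KM_group :: "loop_matrix set" where
  "KM_group = {g. det g = 1}"

text \<open>The standard Borel subgroup: no negative powers of \<open>t\<close>, and upper triangular at \<open>t = 0\<close>.\<close>

definition Borel :: "loop_matrix set" where
  "Borel = {g \<in> KM_group.
     (\<forall>i j. \<forall>k<0. lcoeff (g $ i $ j) k = 0) \<and>
     (\<forall>(i, j)\<in>{(2, 1), (3, 1), (3, 2)}. lcoeff (g $ i $ j) 0 = 0)}"

text \<open>
  The unipotent radical of the opposite Borel subgroup: no positive powers of \<open>t\<close>, and lower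
  unitriangular at \<open>t = \<infinity>\<close>.
\<close>

definition opp_unipotent :: "loop_matrix set" where
  "opp_unipotent = {g \<in> KM_group.
     (\<forall>i j. \<forall>k>0. lcoeff (g $ i $ j) k = 0) \<and>
     (\<forall>i. lcoeff (g $ i $ i) 0 = 1) \<and>
     (\<forall>(i, j)\<in>{(1, 2), (1, 3), (2, 3)}. lcoeff (g $ i $ j) 0 = 0)}"

definition elem_matrix :: "3 \<Rightarrow> 3 \<Rightarrow> laurent \<Rightarrow> loop_matrix" where
  "elem_matrix i j f = (\<chi> k l. (if k = l then 1 else 0) + (if k = i \<and> l = j then f else 0))"

text \<open>
  The root subgroups of the simple roots \<open>\<alpha>\<^sub>1\<close>, \<open>\<alpha>\<^sub>2\<close>, \<open>\<alpha>\<^sub>0 = \<delta> - (\<alpha>\<^sub>1 + \<alpha>\<^sub>2)\<close> and of their negatives.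
  Node \<open>i\<close> belongs to the matrix position \<open>(i, i + 1)\<close>, which for \<open>i = 0\<close> is \<open>(3, 1)\<close>, and
  \<open>\<delta>\<close> corresponds to the factor \<open>t\<close>.
\<close>

definition root_elem_pos :: "3 \<Rightarrow> complex \<Rightarrow> loop_matrix" where
  "root_elem_pos i a = elem_matrix i (i + 1) (lmonom (if i = 0 then 1 else 0) a)"

definition root_elem_neg :: "3 \<Rightarrow> complex \<Rightarrow> loop_matrix" where
  "root_elem_neg i a = elem_matrix (i + 1) i (lmonom (if i = 0 then -1 else 0) a)"

definition simple_lift :: "3 \<Rightarrow> loop_matrix" where
  "simple_lift i = root_elem_pos i 1 ** root_elem_neg i (-1) ** root_elem_pos i 1"

definition word_lift :: "3 list \<Rightarrow> loop_matrix" where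
  "word_lift is = foldr (\<lambda>i n. simple_lift i ** n) is (mat 1)"

text \<open>The coset \<open>g B\<close>, a point of the flag variety.\<close>

definition flag :: "loop_matrix \<Rightarrow> loop_matrix set" where
  "flag g = {g ** b | b. b \<in> Borel}"


section \<open>Smooth points\<close>

text \<open>
  Regular functions on the ind-affine space of loop matrices: polynomials in the coefficients
  of the matrix entries. (A regular function may be an infinite sum of these, but it agrees with
  a polynomial on each finite-dimensional piece, where finitely many coefficients are nonzero.)
\<close>

inductive_set regular_funs :: "(loop_matrix \<Rightarrow> complex) set" where
  const: "(\<lambda>_. c) \<in> regular_funs"
| coeff: "(\<lambda>g. lcoeff (g $ i $ j) k) \<in> regular_funs"
| add: "f \<in> regular_funs \<Longrightarrow> h \<in> regular_funs \<Longrightarrow> (\<lambda>g. f g + h g) \<in> regular_funs"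
| mult: "f \<in> regular_funs \<Longrightarrow> h \<in> regular_funs \<Longrightarrow> (\<lambda>g. f g * h g) \<in> regular_funs"

definition zariski :: "loop_matrix topology" where
  "zariski = topology_generated_by {{g. f g \<noteq> 0} | f. f \<in> regular_funs}"

definition irreducible_space :: "'a topology \<Rightarrow> bool" where
  "irreducible_space X \<longleftrightarrow> topspace X \<noteq> {} \<and>
     (\<forall>A B. closedin X A \<and> closedin X B \<and> A \<union> B = topspace X \<longrightarrow>
        A = topspace X \<or> B = topspace X)"

text \<open>
  Dimension of \<open>Y\<close> at \<open>p\<close>, that is, the Krull dimension of its local ring at \<open>p\<close>: the supremum of
  the lengths of chains of irreducible closed subsets of \<open>Y\<close> containing \<open>p\<close>.
\<close>

definition local_dim :: "loop_matrix set \<Rightarrow> loop_matrix \<Rightarrow> enat" where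
  "local_dim Y p = Sup {enat n | n. \<exists>Z :: nat \<Rightarrow> loop_matrix set.
     (\<forall>i\<le>n. closedin (subtopology zariski Y) (Z i) \<and>
            irreducible_space (subtopology zariski (Z i)) \<and> p \<in> Z i) \<and>
     (\<forall>i<n. Z i \<subset> Z (Suc i))}"

definition lscale :: "complex \<Rightarrow> loop_matrix \<Rightarrow> loop_matrix" where
  "lscale c g = (\<chi> i j. lmonom 0 c * g $ i $ j)"

interpretation loop_space: vector_space lscale
  by unfold_locales
    (simp_all add: lscale_def vec_eq_iff single_add mult_single algebra_simps
      flip: mult.assoc)

text \<open>
  The Zariski tangent space of the reduced variety \<open>Y\<close> at \<open>p\<close>: the vectors \<open>v\<close> along which the
  derivative at \<open>p\<close> of every function vanishing on \<open>Y\<close> is zero.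
\<close>

definition tangent_space :: "loop_matrix set \<Rightarrow> loop_matrix \<Rightarrow> loop_matrix set" where
  "tangent_space Y p = {v. \<forall>f\<in>regular_funs. (\<forall>q\<in>Y. f q = 0) \<longrightarrow>
     deriv (\<lambda>s. f (p + lscale s v)) 0 = 0}"

definition regular_at :: "loop_matrix set \<Rightarrow> loop_matrix \<Rightarrow> bool" where
  "regular_at Y p \<longleftrightarrow> p \<in> Y \<and> (\<exists>Bs. finite Bs \<and> loop_space.independent Bs \<and>
     loop_space.span Bs = tangent_space Y p \<and> enat (card Bs) = local_dim Y p)"

text \<open>
  For \<open>g\<close> in the group, with \<open>U\<^sup>-\<close> the group \<^const>\<open>opp_unipotent\<close> and \<open>B\<close> the Borel subgroup,
  the translated big cell \<open>g U\<^sup>- B / B\<close> is an open neighbourhood of \<open>g B\<close> in the flag ind-variety,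
  and \<open>u \<mapsto> g u B\<close> is an isomorphism from \<open>U\<^sup>-\<close>, closed in the space of loop matrices, onto it.
  The part of a closed subvariety \<open>X\<close> in this chart is \<open>chart X g\<close>, and \<open>g B\<close> is at \<open>u = 1\<close>.
\<close>

definition chart :: "loop_matrix set set \<Rightarrow> loop_matrix \<Rightarrow> loop_matrix set" where
  "chart X g = {u \<in> opp_unipotent. flag (g ** u) \<in> X}"

definition smooth_point :: "loop_matrix set set \<Rightarrow> loop_matrix set \<Rightarrow> bool" where
  "smooth_point X P \<longleftrightarrow> (\<exists>g\<in>KM_group. P = flag g \<and> regular_at (chart X g) (mat 1))"


section \<open>Schubert varieties\<close>

context A2_plane
begin

text \<open>
  The coset \<open>x B\<close>, as a set of matrices: \<open>x\<close> is represented by the product of the lifts of the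
  simple reflections along any word for \<open>x\<close>. Two such products differ by an element of the torus,
  so the union over all words is a single coset.
\<close>

definition W_flag :: "('v \<Rightarrow> 'v) \<Rightarrow> loop_matrix set" where
  "W_flag x = \<Union> {flag (word_lift is) | is. word is = x}"

definition schubert_cell :: "('v \<Rightarrow> 'v) \<Rightarrow> loop_matrix set set" where
  "schubert_cell x = {flag (b ** n) | b n. b \<in> Borel \<and> n \<in> W_flag x}"

definition schubert_variety :: "('v \<Rightarrow> 'v) \<Rightarrow> loop_matrix set set" where
  "schubert_variety w = \<Union> {schubert_cell x | x. x \<in> W \<and> bruhat_le x w}"

end

end

theory Submission
  imports Defs
begin

text \<open>
  If \<open>x B\<close> is a smooth point of \<open>X\<^sub>w\<close>, its tangent space has dimension at most \<open>\<ell>(w)\<close>, because a chain of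
  irreducible closed subsets of \<open>X\<^sub>w\<close> is bounded by the number of parameters of the cells. The tangent
  space contains an independent vector for each reflection \<open>r\<close> with \<open>r x \<le> w\<close>, and there are at least
  \<open>\<ell>(w)\<close> of these (Deodhar's inequality). If two of the reflections moving \<open>x\<close> up have parallel
  hyperplanes, with roots \<open>\<beta>\<close> and \<open>\<beta> + k \<delta>\<close>, then the tangent space, being stable under the root group of \<open>-\<beta>\<close>,
  contains in addition a vector of imaginary weight, which is one too many. So at a smooth
  point each of the six parallel classes contributes at most one reflection moving \<open>x\<close> up.

  Elements of \<open>W\<close> are written as affine permutations of the integers. The Bruhat interval below \<open>w\<close> is
  then cut out by a box in the window of \<open>w\<close>, whose shape is that of a decreasing window for even chambers
  and an increasing one otherwise. Deodhar's inequality and the bounds on \<open>\<ell>(w) - \<ell>(x)\<close> are linear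
  arithmetic in each residue class modulo \<open>3\<close>, and the residues of the window of \<open>w\<close> encode its type.
\<close>

section \<open>Loop matrices as periodic bi-infinite matrices\<close>

text \<open>The constant 6 is the number of root directions. Exactly l(x) reflections move x down;
  so if at least l(w) reflections r satisfy r x \<le> w and each of the six parallel classes
  contains at most one that moves up, then l(w) - l(x) \<le> 6. The sharper constants depend on the
  residues modulo 3 of the window of w. The bounds are verified as explicit inequalities in
  \<open>dec_tight\<close>, \<open>inc_tight\<close> and \<open>odd_tight\<close>, with the length
  given by a closed formula. On the geometric side the obstacle is the chart: it consists of
  opposite unipotent matrices, whereas curves and cells are given by products of root groups and
  Borel elements. Passing to the chart means factoring h = u b, a linear problem for periodic banded
  matrices. It is solved twice: near s = 0 with differentiable solutions, to obtain tangent vectors,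
  and over all parameters with rational solutions, to bound the dimension.\<close>

lemma exhaust3: "i = 1 \<or> i = 2 \<or> i = (3::3)"
  by (rule exhaust_3)

text \<open>Index 0 of type \<open>3\<close> is represented by 3, so the blocks of integers are 1,
  2, 3 plus multiples of 3. This is the source of every \<open>(p - 1) div 3\<close> below.\<close>

definition row :: "3 \<Rightarrow> int" where
  "row i = (if i = 1 then 1 else if i = 2 then 2 else 3)"

lemma of_int_period: "(of_int (p + 3 * k) :: 3) = of_int p"
proof -
  have "(3 :: 3) = 0" by simp
  then show ?thesis
    by (simp only: of_int_add of_int_mult of_int_numeral mult_zero_left add_0_right)
qed

lemma row_cases: "row i \<in> {1, 2, 3}"
  by (simp add: row_def)

lemma of_int_row [simp]: "of_int (row i) = i"
  using exhaust3[of i] by (auto simp: row_def)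

lemma row_of_int: "row (of_int p) = (p - 1) mod 3 + 1"
proof -
  define k where "k = (p - 1) div 3"
  consider "p = 1 + 3 * k" "(p - 1) mod 3 = 0" | "p = 2 + 3 * k" "(p - 1) mod 3 = 1"
    | "p = 3 + 3 * k" "(p - 1) mod 3 = 2"
  proof -
    have "p = (p - 1) mod 3 + 1 + 3 * k" unfolding k_def by presburger
    moreover have "(p - 1) mod 3 = 0 \<or> (p - 1) mod 3 = 1 \<or> (p - 1) mod 3 = 2" by presburger
    ultimately show thesis using that by (elim disjE) simp_all
  qed
  then show ?thesis
  proof cases
    case 1
    have "(of_int p :: 3) = of_int 1" unfolding 1 by (rule of_int_period)
    then show ?thesis unfolding 1(2) by (simp add: row_def)
  next
    case 2
    have "(of_int p :: 3) = of_int 2" unfolding 2 by (rule of_int_period)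
    then show ?thesis unfolding 2(2) by (simp add: row_def)
  next
    case 3
    have "(of_int p :: 3) = of_int 3" unfolding 3 by (rule of_int_period)
    then show ?thesis unfolding 3(2) by (simp add: row_def)
  qed
qed

text \<open>A loop matrix is a bi-infinite matrix with period \<open>3\<close> along the diagonals: \<open>t\<^sup>k\<close> in position
  \<open>(i, j)\<close> becomes the entries in the positions \<open>(p, q + 3 k)\<close> with \<open>p \<equiv> i\<close> and \<open>q \<equiv> j\<close> in one block. The
  Borel subgroup is then the upper triangular one.\<close>

definition ent :: "loop_matrix \<Rightarrow> int \<Rightarrow> int \<Rightarrow> complex" where
  "ent g p q = lcoeff (g $ of_int p $ of_int q) ((q - 1) div 3 - (p - 1) div 3)"

lemma row_div [simp]: "(row i + 3 * k - 1) div 3 = k"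
  using row_cases[of i] by auto

lemma lcoeff_ent: "lcoeff (g $ i $ j) k = ent g (row i) (row j + 3 * k)"
  using row_div[of j k] row_div[of i 0] unfolding ent_def of_int_period of_int_row by simp

lemma ent_period: "ent g (p + 3 * k) (q + 3 * k) = ent g p q"
proof -
  have "(p + 3 * k - 1) div 3 = (p - 1) div 3 + k" "(q + 3 * k - 1) div 3 = (q - 1) div 3 + k"
    by presburger+
  then show ?thesis by (simp only: ent_def of_int_period add_diff_cancel_right)
qed

lemma ent_eqI: "(\<And>p q. ent g p q = ent h p q) \<Longrightarrow> g = h"
  by (simp add: vec_eq_iff poly_mapping_eq_iff fun_eq_iff lcoeff_ent)

lemma lcoeff_mult:
  assumes "finite S" "Poly_Mapping.keys f \<subseteq> S"
  shows "lcoeff (f * g) k = (\<Sum>l\<in>S. lcoeff f l * lcoeff g (k - l))"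
proof -
  have *: "Sum_any (\<lambda>q. lcoeff g q when k = l + q) = lcoeff g (k - l)" for l
  proof -
    have "(\<lambda>q. lcoeff g q when k = l + q) = (\<lambda>q. lcoeff g q when k - l = q)"
      by (auto simp: fun_eq_iff when_def)
    then show ?thesis by (simp only: Sum_any_when_equal')
  qed
  have "lcoeff (f * g) k = Sum_any (\<lambda>l. lcoeff f l * lcoeff g (k - l))"
    by (simp add: lookup_mult *)
  also have "\<dots> = (\<Sum>l\<in>S. lcoeff f l * lcoeff g (k - l))"
    using assms by (intro Sum_any.expand_superset) (auto simp: in_keys_iff)
  finally show ?thesis .
qed

text \<open>A middle index \<open>l\<close> and an exponent \<open>a\<close> of t combine into the
  single integer \<open>row l + 3 * (a + ?P)\<close>, which merges convolution and matrix product
  into one sum over the integers. Any finite \<open>S\<close> carrying the nonzero terms may be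
  used: \<open>{}\<close> proves vanishing, a singleton evaluates a product with a monomial
  matrix.\<close>

lemma ent_mult:
  assumes "finite S" "\<And>r. r \<notin> S \<Longrightarrow> ent g p r * ent h r q = 0"
  shows "ent (g ** h) p q = (\<Sum>r\<in>S. ent g p r * ent h r q)"
proof -
  let ?i = "of_int p :: 3" and ?j = "of_int q :: 3"
  let ?P = "(p - 1) div 3" and ?Q = "(q - 1) div 3"
  define T where "T = (\<Union>l::3. Poly_Mapping.keys (g $ ?i $ l))"
  have T: "finite T" "Poly_Mapping.keys (g $ ?i $ l) \<subseteq> T" for l
    unfolding T_def by auto
  define \<phi> where "\<phi> = (\<lambda>(l :: 3, a). row l + 3 * (a + ?P))"
  have inj: "inj_on \<phi> X" for X
  proof (rule inj_onI)
    fix x y assume "\<phi> x = \<phi> y"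
    obtain l a l' a' where xy: "x = (l, a)" "y = (l', a')" by (metis surj_pair)
    with \<open>\<phi> x = \<phi> y\<close> have e: "row l + 3 * (a + ?P) = row l' + 3 * (a' + ?P)" by (simp add: \<phi>_def)
    from arg_cong[OF this, of "of_int :: int \<Rightarrow> 3"] have "l = l'"
      unfolding of_int_period of_int_row .
    with e xy show "x = y" by simp
  qed
  have \<phi>: "lcoeff (g $ ?i $ l) a * lcoeff (h $ l $ ?j) (?Q - ?P - a)
      = ent g p (\<phi> (l, a)) * ent h (\<phi> (l, a)) q" for l a
    unfolding ent_def \<phi>_def prod.case of_int_period of_int_row row_div
    by (simp add: diff_diff_eq add.commute)
  have "ent (g ** h) p q = (\<Sum>l\<in>UNIV. lcoeff (g $ ?i $ l * h $ l $ ?j) (?Q - ?P))"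
    by (simp add: ent_def matrix_matrix_mult_def lookup_sum)
  also have "\<dots> = (\<Sum>l\<in>UNIV. \<Sum>a\<in>T. lcoeff (g $ ?i $ l) a * lcoeff (h $ l $ ?j) (?Q - ?P - a))"
    by (intro sum.cong refl lcoeff_mult T)
  also have "\<dots> = (\<Sum>x\<in>UNIV \<times> T. ent g p (\<phi> x) * ent h (\<phi> x) q)"
    by (simp add: \<phi> sum.cartesian_product)
  also have "\<dots> = (\<Sum>r\<in>\<phi> ` (UNIV \<times> T). ent g p r * ent h r q)"
    by (simp add: sum.reindex[OF inj])
  also have "\<dots> = (\<Sum>r\<in>S \<union> \<phi> ` (UNIV \<times> T). ent g p r * ent h r q)"
  proof (rule sum.mono_neutral_left)
    show "finite (S \<union> \<phi> ` (UNIV \<times> T))" using assms(1) T(1) by auto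
    show "\<forall>r\<in>S \<union> \<phi> ` (UNIV \<times> T) - \<phi> ` (UNIV \<times> T). ent g p r * ent h r q = 0"
    proof
      fix r assume r: "r \<in> S \<union> \<phi> ` (UNIV \<times> T) - \<phi> ` (UNIV \<times> T)"
      let ?a = "(r - 1) div 3 - ?P"
      have "r = \<phi> (of_int r, ?a)" by (simp add: \<phi>_def row_of_int)
      with r have "?a \<notin> T" by blast
      then have "?a \<notin> Poly_Mapping.keys (g $ ?i $ of_int r)" using T(2) by blast
      then show "ent g p r * ent h r q = 0" by (simp add: ent_def in_keys_iff)
    qed
  qed auto
  also have "\<dots> = (\<Sum>r\<in>S. ent g p r * ent h r q)"
    using assms T(1) by (intro sum.mono_neutral_right) auto
  finally show ?thesis .
qed

lemma ent_one: "ent (mat 1) p q = (if p = q then 1 else 0)"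
proof (cases "p = q")
  case False
  show ?thesis
  proof (cases "(of_int p :: 3) = of_int q")
    case True
    then have "(p - 1) mod 3 = (q - 1) mod 3" by (metis row_of_int add_right_cancel)
    with False have "(p - 1) div 3 \<noteq> (q - 1) div 3" by presburger
    with False True show ?thesis by (simp add: ent_def mat_def lookup_one)
  qed (use False in \<open>simp add: ent_def mat_def\<close>)
qed (simp add: ent_def mat_def)

lemma ent_add: "ent (g + h) p q = ent g p q + ent h p q"
  by (simp add: ent_def lookup_add)

lemma ent_diff: "ent (g - h) p q = ent g p q - ent h p q"
  by (simp add: ent_def lookup_minus)

lemma ent_zero [simp]: "ent 0 p q = 0"
  by (simp add: ent_def)

lemma ent_lscale: "ent (lscale c g) p q = c * ent g p q"
proof -
  have "lcoeff (lmonom 0 c * f) k = c * lcoeff f k" for f k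
    using lcoeff_mult[of "{0}" "lmonom 0 c" f k] by (simp add: lookup_single)
  then show ?thesis by (simp add: ent_def lscale_def)
qed

text \<open>Only finitely many exponents occur in the nine entries. The band is where the triangular
  inductions below start: far from the diagonal everything vanishes.\<close>

lemma ent_banded: "\<exists>N\<ge>0. \<forall>p q. \<bar>p - q\<bar> > N \<longrightarrow> ent g p q = 0"
proof -
  define T where "T = (\<Union>i::3. \<Union>j::3. Poly_Mapping.keys (g $ i $ j))"
  have "finite T" unfolding T_def by auto
  then obtain K where K: "\<And>k. k \<in> T \<Longrightarrow> \<bar>k\<bar> \<le> K"
    by (metis finite_imageI Max_ge image_eqI)
  show ?thesis
  proof (intro exI conjI allI impI)
    fix p q :: int assume a: "\<bar>p - q\<bar> > 3 * \<bar>K\<bar> + 3"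
    have "\<bar>(q - 1) div 3 - (p - 1) div 3\<bar> > K" using a by linarith
    then have "(q - 1) div 3 - (p - 1) div 3 \<notin> T" using K by (meson not_le)
    then show "ent g p q = 0" unfolding ent_def T_def by (auto simp: in_keys_iff)
  qed simp
qed

lemma finite_ent_row: "finite {q. ent g p q \<noteq> 0}"
proof -
  obtain N where N: "\<And>p q. \<bar>p - q\<bar> > N \<Longrightarrow> ent g p q = 0" using ent_banded by metis
  have "{q. ent g p q \<noteq> 0} \<subseteq> {p - N..p + N}" using N by (auto simp: not_less) (smt (verit))+
  then show ?thesis using finite_subset by blast
qed

text \<open>Matrices are built from here on by prescribing periodic entries; finiteness of the rows
  supplies the finite supports of the Laurent polynomials.\<close>

lemma ex_ent:
  assumes per: "\<And>p q k. F (p + 3 * k) (q + 3 * k) = F p q" and fin: "\<And>p. finite {q. F p q \<noteq> 0}"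
  shows "\<exists>g. ent g = F"
proof -
  define g :: loop_matrix where
    "g = (\<chi> i j. Poly_Mapping.Abs_poly_mapping (\<lambda>k. F (row i) (row j + 3 * k)))"
  have "finite {k. F (row i) (row j + 3 * k) \<noteq> 0}" for i j
  proof -
    have "inj (\<lambda>k::int. row j + 3 * k)" by (auto simp: inj_def)
    from finite_vimageI[OF fin[of "row i"] this] show ?thesis by (simp add: vimage_def)
  qed
  then have l: "lcoeff (g $ i $ j) k = F (row i) (row j + 3 * k)" for i j k
    unfolding g_def by (simp add: Abs_poly_mapping_inverse)
  have "ent g p q = F p q" for p q
  proof -
    let ?P = "(p - 1) div 3" and ?Q = "(q - 1) div 3"
    have "ent g p q = F (row (of_int p)) (row (of_int q) + 3 * (?Q - ?P))" by (simp add: ent_def l)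
    also have "\<dots> = F (row (of_int p) + 3 * ?P) (row (of_int q) + 3 * (?Q - ?P) + 3 * ?P)"
      by (rule per[symmetric])
    also have "row (of_int p) + 3 * ?P = p" by (simp add: row_of_int)
    also have "row (of_int q) + 3 * (?Q - ?P) + 3 * ?P = q" by (simp add: row_of_int algebra_simps)
    finally show ?thesis .
  qed
  then show ?thesis by blast
qed

section \<open>Triangular matrices, determinants, and factorisation into lower and upper
  parts\<close>

definition upper :: "loop_matrix \<Rightarrow> bool" where
  "upper g \<longleftrightarrow> (\<forall>p q. q < p \<longrightarrow> ent g p q = 0)"

definition lower_uni :: "loop_matrix \<Rightarrow> bool" where
  "lower_uni g \<longleftrightarrow> (\<forall>p q. p < q \<longrightarrow> ent g p q = 0) \<and> (\<forall>p. ent g p p = 1)"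

lemma three_neq [simp]: "(1::3) \<noteq> 2" "(2::3) \<noteq> 1" "(1::3) \<noteq> 3" "(3::3) \<noteq> 1" "(2::3) \<noteq> 3" "(3::3) \<noteq> 2"
  by simp_all

lemma row_simps [simp]: "row 1 = 1" "row 2 = 2" "row 3 = 3"
  by (simp_all add: row_def)

lemma upperD:
  assumes "upper g"
  shows "k < 0 \<Longrightarrow> lcoeff (g $ i $ j) k = 0" "row j < row i \<Longrightarrow> lcoeff (g $ i $ j) 0 = 0"
proof -
  show "lcoeff (g $ i $ j) k = 0" if "k < 0"
  proof -
    have "row j + 3 * k < row i" using row_cases[of i] row_cases[of j] that by auto
    then show ?thesis using assms by (simp add: upper_def lcoeff_ent)
  qed
  show "lcoeff (g $ i $ j) 0 = 0" if "row j < row i"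
    using that assms by (simp add: upper_def lcoeff_ent)
qed

lemma lower_uniD:
  assumes "lower_uni g"
  shows "k > 0 \<Longrightarrow> lcoeff (g $ i $ j) k = 0" "row i < row j \<Longrightarrow> lcoeff (g $ i $ j) 0 = 0"
    "lcoeff (g $ i $ i) 0 = 1"
proof -
  show "lcoeff (g $ i $ j) k = 0" if "k > 0"
  proof -
    have "row j + 3 * k > row i" using row_cases[of i] row_cases[of j] that by auto
    then show ?thesis using assms by (simp add: lower_uni_def lcoeff_ent)
  qed
  show "lcoeff (g $ i $ j) 0 = 0" if "row i < row j"
    using that assms by (simp add: lower_uni_def lcoeff_ent)
  show "lcoeff (g $ i $ i) 0 = 1"
    using assms by (simp add: lower_uni_def lcoeff_ent)
qed

lemma Borel_iff: "g \<in> Borel \<longleftrightarrow> det g = 1 \<and> upper g"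
proof
  assume g: "g \<in> Borel"
  have "ent g p q = 0" if "q < p" for p q
  proof (cases "(p - 1) div 3 = (q - 1) div 3")
    case True
    let ?i = "of_int p :: 3" and ?j = "of_int q :: 3"
    have "row ?j < row ?i" using True that unfolding row_of_int by presburger
    then have "(?i, ?j) \<in> {(2, 1), (3, 1), (3, 2)}"
      using exhaust3[of ?i] exhaust3[of ?j] by (auto simp del: of_int_eq_1_iff)
    then show ?thesis using g True by (auto simp: Borel_def ent_def)
  next
    case False
    then have "(q - 1) div 3 - (p - 1) div 3 < 0" using that by (smt (verit) zdiv_mono1)
    then show ?thesis using g by (simp add: Borel_def ent_def)
  qed
  then show "det g = 1 \<and> upper g" using g by (auto simp: Borel_def KM_group_def upper_def)
next
  assume g: "det g = 1 \<and> upper g"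
  then show "g \<in> Borel"
    by (auto simp: Borel_def KM_group_def upperD)
qed

lemma opp_unipotent_iff: "g \<in> opp_unipotent \<longleftrightarrow> det g = 1 \<and> lower_uni g"
proof
  assume g: "g \<in> opp_unipotent"
  have "ent g p q = 0" if "p < q" for p q
  proof (cases "(p - 1) div 3 = (q - 1) div 3")
    case True
    let ?i = "of_int p :: 3" and ?j = "of_int q :: 3"
    have "row ?i < row ?j" using True that unfolding row_of_int by presburger
    then have "(?i, ?j) \<in> {(1, 2), (1, 3), (2, 3)}"
      using exhaust3[of ?i] exhaust3[of ?j] by (auto simp del: of_int_eq_1_iff)
    then show ?thesis using g True by (auto simp: opp_unipotent_def ent_def)
  next
    case False
    then have "(q - 1) div 3 - (p - 1) div 3 > 0" using that by (smt (verit) zdiv_mono1)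
    then show ?thesis using g by (simp add: opp_unipotent_def ent_def)
  qed
  moreover have "ent g p p = 1" for p using g by (simp add: opp_unipotent_def ent_def)
  ultimately show "det g = 1 \<and> lower_uni g"
    using g by (auto simp: opp_unipotent_def KM_group_def lower_uni_def)
next
  assume g: "det g = 1 \<and> lower_uni g"
  then show "g \<in> opp_unipotent"
    by (auto simp: opp_unipotent_def KM_group_def lower_uniD)
qed

lemma KM_inverse:
  assumes "g \<in> KM_group"
  obtains h where "g ** h = mat 1" "h ** g = mat 1" "h \<in> KM_group"
proof -
  define C where "C = (\<lambda>i j k l. g $ i $ j * g $ k $ l - g $ i $ l * g $ k $ j)"
  \<comment> \<open>The adjugate of \<open>g\<close>, with \<open>C\<close> its two by two minors;
    it is the inverse because the determinant is 1.\<close>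
  define h :: loop_matrix where "h = vector [
    vector [C 2 2 3 3, - C 1 2 3 3, C 1 2 2 3],
    vector [- C 2 1 3 3, C 1 1 3 3, - C 1 1 2 3],
    vector [C 2 1 3 2, - C 1 1 3 2, C 1 1 2 2]]"
  have d: "det g = 1" using assms by (simp add: KM_group_def)
  have h: "g ** h = mat 1"
    using d unfolding det_3 h_def C_def
    by (simp add: vec_eq_iff forall_3 matrix_matrix_mult_def sum_3 mat_def algebra_simps)
  have h': "h ** g = mat 1"
    using d unfolding det_3 h_def C_def
    by (simp add: vec_eq_iff forall_3 matrix_matrix_mult_def sum_3 mat_def algebra_simps)
  have "det h = 1" using arg_cong[OF h, of det] d by (simp add: det_mul)
  with h h' show ?thesis by (intro that) (auto simp: KM_group_def)
qed

lemma KM_mult: "g \<in> KM_group \<Longrightarrow> h \<in> KM_group \<Longrightarrow> g ** h \<in> KM_group"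
  by (simp add: KM_group_def det_mul)

lemma KM_one: "mat 1 \<in> KM_group"
  by (simp add: KM_group_def)

lemma upper_mult:
  assumes "upper g" "upper h" shows "upper (g ** h)"
  unfolding upper_def
proof (intro allI impI)
  fix p q :: int assume "q < p"
  have "ent g p r * ent h r q = 0" for r
    using assms \<open>q < p\<close> by (cases "r < p") (auto simp: upper_def)
  then show "ent (g ** h) p q = 0" by (subst ent_mult[of "{}"]) auto
qed

lemma Borel_mult: "g \<in> Borel \<Longrightarrow> h \<in> Borel \<Longrightarrow> g ** h \<in> Borel"
  by (simp add: Borel_iff det_mul upper_mult)

lemma Borel_one: "mat 1 \<in> Borel"
  by (simp add: Borel_iff upper_def ent_one)

lemma Borel_KM: "b \<in> Borel \<Longrightarrow> b \<in> KM_group"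
  by (simp add: Borel_def)

lemma lcoeff_mult_nonneg:
  assumes "\<And>k. k < 0 \<Longrightarrow> lcoeff f k = 0" "\<And>k. k < 0 \<Longrightarrow> lcoeff g k = 0"
  shows "k < 0 \<Longrightarrow> lcoeff (f * g) k = 0" "lcoeff (f * g) 0 = lcoeff f 0 * lcoeff g 0"
proof -
  have *: "lcoeff (f * g) k = (\<Sum>l\<in>insert 0 (Poly_Mapping.keys f). lcoeff f l * lcoeff g (k - l))" for k
    by (rule lcoeff_mult) auto
  show "lcoeff (f * g) k = 0" if "k < 0"
    unfolding * by (rule sum.neutral) (use assms that in \<open>smt (verit) mult_eq_0_iff\<close>)
  have "lcoeff (f * g) 0 = (\<Sum>l\<in>{0}. lcoeff f l * lcoeff g (0 - l))"
    unfolding * by (rule sum.mono_neutral_right) (use assms in \<open>auto, smt (verit)\<close>)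
  then show "lcoeff (f * g) 0 = lcoeff f 0 * lcoeff g 0" by simp
qed

lemma lcoeff_mult_nonpos:
  assumes "\<And>k. k > 0 \<Longrightarrow> lcoeff f k = 0" "\<And>k. k > 0 \<Longrightarrow> lcoeff g k = 0"
  shows "k > 0 \<Longrightarrow> lcoeff (f * g) k = 0" "lcoeff (f * g) 0 = lcoeff f 0 * lcoeff g 0"
proof -
  have *: "lcoeff (f * g) k = (\<Sum>l\<in>insert 0 (Poly_Mapping.keys f). lcoeff f l * lcoeff g (k - l))" for k
    by (rule lcoeff_mult) auto
  show "lcoeff (f * g) k = 0" if "k > 0"
    unfolding * by (rule sum.neutral) (use assms that in \<open>smt (verit) mult_eq_0_iff\<close>)
  have "lcoeff (f * g) 0 = (\<Sum>l\<in>{0}. lcoeff f l * lcoeff g (0 - l))"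
    unfolding * by (rule sum.mono_neutral_right) (use assms in \<open>auto, smt (verit)\<close>)
  then show "lcoeff (f * g) 0 = lcoeff f 0 * lcoeff g 0" by simp
qed

text \<open>On polynomials in t the constant coefficient is multiplicative, and at t = 0 the matrix
  is upper triangular. \<open>det_lower_uni\<close> is the same argument at t = infinity.\<close>

lemma det_upper:
  assumes "upper g"
  shows "k < 0 \<Longrightarrow> lcoeff (det g) k = 0" "lcoeff (det g) 0 = ent g 1 1 * ent g 2 2 * ent g 3 3"
proof -
  note n = lcoeff_mult_nonneg
  have u: "lcoeff (g $ i $ j) k = 0" if "k < 0" for i j k using assms that by (rule upperD)
  have z: "lcoeff (g $ 2 $ 1) 0 = 0" "lcoeff (g $ 3 $ 1) 0 = 0" "lcoeff (g $ 3 $ 2) 0 = 0"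
    using upperD(2)[OF assms] by simp_all
  show "lcoeff (det g) k = 0" if "k < 0"
    unfolding det_3 lookup_add lookup_minus using that by (simp add: n u)
  show "lcoeff (det g) 0 = ent g 1 1 * ent g 2 2 * ent g 3 3"
    unfolding det_3 lookup_add lookup_minus by (simp add: n u z) (simp add: lcoeff_ent)
qed

lemma det_lower_uni:
  assumes "lower_uni g"
  shows "k > 0 \<Longrightarrow> lcoeff (det g) k = 0" "lcoeff (det g) 0 = 1"
proof -
  note n = lcoeff_mult_nonpos
  have u: "lcoeff (g $ i $ j) k = 0" if "k > 0" for i j k using assms that by (rule lower_uniD)
  have z: "lcoeff (g $ 1 $ 2) 0 = 0" "lcoeff (g $ 1 $ 3) 0 = 0" "lcoeff (g $ 2 $ 3) 0 = 0"
    "lcoeff (g $ i $ i) 0 = 1" for i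
    using lower_uniD(2,3)[OF assms] by simp_all
  show "lcoeff (det g) k = 0" if "k > 0"
    unfolding det_3 lookup_add lookup_minus using that by (simp add: n u)
  show "lcoeff (det g) 0 = 1"
    unfolding det_3 lookup_add lookup_minus by (simp add: n u z)
qed

lemma Borel_diag: "b \<in> Borel \<Longrightarrow> ent b p p \<noteq> 0"
proof -
  assume b: "b \<in> Borel"
  have *: "ent b 1 1 * ent b 2 2 * ent b 3 3 = 1"
    using det_upper(2)[of b] b by (simp add: Borel_iff lookup_one)
  have "ent b p p = ent b (row (of_int p)) (row (of_int p))"
    using ent_period[of b "row (of_int p)" "(p - 1) div 3" "row (of_int p)"] by (simp add: row_of_int)
  moreover have "ent b (row i) (row i) \<noteq> 0" for i
    using row_cases[of i] * by auto
  ultimately show ?thesis by metis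
qed

text \<open>In each column of the inverse the induction starts below the band and climbs to the
  diagonal: in row \<open>p\<close> of \<open>b ** c = mat 1\<close> every term but
  \<open>ent b p p * ent c p q\<close> vanishes, and the diagonal of \<open>b\<close> is
  nonzero.\<close>

lemma Borel_inverse:
  assumes "b \<in> Borel"
  obtains c where "b ** c = mat 1" "c ** b = mat 1" "c \<in> Borel"
proof -
  obtain c where c: "b ** c = mat 1" "c ** b = mat 1" "c \<in> KM_group"
    using KM_inverse Borel_KM assms by metis
  have b: "upper b" using assms by (simp add: Borel_iff)
  obtain N where N: "\<And>p q. \<bar>p - q\<bar> > N \<Longrightarrow> ent c p q = 0" using ent_banded by metis
  have "ent c p q = 0" if "q < p" for p q
    using that
  proof (induction "nat (q + N + 1 - p)" arbitrary: p rule: less_induct)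
    case less
    show ?case
    proof (cases "p > q + N")
      case True
      then show ?thesis by (intro N) auto
    next
      case False
      have "0 = ent (b ** c) p q" using less.prems by (simp add: c ent_one)
      also have "\<dots> = (\<Sum>r\<in>{p}. ent b p r * ent c r q)"
      proof (rule ent_mult)
        fix r assume "r \<notin> {p}"
        show "ent b p r * ent c r q = 0"
        proof (cases "r < p")
          case True
          then show ?thesis using b by (simp add: upper_def)
        next
          case f: False
          have "ent c r q = 0" using \<open>r \<notin> {p}\<close> f False less.prems by (intro less.hyps) auto
          then show ?thesis by simp
        qed
      qed simp
      finally show ?thesis using Borel_diag[OF assms] by simp
    qed
  qed
  then have "c \<in> Borel" using c by (simp add: Borel_iff upper_def KM_group_def)
  with c show ?thesis by (intro that)
qed

lemma flag_mem: "g \<in> flag g"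
  unfolding flag_def using Borel_one by (auto intro!: exI[of _ "mat 1"])

lemma flag_mult [simp]: "b \<in> Borel \<Longrightarrow> flag (g ** b) = flag g"
proof -
  assume b: "b \<in> Borel"
  obtain c where c: "b ** c = mat 1" "c \<in> Borel" using Borel_inverse[OF b] by metis
  have "flag (g ** b) \<subseteq> flag g"
    unfolding flag_def using b by (auto simp flip: matrix_mul_assoc intro: Borel_mult)
  moreover have "g ** d \<in> flag (g ** b)" if "d \<in> Borel" for d
  proof -
    have "g ** d = (g ** b) ** (c ** d)"
      by (simp add: matrix_mul_assoc) (simp add: c flip: matrix_mul_assoc)
    then show ?thesis unfolding flag_def using c that by (blast intro: Borel_mult)
  qed
  ultimately show ?thesis unfolding flag_def by blast
qed

lemma flag_eqD: "flag g = flag h \<Longrightarrow> \<exists>b\<in>Borel. g = h ** b"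
  using flag_mem[of g] by (auto simp: flag_def)

text \<open>Both factors have the same determinant. One is a polynomial in the inverse of t with
  constant term 1, the other a polynomial in t, so both determinants are 1.\<close>

lemma lower_upper_factor:
  assumes "h \<in> KM_group" "lower_uni u" "upper c" "u = h ** c"
  shows "u \<in> opp_unipotent" "c \<in> Borel"
proof -
  have e: "det u = det c" using assms by (simp add: det_mul KM_group_def)
  have "lcoeff (det u) k = lcoeff 1 k" for k
    using det_lower_uni[OF assms(2)] det_upper(1)[OF assms(3)] e
    by (cases k "0::int" rule: linorder_cases) (auto simp: lookup_one)
  then have "det u = 1" by (simp add: poly_mapping_eq_iff fun_eq_iff)
  then show "u \<in> opp_unipotent" "c \<in> Borel"
    using assms e by (auto simp: opp_unipotent_iff Borel_iff)
qed

text \<open>This is the triviality of the intersection of the Borel subgroup with the opposite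
  unipotent group. The part of \<open>y\<close> on and above the diagonal is computed column by
  column, from beyond the band down to the diagonal.\<close>

lemma lower_upper_unique:
  assumes u: "lower_uni u" "lower_uni v" and y: "upper y" and eq: "v = u ** y"
  shows "v = u"
proof -
  obtain N where N: "\<And>p q. \<bar>p - q\<bar> > N \<Longrightarrow> ent y p q = 0" using ent_banded by metis
  have *: "ent y p q = ent (mat 1) p q" if "p \<le> q" for p q
    using that
  proof (induction "nat (p - q + N + 1)" arbitrary: p rule: less_induct)
    case less
    have "ent (mat 1) p q = ent v p q"
      using u(2) less.prems by (auto simp: lower_uni_def ent_one)
    also have "\<dots> = (\<Sum>r\<in>{p}. ent u p r * ent y r q)"
      unfolding eq
    proof (rule ent_mult)
      fix r assume r: "r \<notin> {p}"
      show "ent u p r * ent y r q = 0"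
      proof (cases "r < p")
        case True
        have "ent y r q = 0"
        proof (cases "q - r > N")
          case True
          then show ?thesis by (intro N) auto
        next
          case False
          have "ent y r q = ent (mat 1) r q"
            using True False less.prems by (intro less.hyps) auto
          then show ?thesis using True less.prems by (simp add: ent_one)
        qed
        then show ?thesis by simp
      next
        case False
        then show ?thesis using r u by (auto simp: lower_uni_def)
      qed
    qed simp
    finally show ?case using u by (simp add: lower_uni_def)
  qed
  have "y = mat 1"
  proof (rule ent_eqI)
    fix p q show "ent y p q = ent (mat 1) p q"
      using * y by (cases "p \<le> q") (auto simp: upper_def ent_one)
  qed
  then show ?thesis using eq by simp
qed

section \<open>Tangent vectors of curves\<close>

text \<open>Gaussian elimination near a point where the coefficient matrix is the identity: the
  pivot stays nonzero nearby, and the Schur complement \<open>?A\<close> is again the identity at 0,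
  so the induction continues.\<close>

lemma solve_linear_near:
  fixes A :: "'i \<Rightarrow> 'i \<Rightarrow> complex \<Rightarrow> complex"
  assumes "finite P" "\<And>i j. i \<in> P \<Longrightarrow> j \<in> P \<Longrightarrow> A i j field_differentiable (at 0)"
    "\<And>i j. i \<in> P \<Longrightarrow> j \<in> P \<Longrightarrow> A i j 0 = (if i = j then 1 else 0)"
    "\<And>i. i \<in> P \<Longrightarrow> r i field_differentiable (at 0)"
  shows "\<exists>c. (\<forall>j\<in>P. c j field_differentiable (at 0)) \<and>
    (\<forall>\<^sub>F s in nhds 0. \<forall>i\<in>P. (\<Sum>j\<in>P. A i j s * c j s) = r i s)"
  using assms
proof (induction P arbitrary: A r rule: finite_induct)
  case (insert n P)
  have ne: "A n n 0 \<noteq> 0" using insert.prems(2) by simp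
  have d: "A i j field_differentiable (at 0)" if "i \<in> insert n P" "j \<in> insert n P" for i j
    using insert.prems(1) that by blast
  have dr: "r i field_differentiable (at 0)" if "i \<in> insert n P" for i
    using insert.prems(3) that by blast
  let ?A = "\<lambda>i j s. A i j s - A i n s * A n j s / A n n s"
  let ?r = "\<lambda>i s. r i s - A i n s * r n s / A n n s"
  have "\<exists>c. (\<forall>j\<in>P. c j field_differentiable (at 0)) \<and>
    (\<forall>\<^sub>F s in nhds 0. \<forall>i\<in>P. (\<Sum>j\<in>P. ?A i j s * c j s) = ?r i s)"
  proof (rule insert.IH)
    show "?A i j field_differentiable (at 0)" if "i \<in> P" "j \<in> P" for i j
      using that ne by (intro field_differentiable_diff field_differentiable_divide
          field_differentiable_mult d) auto
    show "?A i j 0 = (if i = j then 1 else 0)" if "i \<in> P" "j \<in> P" for i j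
      using that insert.hyps insert.prems(2) by auto
    show "?r i field_differentiable (at 0)" if "i \<in> P" for i
      using that ne by (intro field_differentiable_diff field_differentiable_divide
          field_differentiable_mult d dr) auto
  qed
  then obtain c where c: "\<And>j. j \<in> P \<Longrightarrow> c j field_differentiable (at 0)"
    "\<forall>\<^sub>F s in nhds 0. \<forall>i\<in>P. (\<Sum>j\<in>P. ?A i j s * c j s) = ?r i s" by blast
  define c' where "c' = c(n := \<lambda>s. (r n s - (\<Sum>j\<in>P. A n j s * c j s)) / A n n s)"
  have "isCont (A n n) 0" using d by (intro field_differentiable_imp_continuous_at) auto
  then have "\<forall>\<^sub>F s in nhds 0. A n n s \<noteq> 0"
    using ne unfolding isCont_def by (simp add: eventually_nhds_conv_at tendsto_imp_eventually_ne)
  with c(2) have "\<forall>\<^sub>F s in nhds 0. \<forall>i\<in>insert n P. (\<Sum>j\<in>insert n P. A i j s * c' j s) = r i s"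
  proof eventually_elim
    case (elim s)
    have e: "c' n s = (r n s - (\<Sum>j\<in>P. A n j s * c j s)) / A n n s" by (simp add: c'_def)
    have sum: "(\<Sum>j\<in>P. A i j s * c' j s) = (\<Sum>j\<in>P. A i j s * c j s)" for i
      using insert.hyps by (intro sum.cong) (auto simp: c'_def)
    show ?case
    proof
      fix i assume i: "i \<in> insert n P"
      have "(\<Sum>j\<in>insert n P. A i j s * c' j s) = A i n s * c' n s + (\<Sum>j\<in>P. A i j s * c j s)"
        using insert.hyps by (simp add: sum)
      also have "\<dots> = r i s"
      proof (cases "i = n")
        case True
        then show ?thesis using elim(2) by (simp add: e)
      next
        case False
        with i elim(1) have "(\<Sum>j\<in>P. ?A i j s * c j s) = ?r i s" by blast
        then have "(\<Sum>j\<in>P. A i j s * c j s) - A i n s * (\<Sum>j\<in>P. A n j s * c j s) / A n n s = ?r i s"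
          by (simp add: left_diff_distrib sum_subtractf sum_distrib_left sum_divide_distrib mult.assoc)
        then have "(\<Sum>j\<in>P. A i j s * c j s) =
            (r i s - A i n s * r n s / A n n s) + A i n s * (\<Sum>j\<in>P. A n j s * c j s) / A n n s"
          by (simp only: diff_eq_eq)
        then show ?thesis
          unfolding e by (simp only: right_diff_distrib diff_divide_distrib times_divide_eq_right) simp
      qed
      finally show "(\<Sum>j\<in>insert n P. A i j s * c' j s) = r i s" .
    qed
  qed
  moreover have "c' j field_differentiable (at 0)" if "j \<in> insert n P" for j
  proof (cases "j = n")
    case True
    have "(\<lambda>s. (r n s - (\<Sum>j\<in>P. A n j s * c j s)) / A n n s) field_differentiable (at 0)"
      using ne by (intro field_differentiable_diff field_differentiable_divide dr
          field_differentiable_sum field_differentiable_mult d c(1)) auto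
    then show ?thesis using True by (simp add: c'_def)
  next
    case False
    then show ?thesis using that c(1) by (simp add: c'_def)
  qed
  ultimately show ?case by blast
qed auto

text \<open>By the sum and product rules the derivative depends only on the velocity at the point. A
  curve inside \<open>Y\<close> with velocity \<open>V\<close> can therefore replace the straight
  line in the definition of \<open>tangent_space\<close>.\<close>

lemma regular_fun_derivative:
  assumes "f \<in> regular_funs" "u 0 = mat 1"
    "\<And>p q. ((\<lambda>s. ent (u s) p q) has_field_derivative ent V p q) (at 0)"
  shows "\<exists>D. ((\<lambda>s. f (u s)) has_field_derivative D) (at 0) \<and>
    ((\<lambda>s. f (mat 1 + lscale s V)) has_field_derivative D) (at 0)"
  using assms(1)
proof induction
  case (const c)
  then show ?case by (auto intro!: exI[of _ 0])
next
  case (coeff i j k)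
  show ?case
    unfolding lcoeff_ent ent_add ent_lscale
    by (rule exI, rule conjI, rule assms(3)) (auto intro!: derivative_eq_intros)
next
  case (add f h)
  then obtain D E where
    "((\<lambda>s. f (u s)) has_field_derivative D) (at 0)"
    "((\<lambda>s. f (mat 1 + lscale s V)) has_field_derivative D) (at 0)"
    "((\<lambda>s. h (u s)) has_field_derivative E) (at 0)"
    "((\<lambda>s. h (mat 1 + lscale s V)) has_field_derivative E) (at 0)" by blast
  from DERIV_add[OF this(1,3)] DERIV_add[OF this(2,4)] show ?case by blast
next
  case (mult f h)
  then obtain D E where
    "((\<lambda>s. f (u s)) has_field_derivative D) (at 0)"
    "((\<lambda>s. f (mat 1 + lscale s V)) has_field_derivative D) (at 0)"
    "((\<lambda>s. h (u s)) has_field_derivative E) (at 0)"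
    "((\<lambda>s. h (mat 1 + lscale s V)) has_field_derivative E) (at 0)" by blast
  note m = DERIV_mult[OF this(1,3)] DERIV_mult[OF this(2,4)]
  have z: "mat 1 + lscale 0 V = mat 1" by (rule ent_eqI) (simp add: ent_add ent_lscale)
  show ?case using m unfolding z assms(2) by blast
qed

text \<open>The Lie algebra of the loop group is the sum of the strictly lower triangular and the upper
  triangular matrices; \<open>low\<close> projects onto the first, the tangent space of the flag variety.\<close>

definition low :: "loop_matrix \<Rightarrow> loop_matrix" where
  "low Y = (SOME V. \<forall>p q. ent V p q = (if q < p then ent Y p q else 0))"

lemma ent_low: "ent (low Y) p q = (if q < p then ent Y p q else 0)"
proof -
  have "\<exists>V. ent V = (\<lambda>p q. if q < p then ent Y p q else 0)"
  proof (rule ex_ent)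
    fix p :: int
    have "{q. (if q < p then ent Y p q else 0) \<noteq> 0} \<subseteq> {q. ent Y p q \<noteq> 0}" by auto
    then show "finite {q. (if q < p then ent Y p q else 0) \<noteq> 0}"
      using finite_ent_row finite_subset by blast
  qed (simp add: ent_period)
  then obtain V where "ent V = (\<lambda>p q. if q < p then ent Y p q else 0)" ..
  then have "\<forall>p q. ent V p q = (if q < p then ent Y p q else 0)" by simp
  then have "\<forall>p q. ent (low Y) p q = (if q < p then ent Y p q else 0)"
    unfolding low_def by (rule someI[of "\<lambda>V. \<forall>p q. ent V p q = (if q < p then ent Y p q else 0)"])
  then show ?thesis by blast
qed

lemma matrix_add_rdistrib: "(B + C) ** A = B ** A + C ** (A :: 'a::semiring_1^'n^'m)"
  by (simp add: vec_eq_iff matrix_matrix_mult_def sum.distrib distrib_right)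

lemma matrix_sub_ldistrib: "A ** (B - C) = A ** B - A ** (C :: 'a::ring_1^'n^'m)"
  by (simp add: vec_eq_iff matrix_matrix_mult_def sum_subtractf right_diff_distrib)

lemma mult_lscale_right: "g ** lscale c h = lscale c (g ** h)"
proof (rule ent_eqI)
  fix p q
  have f: "finite {r. ent g p r \<noteq> 0}" by (rule finite_ent_row)
  show "ent (g ** lscale c h) p q = ent (lscale c (g ** h)) p q"
    unfolding ent_lscale by (subst (1 2) ent_mult[OF f]) (auto simp: ent_lscale sum_distrib_left mult_ac)
qed

lemma mult_lscale_left: "lscale c g ** h = lscale c (g ** h)"
proof (rule ent_eqI)
  fix p q
  have f: "finite {r. ent g p r \<noteq> 0}" by (rule finite_ent_row)
  show "ent (lscale c g ** h) p q = ent (lscale c (g ** h)) p q"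
    unfolding ent_lscale by (subst (1 2) ent_mult[OF f]) (auto simp: ent_lscale sum_distrib_left mult_ac)
qed

lemma lscale_add: "lscale c (g + h) = lscale c g + lscale c h"
  by (rule ent_eqI) (simp add: ent_lscale ent_add algebra_simps)

lemma one_minus_square_zero:
  assumes "Y ** Y = 0"
  shows "(mat 1 + lscale (- s) Y) ** (mat 1 + lscale s Y) = mat 1"
proof -
  have "(mat 1 + lscale (- s) Y) ** (mat 1 + lscale s Y)
     = mat 1 + lscale s Y + (lscale (- s) Y + lscale s (lscale (- s) (Y ** Y)))"
    by (simp only: matrix_add_ldistrib matrix_add_rdistrib mult_lscale_left mult_lscale_right
        lscale_add matrix_mul_lid matrix_mul_rid ac_simps)
  then show ?thesis using assms
    by (intro ent_eqI) (simp add: ent_add ent_lscale)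
qed

text \<open>The condition \<open>Y ** Y = 0\<close> gives \<open>mat 1 + lscale s Y\<close> an
  explicit inverse. Splitting off an upper triangular factor moves this curve into the chart, where
  its velocity is \<open>low Y\<close>.\<close>

lemma curve_tangent:
  assumes Y: "Y ** Y = 0"
    and KM: "\<And>s. mat 1 + lscale s Y \<in> KM_group"
    and X: "\<And>s. flag (g ** (mat 1 + lscale s Y)) \<in> X"
  shows "low Y \<in> tangent_space (chart X g) (mat 1)"
proof -
  obtain N where N: "N \<ge> 0" "\<And>p q. \<bar>p - q\<bar> > N \<Longrightarrow> ent Y p q = 0" using ent_banded by metis
  define H where "H = (\<lambda>s. mat 1 + lscale s Y)"
  have H: "ent (H s) p q = (if p = q then 1 else 0) + s * ent Y p q" for s p q
    by (simp add: H_def ent_add ent_one ent_lscale)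
  have dH: "(\<lambda>s. ent (H s) i j) field_differentiable (at 0)" for i j
    unfolding H by (rule field_differentiable_add[OF field_differentiable_const
        field_differentiable_mult[OF field_differentiable_ident field_differentiable_const]])
  \<comment> \<open>For each column \<open>q\<close>, an upper triangular column of bandwidth
    \<open>N\<close> is determined by asking that its product with \<open>H s\<close> agree with the
    identity in the rows \<open>q - N\<close> to \<open>q\<close>.\<close>
  have "\<forall>q. \<exists>c. (\<forall>j\<in>{q-N..q}. c j field_differentiable (at 0)) \<and>
    (\<forall>\<^sub>F s in nhds 0. \<forall>i\<in>{q-N..q}. (\<Sum>j\<in>{q-N..q}. ent (H s) i j * c j s) = (if i = q then 1 else 0))"
    by (intro allI solve_linear_near dH field_differentiable_const) (simp_all add: H)
  from choice[OF this] obtain c where c: "\<And>q. (\<forall>j\<in>{q-N..q}. c q j field_differentiable (at 0)) \<and>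
    (\<forall>\<^sub>F s in nhds 0. \<forall>i\<in>{q-N..q}.
      (\<Sum>j\<in>{q-N..q}. ent (H s) i j * c q j s) = (if i = q then 1 else 0))" by blast
  have c1: "c q j field_differentiable (at 0)" if "j \<in> {q-N..q}" for q j using c[of q] that by blast
  have c2: "\<forall>\<^sub>F s in nhds 0. \<forall>i\<in>{q-N..q}.
      (\<Sum>j\<in>{q-N..q}. ent (H s) i j * c q j s) = (if i = q then 1 else 0)" for q
    using c[of q] by blast
  \<comment> \<open>\<open>sh\<close> measures the translation of a column into the block 1, 2, 3.
    The solutions extend periodically, and only three statements valid near 0 have to hold
    together.\<close>
  define sh where "sh = (\<lambda>q::int. 3 * ((q - 1) div 3))"
  have sh: "sh (q + 3 * k) = sh q + 3 * k" for q k unfolding sh_def by presburger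
  have rq: "q - sh q \<in> {1, 2, 3}" for q unfolding sh_def insert_iff empty_iff by presburger
  define F where "F = (\<lambda>s p q. if q - N \<le> p \<and> p \<le> q then c (q - sh q) (p - sh q) s else 0)"
  have "\<exists>C. ent C = F s" for s
  proof (rule ex_ent)
    fix p :: int
    have "{q. F s p q \<noteq> 0} \<subseteq> {p..p + N}" unfolding F_def by auto
    then show "finite {q. F s p q \<noteq> 0}" using finite_subset by blast
  qed (auto simp: F_def sh)
  then obtain C where C: "\<And>s. ent (C s) = F s" by metis
  define Z where "Z = (\<lambda>s. H s ** C s)"
  have Z: "ent (Z s) p q = (\<Sum>j\<in>{q-N..q}. ent (H s) p j * F s j q)" for s p q
    unfolding Z_def by (subst ent_mult[of "{q-N..q}"]) (auto simp: C F_def)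
  have "\<forall>\<^sub>F s in nhds 0. \<forall>q\<in>{1,2,3}. \<forall>i\<in>{q-N..q}.
      (\<Sum>j\<in>{q-N..q}. ent (H s) i j * c q j s) = (if i = q then 1 else 0)"
    using c2[of 1] c2[of 2] c2[of 3] by eventually_elim auto
  then have ev: "\<forall>\<^sub>F s in nhds 0. \<forall>q. \<forall>i\<in>{q-N..q}. ent (Z s) i q = (if i = q then 1 else 0)"
  proof eventually_elim
    case (elim s)
    show ?case
    proof (intro allI ballI)
      fix q i assume i: "i \<in> {q - N..q}"
      let ?q = "q - sh q"
      have "ent (Z s) i q = (\<Sum>j\<in>{q-N..q}. ent (H s) (i - sh q) (j - sh q) * c ?q (j - sh q) s)"
        unfolding Z
      proof (rule sum.cong)
        fix j assume j: "j \<in> {q-N..q}"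
        have "ent (H s) i j = ent (H s) (i - sh q) (j - sh q)"
          using ent_period[of "H s" "i - sh q" "(q - 1) div 3" "j - sh q"] by (simp add: sh_def)
        with j show "ent (H s) i j * F s j q = ent (H s) (i - sh q) (j - sh q) * c ?q (j - sh q) s"
          by (simp add: F_def)
      qed simp
      also have "\<dots> = (\<Sum>j\<in>{?q-N..?q}. ent (H s) (i - sh q) j * c ?q j s)"
        by (rule sum.reindex_bij_witness[of _ "\<lambda>j. j + sh q" "\<lambda>j. j - sh q"]) auto
      also have "\<dots> = (if i - sh q = ?q then 1 else 0)"
        using elim[rule_format, of ?q "i - sh q"] rq[of q] i by simp
      finally show "ent (Z s) i q = (if i = q then 1 else 0)" by simp
    qed
  qed
  define u where "u = (\<lambda>s. mat 1 + low (Z s))"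
  have u: "ent (u s) p q = (if p = q then 1 else if q < p then ent (Z s) p q else 0)" for s p q
    by (simp add: u_def ent_add ent_one ent_low)
  have chart: "\<forall>\<^sub>F s in nhds 0. u s \<in> chart X g"
    using ev
  proof eventually_elim
    case (elim s)
    have lu: "lower_uni (u s)" by (simp add: lower_uni_def u)
    \<comment> \<open>A product of two matrices of bandwidth \<open>N\<close> may have entries
      further than \<open>N\<close> above the diagonal, where no equation was imposed. They form
      \<open>J\<close>. Multiplied by \<open>H'\<close>, again of bandwidth \<open>N\<close>, they
      remain upper triangular, so dropping them changes only the upper factor.\<close>
    define J where "J = Z s - u s"
    have J: "ent J p q = 0" if "p \<ge> q - N" for p q
      using elim that by (auto simp: J_def ent_diff u)
    define H' where "H' = mat 1 + lscale (- s) Y"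
    have H': "H' ** H s = mat 1" "H s ** H' = mat 1"
      using one_minus_square_zero[OF Y, of s] one_minus_square_zero[OF Y, of "- s"]
      by (simp_all add: H'_def H_def)
    have "upper (C s)" by (simp add: upper_def C F_def)
    moreover have "upper (H' ** J)"
      unfolding upper_def
    proof (intro allI impI)
      fix p q :: int assume qp: "q < p"
      have "ent H' p r * ent J r q = 0" for r
      proof (cases "r < q - N")
        case True
        then have "\<bar>p - r\<bar> > N" "p \<noteq> r" using qp N(1) by auto
        then have "ent H' p r = 0" using N(2)[of p r]
          by (simp only: H'_def ent_add ent_one ent_lscale) simp
        then show ?thesis by simp
      qed (simp add: J)
      then show "ent (H' ** J) p q = 0" by (subst ent_mult[of "{}"]) auto
    qed
    moreover have "H' ** u s = C s - H' ** J"
    proof -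
      have "H' ** u s = H' ** Z s - H' ** J"
        by (simp add: J_def matrix_sub_ldistrib)
      also have "H' ** Z s = C s" by (simp add: Z_def matrix_mul_assoc H')
      finally show ?thesis .
    qed
    ultimately have up: "upper (H' ** u s)" by (simp add: upper_def ent_diff)
    have us: "u s = H s ** (H' ** u s)" by (simp add: matrix_mul_assoc H')
    have "H s \<in> KM_group" using KM by (simp add: H_def)
    note luf = lower_upper_factor[OF this lu up us]
    have "flag (g ** u s) = flag (g ** H s ** (H' ** u s))"
      by (metis us matrix_mul_assoc)
    also have "\<dots> = flag (g ** H s)" using luf by simp
    also have "\<dots> \<in> X" using X by (simp add: H_def)
    finally show ?case using luf by (simp add: chart_def)
  qed
  have c0: "c q j 0 = (if j = q then 1 else 0)" if "j \<in> {q-N..q}" for q j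
  proof -
    have "(\<Sum>l\<in>{q-N..q}. ent (H 0) j l * c q l 0) = (if j = q then 1 else 0)"
      using eventually_nhds_x_imp_x[OF c2[of q]] that by blast
    moreover have "(\<Sum>l\<in>{q-N..q}. ent (H 0) j l * c q l 0) = (\<Sum>l\<in>{q-N..q}. if l = j then c q l 0 else 0)"
      by (rule sum.cong) (auto simp: H)
    ultimately show ?thesis using that by simp
  qed
  have u0: "u 0 = mat 1"
  proof (rule ent_eqI)
    fix p q
    have "ent (Z 0) p q = 0" if "q < p"
      unfolding Z using that by (auto intro!: sum.neutral simp: H)
    then show "ent (u 0) p q = ent (mat 1) p q" by (simp add: u ent_one)
  qed
  have du: "((\<lambda>s. ent (u s) p q) has_field_derivative ent (low Y) p q) (at 0)" for p q
  proof (cases "q < p")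
    case True
    let ?q = "q - sh q"
    \<comment> \<open>Every \<open>j\<close> in the range is smaller than \<open>p\<close>, so the
      identity part of \<open>H s\<close> does not contribute and a factor \<open>s\<close> comes
      out. Hence only the values of \<open>c\<close> at 0 enter the derivative.\<close>
    have e: "ent (u s) p q = (\<Sum>j\<in>{q-N..q}. s * (ent Y p j * c ?q (j - sh q) s))" for s
      using True unfolding u Z by (auto intro!: sum.cong simp: H F_def)
    have t: "((\<lambda>s. s * (ent Y p j * c ?q (j - sh q) s)) has_field_derivative
        (if j = q then ent Y p j else 0)) (at 0)" if "j \<in> {q-N..q}" for j
    proof -
      from c1[of "j - sh q" ?q] that obtain D where
        "(c ?q (j - sh q) has_field_derivative D) (at 0)"
        by (auto simp: field_differentiable_def)
      then have "((\<lambda>s. s * (ent Y p j * c ?q (j - sh q) s)) has_field_derivative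
          1 * (ent Y p j * c ?q (j - sh q) 0) + (ent Y p j * D) * 0) (at 0)"
        by (intro DERIV_mult DERIV_cmult DERIV_ident)
      moreover have "c ?q (j - sh q) 0 = (if j = q then 1 else 0)"
        using c0[of "j - sh q" ?q] that by simp
      ultimately show ?thesis by (auto split: if_splits)
    qed
    have "((\<lambda>s. \<Sum>j\<in>{q-N..q}. s * (ent Y p j * c ?q (j - sh q) s)) has_field_derivative
        (\<Sum>j\<in>{q-N..q}. if j = q then ent Y p j else 0)) (at 0)"
      by (intro DERIV_sum t)
    moreover have "(\<Sum>j\<in>{q-N..q}. if j = q then ent Y p j else 0) = ent Y p q"
      using N(1) by (simp add: sum.delta)
    ultimately show ?thesis using True by (simp add: e ent_low)
  next
    case False
    then show ?thesis by (cases "p = q") (auto simp: u ent_low)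
  qed
  show ?thesis
    unfolding tangent_space_def
  proof (intro CollectI ballI impI)
    fix f assume f: "f \<in> regular_funs" "\<forall>q\<in>chart X g. f q = 0"
    obtain D where D: "((\<lambda>s. f (u s)) has_field_derivative D) (at 0)"
      "((\<lambda>s. f (mat 1 + lscale s (low Y))) has_field_derivative D) (at 0)"
      using regular_fun_derivative[OF f(1) u0 du] by blast
    have "\<forall>\<^sub>F s in nhds 0. f (u s) = 0"
      using chart by (rule eventually_mono) (use f(2) in auto)
    then have "((\<lambda>s. f (u s)) has_field_derivative 0) (at 0)"
      by (subst DERIV_cong_ev[OF refl _ refl, where g = "\<lambda>_. 0"]) auto
    with D show "deriv (\<lambda>s. f (mat 1 + lscale s (low Y))) 0 = 0"
      using DERIV_unique DERIV_imp_deriv by metis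
  qed
qed

section \<open>Dimension and algebraic dependence\<close>

lemma topspace_zariski [simp]: "topspace zariski = UNIV"
proof -
  have "UNIV \<in> {{g. f g \<noteq> 0} | f. f \<in> regular_funs}"
    by (rule CollectI, rule exI[of _ "\<lambda>_. 1"]) (simp add: regular_funs.const)
  then have "openin zariski UNIV" unfolding zariski_def by (rule topology_generated_by_Basis)
  then show ?thesis using openin_subset by blast
qed

lemma zariski_basis:
  assumes "openin zariski U" "z \<in> U"
  shows "\<exists>f\<in>regular_funs. f z \<noteq> 0 \<and> (\<forall>g. f g \<noteq> 0 \<longrightarrow> g \<in> U)"
proof -
  have "generate_topology_on {{g. f g \<noteq> 0} | f. f \<in> regular_funs} U"
    using assms(1) by (simp add: zariski_def openin_topology_generated_by_iff)
  then show ?thesis using assms(2)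
  proof (induction arbitrary: z)
    case (Int A B)
    from Int.IH(1)[of z] Int.prems obtain f where
      f: "f \<in> regular_funs" "f z \<noteq> 0" "\<And>g. f g \<noteq> 0 \<Longrightarrow> g \<in> A" by blast
    from Int.IH(2)[of z] Int.prems obtain h where
      h: "h \<in> regular_funs" "h z \<noteq> 0" "\<And>g. h g \<noteq> 0 \<Longrightarrow> g \<in> B" by blast
    show ?case
      by (rule bexI[of _ "\<lambda>g. f g * h g"]) (use f h in \<open>auto intro: regular_funs.mult\<close>)
  next
    case (UN K)
    then obtain k where "k \<in> K" "z \<in> k" by blast
    with UN.IH[of k z] show ?case by blast
  qed auto
qed

lemma closedin_zero_set:
  assumes "f \<in> regular_funs"
  shows "closedin (subtopology zariski Z) {z \<in> Z. f z = 0}"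
proof -
  have "openin zariski {g. f g \<noteq> 0}"
    unfolding zariski_def using assms by (intro topology_generated_by_Basis) blast
  then have "closedin zariski {g. f g = 0}"
    by (auto simp: closedin_def Compl_eq_Diff_UNIV[symmetric] Collect_neg_eq[symmetric])
  then show ?thesis by (auto simp: closedin_subtopology)
qed

lemma irreducible_prod:
  assumes "irreducible_space (subtopology zariski Z)" "f \<in> regular_funs" "h \<in> regular_funs"
    "\<forall>z\<in>Z. f z * h z = 0"
  shows "(\<forall>z\<in>Z. f z = 0) \<or> (\<forall>z\<in>Z. h z = 0)"
proof -
  let ?X = "subtopology zariski Z"
  have "{z \<in> Z. f z = 0} \<union> {z \<in> Z. h z = 0} = topspace ?X" using assms(4) by auto
  then have "{z \<in> Z. f z = 0} = topspace ?X \<or> {z \<in> Z. h z = 0} = topspace ?X"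
    using assms(1) closedin_zero_set[OF assms(2), of Z] closedin_zero_set[OF assms(3), of Z]
    unfolding irreducible_space_def by meson
  then show ?thesis unfolding topspace_subtopology topspace_zariski by blast
qed

lemma irreducible_nonempty: "irreducible_space (subtopology zariski Z) \<Longrightarrow> Z \<noteq> {}"
  by (auto simp: irreducible_space_def)

lemma regular_power: "f \<in> regular_funs \<Longrightarrow> (\<lambda>z. f z ^ n) \<in> regular_funs"
  by (induction n) (simp_all add: regular_funs.const regular_funs.mult)

lemma regular_prod: "(\<And>i. i \<in> I \<Longrightarrow> f i \<in> regular_funs) \<Longrightarrow> (\<lambda>z. \<Prod>i\<in>I. f i z) \<in> regular_funs"
  by (induction I rule: infinite_finite_induct) (simp_all add: regular_funs.const regular_funs.mult)

lemma regular_sum: "(\<And>i. i \<in> I \<Longrightarrow> f i \<in> regular_funs) \<Longrightarrow> (\<lambda>z. \<Sum>i\<in>I. f i z) \<in> regular_funs"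
  by (induction I rule: infinite_finite_induct) (simp_all add: regular_funs.const regular_funs.add)

definition monom_fun :: "nat \<Rightarrow> (nat \<Rightarrow> 'a \<Rightarrow> complex) \<Rightarrow> (nat \<Rightarrow> nat) \<Rightarrow> 'a \<Rightarrow> complex" where
  "monom_fun k f e z = (\<Prod>i<k. f i z ^ e i)"

definition exponents :: "nat \<Rightarrow> nat \<Rightarrow> (nat \<Rightarrow> nat) set" where
  "exponents k d = {e. (\<forall>i<k. e i \<le> d) \<and> (\<forall>i\<ge>k. e i = 0)}"

lemma regular_monom_fun: "(\<And>i. i < k \<Longrightarrow> f i \<in> regular_funs) \<Longrightarrow> monom_fun k f e \<in> regular_funs"
  unfolding monom_fun_def by (intro regular_prod regular_power) auto

text \<open>The lowest power of the last function can be cancelled on the irreducible set where it does not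
  vanish; on the next smaller set only the terms of lowest degree survive.\<close>

lemma chain_independent:
  assumes "\<And>i. i \<le> k \<Longrightarrow> irreducible_space (subtopology zariski (Z i))"
    "\<And>i. i < k \<Longrightarrow> Z i \<subseteq> Z (Suc i)"
    "\<And>i. i < k \<Longrightarrow> f i \<in> regular_funs"
    "\<And>i z. i < k \<Longrightarrow> z \<in> Z i \<Longrightarrow> f i z = 0"
    "\<And>i. i < k \<Longrightarrow> \<exists>z\<in>Z (Suc i). f i z \<noteq> 0"
    "finite E" "\<And>e i. e \<in> E \<Longrightarrow> k \<le> i \<Longrightarrow> e i = 0"
    "\<And>z. z \<in> Z k \<Longrightarrow> (\<Sum>e\<in>E. c e * monom_fun k f e z) = 0" "e \<in> E"
  shows "c e = 0"
  using assms
proof (induction k arbitrary: E c e)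
  case 0
  have "e' = (\<lambda>_. 0)" if "e' \<in> E" for e' using 0(7)[OF that] by (simp add: fun_eq_iff)
  with \<open>e \<in> E\<close> have "E = {e}" by blast
  moreover obtain z where "z \<in> Z 0" using irreducible_nonempty 0(1)[of 0] by blast
  ultimately show ?case using 0(8)[of z] by (simp add: monom_fun_def)
next
  case (Suc k)
  show ?case
  proof (rule ccontr)
    assume "c e \<noteq> 0"
    define d where "d = Min ((\<lambda>e. e k) ` {e \<in> E. c e \<noteq> 0})"
    have fin: "finite {e \<in> E. c e \<noteq> 0}" using Suc.prems(6) by simp
    have ne: "{e \<in> E. c e \<noteq> 0} \<noteq> {}" using \<open>c e \<noteq> 0\<close> Suc.prems(9) by blast
    have d_le: "d \<le> e' k" if "e' \<in> E" "c e' \<noteq> 0" for e'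
      unfolding d_def using that fin by (intro Min_le) auto
    have "d \<in> (\<lambda>e. e k) ` {e \<in> E. c e \<noteq> 0}" unfolding d_def using fin ne by (intro Min_in) auto
    then obtain e0 where e0: "e0 \<in> E" "c e0 \<noteq> 0" "e0 k = d" by blast
    define Q where "Q = (\<lambda>z. \<Sum>e\<in>{e \<in> E. c e \<noteq> 0}. c e * (monom_fun k f e z * f k z ^ (e k - d)))"
    have "f k z ^ d * Q z = 0" if z: "z \<in> Z (Suc k)" for z
    proof -
      have "f k z ^ d * Q z = (\<Sum>e\<in>{e \<in> E. c e \<noteq> 0}. c e * monom_fun (Suc k) f e z)"
        unfolding Q_def sum_distrib_left
      proof (rule sum.cong)
        fix e assume "e \<in> {e \<in> E. c e \<noteq> 0}"
        then have "f k z ^ e k = f k z ^ d * f k z ^ (e k - d)" using d_le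
          by (simp flip: power_add)
        then show "f k z ^ d * (c e * (monom_fun k f e z * f k z ^ (e k - d)))
          = c e * monom_fun (Suc k) f e z"
          by (simp add: monom_fun_def mult_ac)
      qed simp
      also have "\<dots> = (\<Sum>e\<in>E. c e * monom_fun (Suc k) f e z)"
        using Suc.prems(6) by (intro sum.mono_neutral_left) auto
      finally show ?thesis using Suc.prems(8)[OF z] by simp
    qed
    moreover have "Q \<in> regular_funs"
      unfolding Q_def using Suc.prems(3)
      by (intro regular_sum regular_funs.mult regular_funs.const regular_monom_fun regular_power) auto
    moreover have "(\<lambda>z. f k z ^ d) \<in> regular_funs" using Suc.prems(3) by (intro regular_power) auto
    ultimately have "(\<forall>z\<in>Z (Suc k). f k z ^ d = 0) \<or> (\<forall>z\<in>Z (Suc k). Q z = 0)"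
      using Suc.prems(1)[of "Suc k"] by (intro irreducible_prod) auto
    then have Q: "Q z = 0" if "z \<in> Z (Suc k)" for z
      using Suc.prems(5)[of k] that by auto
    \<comment> \<open>All surviving exponents have the value \<open>d\<close> in place
      \<open>k\<close>. Resetting that place to 0 makes the induction hypothesis applicable;
      \<open>c'\<close> recovers the coefficient by restoring \<open>d\<close>.\<close>
    define E' where "E' = {e \<in> E. c e \<noteq> 0 \<and> e k = d}"
    define c' where "c' = (\<lambda>e. c (e(k := d)))"
    have inj: "inj_on (\<lambda>e. e(k := 0)) E'"
    proof (rule inj_onI)
      fix x y assume "x \<in> E'" "y \<in> E'" and eq: "x(k := 0) = y(k := 0)"
      then have "x k = y k" by (simp add: E'_def)
      with eq show "x = y" by (metis fun_upd_triv fun_upd_upd)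
    qed
    have c': "c' (e(k := 0)) = c e" if "e \<in> E'" for e
      using that by (auto simp: c'_def E'_def)
    have "c' (e0(k := 0)) = 0"
    proof (rule Suc.IH[where E = "(\<lambda>e. e(k := 0)) ` E'" and c = c' and e = "e0(k := 0)"])
      show "finite ((\<lambda>e. e(k := 0)) ` E')" using Suc.prems(6) by (simp add: E'_def)
      show "(\<Sum>e\<in>(\<lambda>e. e(k := 0)) ` E'. c' e * monom_fun k f e z) = 0" if z: "z \<in> Z k" for z
      proof -
        have fk: "f k z = 0" using Suc.prems(4) z by simp
        have "(\<Sum>e\<in>(\<lambda>e. e(k := 0)) ` E'. c' e * monom_fun k f e z)
           = (\<Sum>e\<in>E'. c e * (monom_fun k f e z * f k z ^ (e k - d)))"
          unfolding sum.reindex[OF inj] o_def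
          by (rule sum.cong) (auto simp: c' monom_fun_def E'_def)
        also have "\<dots> = Q z"
          unfolding Q_def
        proof (rule sum.mono_neutral_left)
          show "\<forall>e\<in>{e \<in> E. c e \<noteq> 0} - E'. c e * (monom_fun k f e z * f k z ^ (e k - d)) = 0"
          proof
            fix e assume "e \<in> {e \<in> E. c e \<noteq> 0} - E'"
            then have "e k - d > 0" using d_le by (auto simp: E'_def le_less)
            then show "c e * (monom_fun k f e z * f k z ^ (e k - d)) = 0" using fk by simp
          qed
        qed (use fin in \<open>auto simp: E'_def\<close>)
        also have "\<dots> = 0" using Q Suc.prems(2)[of k] z by auto
        finally show ?thesis .
      qed
      show "e i = 0" if mem: "e \<in> (\<lambda>e. e(k := 0)) ` E'" and ki: "k \<le> i" for e i
      proof -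
        obtain e' where e': "e = e'(k := 0)" "e' \<in> E" using mem unfolding E'_def by blast
        show ?thesis
        proof (cases "i = k")
          case False
          then have "Suc k \<le> i" using ki by simp
          from Suc.prems(7)[OF e'(2) this] False show ?thesis by (simp add: e'(1))
        qed (simp add: e'(1))
      qed
      show "e0(k := 0) \<in> (\<lambda>e. e(k := 0)) ` E'" using e0 by (auto simp: E'_def)
      show "irreducible_space (subtopology zariski (Z i))" if "i \<le> k" for i
        using Suc.prems(1) that by simp
      show "Z i \<subseteq> Z (Suc i)" if "i < k" for i using Suc.prems(2) that by simp
      show "f i \<in> regular_funs" if "i < k" for i using Suc.prems(3) that by simp
      show "f i z = 0" if "i < k" "z \<in> Z i" for i z using Suc.prems(4)[of i z] that by simp
      show "\<exists>z\<in>Z (Suc i). f i z \<noteq> 0" if "i < k" for i using Suc.prems(5)[of i] that by simp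
    qed
    with c'[of e0] e0 show False by (simp add: E'_def)
  qed
qed

text \<open>This says that the regular functions on \<open>S\<close> have transcendence degree less
  than \<open>k\<close>. Here \<open>S\<close> is an arbitrary set of matrices, so the pieces of a
  chart can be treated separately.\<close>

definition alg_dependent :: "nat \<Rightarrow> loop_matrix set \<Rightarrow> bool" where
  "alg_dependent k S \<longleftrightarrow> (\<forall>f. (\<forall>i<k. f i \<in> regular_funs) \<longrightarrow>
     (\<exists>d c. (\<exists>e\<in>exponents k d. c e \<noteq> 0) \<and>
        (\<forall>z\<in>S. (\<Sum>e\<in>exponents k d. c e * monom_fun k f e z) = 0)))"

lemma bij_exponents: "bij_betw (\<lambda>e i. if i < k then e i else 0) (PiE {..<k} (\<lambda>_. {..d})) (exponents k d)"
proof (rule bij_betw_byWitness[where f' = "\<lambda>e. restrict e {..<k}"])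
  show "\<forall>a\<in>{..<k} \<rightarrow>\<^sub>E {..d}. restrict (\<lambda>i. if i < k then a i else 0) {..<k} = a"
    by (auto simp: PiE_def extensional_def restrict_def fun_eq_iff)
qed (auto simp: exponents_def PiE_def Pi_def)

lemma finite_exponents: "finite (exponents k d)"
  using bij_betw_finite[OF bij_exponents] by (simp add: finite_PiE)

lemma card_exponents: "card (exponents k d) = (d + 1) ^ k"
  using bij_betw_same_card[OF bij_exponents, of k d] by (simp add: card_PiE)

text \<open>A chain of length \<open>n + 1\<close> yields \<open>n + 1\<close> functions, the i-th
  vanishing on \<open>Z i\<close> but not on \<open>Z (Suc i)\<close>. The product over all pieces
  of their relations vanishes on the irreducible set \<open>Z (Suc n)\<close>, hence one relation
  does, against \<open>chain_independent\<close>.\<close>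

lemma local_dim_le:
  assumes "finite \<S>" "Y \<subseteq> \<Union>\<S>" "\<And>S. S \<in> \<S> \<Longrightarrow> alg_dependent (Suc n) S"
  shows "local_dim Y p \<le> enat n"
  unfolding local_dim_def
proof (rule Sup_least)
  fix x assume "x \<in> {enat n | n. \<exists>Z :: nat \<Rightarrow> loop_matrix set.
     (\<forall>i\<le>n. closedin (subtopology zariski Y) (Z i) \<and>
            irreducible_space (subtopology zariski (Z i)) \<and> p \<in> Z i) \<and>
     (\<forall>i<n. Z i \<subset> Z (Suc i))}"
  then obtain m Z where x: "x = enat m"
    and Z: "\<And>i. i \<le> m \<Longrightarrow> closedin (subtopology zariski Y) (Z i)"
      "\<And>i. i \<le> m \<Longrightarrow> irreducible_space (subtopology zariski (Z i))"
      "\<And>i. i < m \<Longrightarrow> Z i \<subset> Z (Suc i)" by auto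
  have "m \<le> n"
  proof (rule ccontr)
    assume "\<not> m \<le> n"
    have "\<exists>f\<in>regular_funs. (\<forall>z\<in>Z i. f z = 0) \<and> (\<exists>z\<in>Z (Suc i). f z \<noteq> 0)" if im: "i < m" for i
    proof -
      obtain z where z: "z \<in> Z (Suc i)" "z \<notin> Z i" using Z(3)[OF im] by blast
      obtain C where C: "closedin zariski C" "Z i = C \<inter> Y"
        using Z(1)[of i] im by (auto simp: closedin_subtopology)
      have "z \<in> Y" using Z(1)[of "Suc i"] im z closedin_subset by fastforce
      then have "z \<in> UNIV - C" using z C by auto
      moreover have "openin zariski (UNIV - C)" using C(1) by (simp add: closedin_def)
      ultimately obtain f where "f \<in> regular_funs" "f z \<noteq> 0" "\<forall>g. f g \<noteq> 0 \<longrightarrow> g \<in> UNIV - C"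
        using zariski_basis by blast
      then show ?thesis using C z by blast
    qed
    then have "\<forall>i. \<exists>f. i < m \<longrightarrow> f \<in> regular_funs \<and> (\<forall>z\<in>Z i. f z = 0) \<and> (\<exists>z\<in>Z (Suc i). f z \<noteq> 0)"
      by blast
    from choice[OF this] obtain f where
      f: "\<And>i. i < m \<Longrightarrow> f i \<in> regular_funs \<and> (\<forall>z\<in>Z i. f i z = 0) \<and> (\<exists>z\<in>Z (Suc i). f i z \<noteq> 0)"
      by blast
    let ?k = "Suc n"
    have km: "?k \<le> m" using \<open>\<not> m \<le> n\<close> by simp
    have f_reg: "f i \<in> regular_funs" if "i < ?k" for i using f[of i] that km by simp
    have "\<forall>S. \<exists>dc. S \<in> \<S> \<longrightarrow> (\<exists>e\<in>exponents ?k (fst dc). snd dc e \<noteq> 0) \<and>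
        (\<forall>z\<in>S. (\<Sum>e\<in>exponents ?k (fst dc). snd dc e * monom_fun ?k f e z) = 0)"
    proof
      fix S
      show "\<exists>dc. S \<in> \<S> \<longrightarrow> (\<exists>e\<in>exponents ?k (fst dc). snd dc e \<noteq> 0) \<and>
        (\<forall>z\<in>S. (\<Sum>e\<in>exponents ?k (fst dc). snd dc e * monom_fun ?k f e z) = 0)"
      proof (cases "S \<in> \<S>")
        case True
        then have "alg_dependent ?k S" by (rule assms(3))
        then obtain d c where dc: "\<exists>e\<in>exponents ?k d. c e \<noteq> 0"
          "\<forall>z\<in>S. (\<Sum>e\<in>exponents ?k d. c e * monom_fun ?k f e z) = 0"
          using f_reg unfolding alg_dependent_def by blast
        show ?thesis by (rule exI[of _ "(d, c)"]) (use dc in simp)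
      qed simp
    qed
    from choice[OF this] obtain dc where dc: "\<And>S. S \<in> \<S> \<Longrightarrow>
        (\<exists>e\<in>exponents ?k (fst (dc S)). snd (dc S) e \<noteq> 0) \<and>
        (\<forall>z\<in>S. (\<Sum>e\<in>exponents ?k (fst (dc S)). snd (dc S) e * monom_fun ?k f e z) = 0)"
      by blast
    define Q where "Q = (\<lambda>S z. \<Sum>e\<in>exponents ?k (fst (dc S)). snd (dc S) e * monom_fun ?k f e z)"
    have Q: "Q S \<in> regular_funs" for S
      unfolding Q_def
      by (intro regular_sum regular_funs.mult regular_funs.const regular_monom_fun f_reg)
    have irr: "irreducible_space (subtopology zariski (Z ?k))" using Z(2) km by simp
    have "\<exists>S\<in>\<T>. \<forall>z\<in>Z ?k. Q S z = 0" if "finite \<T>" "\<forall>z\<in>Z ?k. (\<Prod>S\<in>\<T>. Q S z) = 0" for \<T>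
      using that
    proof (induction \<T> rule: finite_induct)
      case empty
      then show ?case using irreducible_nonempty[OF irr] by auto
    next
      case (insert S \<T>)
      have "(\<forall>z\<in>Z ?k. Q S z = 0) \<or> (\<forall>z\<in>Z ?k. (\<Prod>S\<in>\<T>. Q S z) = 0)"
        using insert.prems insert.hyps by (intro irreducible_prod[OF irr] Q regular_prod) auto
      then show ?case using insert.IH by auto
    qed
    moreover have "\<forall>z\<in>Z ?k. (\<Prod>S\<in>\<S>. Q S z) = 0"
    proof
      fix z assume "z \<in> Z ?k"
      then have "z \<in> Y" using Z(1)[of ?k] km closedin_subset by fastforce
      then obtain S where "S \<in> \<S>" "z \<in> S" using assms(2) by blast
      then show "(\<Prod>S\<in>\<S>. Q S z) = 0"
        using dc[of S] assms(1) by (intro prod_zero) (auto simp: Q_def)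
    qed
    ultimately obtain S where S: "S \<in> \<S>" "\<And>z. z \<in> Z ?k \<Longrightarrow> Q S z = 0"
      using assms(1) by blast
    have "snd (dc S) e = 0" if e: "e \<in> exponents ?k (fst (dc S))" for e
    proof (rule chain_independent[where k = ?k and Z = Z and f = f and E = "exponents ?k (fst (dc S))"
          and c = "snd (dc S)"])
      show "irreducible_space (subtopology zariski (Z i))" if "i \<le> ?k" for i using Z(2) that km by simp
      show "Z i \<subseteq> Z (Suc i)" if "i < ?k" for i using Z(3)[of i] that km by auto
      show "f i \<in> regular_funs" if "i < ?k" for i using that by (rule f_reg)
      show "f i z = 0" if "i < ?k" "z \<in> Z i" for i z using f[of i] that km by simp
      show "\<exists>z\<in>Z (Suc i). f i z \<noteq> 0" if "i < ?k" for i using f[of i] that km by simp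
      show "e i = 0" if "e \<in> exponents ?k (fst (dc S))" "?k \<le> i" for e i
        using that by (simp add: exponents_def)
      show "(\<Sum>e\<in>exponents ?k (fst (dc S)). snd (dc S) e * monom_fun ?k f e z) = 0"
        if "z \<in> Z ?k" for z using S(2)[OF that] by (simp add: Q_def)
    qed (rule finite_exponents, rule e)
    then show False using dc[OF S(1)] by blast
  qed
  then show "x \<le> enat n" by (simp add: x)
qed

lemma homogeneous_system_nontrivial:
  fixes A :: "'i \<Rightarrow> 'j \<Rightarrow> complex"
  assumes "finite I" "finite J" "card I < card J"
  shows "\<exists>v. (\<exists>j\<in>J. v j \<noteq> 0) \<and> (\<forall>i\<in>I. (\<Sum>j\<in>J. A i j * v j) = 0)"
  using assms
proof (induction I arbitrary: A J rule: finite_induct)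
  case empty
  then have "J \<noteq> {}" by auto
  then obtain j where "j \<in> J" by blast
  then show ?case by (intro exI[of _ "\<lambda>_. 1"]) auto
next
  case (insert i0 I)
  show ?case
  proof (cases "\<forall>j\<in>J. A i0 j = 0")
    case True
    have "card I < card J" using insert.hyps insert.prems by simp
    from insert.IH[OF insert.prems(1) this, of A] obtain v where
      "\<exists>j\<in>J. v j \<noteq> 0" "\<forall>i\<in>I. (\<Sum>j\<in>J. A i j * v j) = 0" by blast
    with True show ?thesis by (intro exI[of _ v]) simp
  next
    case False
    then obtain j0 where j0: "j0 \<in> J" "A i0 j0 \<noteq> 0" by blast
    note fin = insert.prems(1)
    let ?J = "J - {j0}"
    have "card I < card ?J" using insert.hyps insert.prems j0 by simp
    from insert.IH[OF finite_Diff[OF fin] this, of "\<lambda>i j. A i j - A i j0 * A i0 j / A i0 j0"]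
    obtain v where v: "\<exists>j\<in>?J. v j \<noteq> 0"
      "\<And>i. i \<in> I \<Longrightarrow> (\<Sum>j\<in>?J. (A i j - A i j0 * A i0 j / A i0 j0) * v j) = 0" by blast
    define t where "t = (\<Sum>j\<in>?J. A i0 j * v j)"
    define w where "w = v(j0 := - t / A i0 j0)"
    have w: "(\<Sum>j\<in>J. A i j * w j) = A i j0 * (- t / A i0 j0) + (\<Sum>j\<in>?J. A i j * v j)" for i
    proof -
      have "(\<Sum>j\<in>J. A i j * w j) = A i j0 * w j0 + (\<Sum>j\<in>?J. A i j * w j)"
        using j0 insert.prems(1) by (simp add: sum.remove)
      also have "(\<Sum>j\<in>?J. A i j * w j) = (\<Sum>j\<in>?J. A i j * v j)"
        by (rule sum.cong) (auto simp: w_def)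
      finally show ?thesis by (simp add: w_def)
    qed
    have "(\<Sum>j\<in>J. A i j * w j) = 0" if i: "i \<in> insert i0 I" for i
    proof (cases "i = i0")
      case True
      then show ?thesis using j0 unfolding w by (simp add: t_def)
    next
      case False
      with i have "(\<Sum>j\<in>?J. A i j * v j - A i j0 / A i0 j0 * (A i0 j * v j)) = 0"
        using v(2)[of i] by (simp add: left_diff_distrib mult.assoc)
      then have "(\<Sum>j\<in>?J. A i j * v j) = A i j0 / A i0 j0 * t"
        unfolding sum_subtractf sum_distrib_left[symmetric] t_def by simp
      then show ?thesis unfolding w by simp
    qed
    moreover have "\<exists>j\<in>J. w j \<noteq> 0" using v(1) by (auto simp: w_def)
    ultimately show ?thesis by blast
  qed
qed

section \<open>Polynomial functions of finitely many parameters and their degrees\<close>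

definition pmono :: "nat \<Rightarrow> (nat \<Rightarrow> nat) \<Rightarrow> (nat \<Rightarrow> complex) \<Rightarrow> complex" where
  "pmono n e a = (\<Prod>i<n. a i ^ e i)"

text \<open>The degree is bounded in each variable separately, so there are exactly
  \<open>(d + 1) ^ n\<close> monomials and the count in \<open>alg_dependent_rational\<close>
  compares powers.\<close>

definition pf :: "nat \<Rightarrow> nat \<Rightarrow> ((nat \<Rightarrow> complex) \<Rightarrow> complex) \<Rightarrow> bool" where
  "pf n d F \<longleftrightarrow> (\<exists>c. \<forall>a. F a = (\<Sum>e\<in>exponents n d. c e * pmono n e a))"

lemma exponents_mono: "d \<le> d' \<Longrightarrow> exponents n d \<subseteq> exponents n d'"
  by (force simp: exponents_def)

lemma pf_mono:
  assumes "pf n d F" "d \<le> d'" shows "pf n d' F"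
proof -
  obtain c where c: "\<And>a. F a = (\<Sum>e\<in>exponents n d. c e * pmono n e a)"
    using assms(1) by (auto simp: pf_def)
  have "F a = (\<Sum>e\<in>exponents n d'. (if e \<in> exponents n d then c e else 0) * pmono n e a)" for a
    unfolding c using exponents_mono[OF assms(2)] finite_exponents[of n d']
    by (intro sum.mono_neutral_cong_left) auto
  then show ?thesis unfolding pf_def by (intro exI allI)
qed

lemma pf_add:
  assumes "pf n d F" "pf n d G" shows "pf n d (\<lambda>a. F a + G a)"
proof -
  obtain c where c: "\<And>a. F a = (\<Sum>e\<in>exponents n d. c e * pmono n e a)"
    using assms(1) by (auto simp: pf_def)
  obtain c' where c': "\<And>a. G a = (\<Sum>e\<in>exponents n d. c' e * pmono n e a)"
    using assms(2) by (auto simp: pf_def)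
  have "F a + G a = (\<Sum>e\<in>exponents n d. (c e + c' e) * pmono n e a)" for a
    by (simp add: c c' distrib_right sum.distrib)
  then show ?thesis unfolding pf_def by (intro exI allI)
qed

lemma pf_mult:
  assumes "pf n d F" "pf n d' G" shows "pf n (d + d') (\<lambda>a. F a * G a)"
proof -
  obtain c where c: "\<And>a. F a = (\<Sum>e\<in>exponents n d. c e * pmono n e a)"
    using assms(1) by (auto simp: pf_def)
  obtain c' where c': "\<And>a. G a = (\<Sum>e\<in>exponents n d'. c' e * pmono n e a)"
    using assms(2) by (auto simp: pf_def)
  let ?S = "exponents n d \<times> exponents n d'" and ?T = "exponents n (d + d')"
  let ?g = "\<lambda>(e, e') i. e i + e' i :: nat"
  have g: "?g ` ?S \<subseteq> ?T" by (auto simp: exponents_def add_mono)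
  have pm: "pmono n (?g x) a = pmono n (fst x) a * pmono n (snd x) a" for x a
    by (simp add: pmono_def power_add prod.distrib case_prod_beta)
  have "F a * G a = (\<Sum>s\<in>?T. (\<Sum>x\<in>{x\<in>?S. ?g x = s}. c (fst x) * c' (snd x)) * pmono n s a)" for a
  proof -
    have "F a * G a = (\<Sum>x\<in>?S. c (fst x) * c' (snd x) * pmono n (?g x) a)"
      unfolding c c' sum_product sum.cartesian_product pm
      by (rule sum.cong) (simp_all add: case_prod_beta mult_ac)
    also have "\<dots> = (\<Sum>s\<in>?T. \<Sum>x\<in>{x\<in>?S. ?g x = s}. c (fst x) * c' (snd x) * pmono n (?g x) a)"
      by (rule sum.group[symmetric]) (use g in \<open>simp_all add: finite_exponents\<close>)
    also have "\<dots> = (\<Sum>s\<in>?T. (\<Sum>x\<in>{x\<in>?S. ?g x = s}. c (fst x) * c' (snd x)) * pmono n s a)"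
      unfolding sum_distrib_right by (intro sum.cong) auto
    finally show ?thesis .
  qed
  then show ?thesis unfolding pf_def by (intro exI allI)
qed

lemma pf_const: "pf n d (\<lambda>_. k)"
proof -
  have "pf n 0 (\<lambda>_. k)"
  proof -
    have "exponents n 0 = {\<lambda>_. 0}" by (auto simp: exponents_def fun_eq_iff) (metis not_le)
    then show ?thesis unfolding pf_def by (intro exI[of _ "\<lambda>_. k"]) (simp add: pmono_def)
  qed
  then show ?thesis by (rule pf_mono) simp
qed

lemma pf_var:
  assumes "i < n" shows "pf n 1 (\<lambda>a. a i)"
proof -
  let ?e = "\<lambda>j. if j = i then 1 else (0::nat)"
  have "a i = (\<Sum>e\<in>exponents n 1. (if e = ?e then 1 else 0) * pmono n e a)" for a
  proof -
    have "?e \<in> exponents n 1" using assms by (auto simp: exponents_def)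
    then have "(\<Sum>e\<in>exponents n 1. (if e = ?e then 1 else 0) * pmono n e a) = pmono n ?e a"
      using finite_exponents[of n 1] by (simp add: if_distrib[of "\<lambda>x. x * _"] sum.delta cong: if_cong)
    also have "\<dots> = (\<Prod>j<n. if j = i then a i else 1)"
      unfolding pmono_def by (rule prod.cong) auto
    also have "\<dots> = a i" using assms by (simp add: prod.delta)
    finally show ?thesis by simp
  qed
  then show ?thesis unfolding pf_def by (intro exI allI)
qed

lemma pf_prod:
  assumes "finite I" "\<And>i. i \<in> I \<Longrightarrow> pf n d (F i)"
  shows "pf n (card I * d) (\<lambda>a. \<Prod>i\<in>I. F i a)"
  using assms
proof (induction I rule: finite_induct)
  case (insert i I)
  have "pf n (d + card I * d) (\<lambda>a. F i a * (\<Prod>i\<in>I. F i a))"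
    using insert by (intro pf_mult) auto
  then show ?case using insert.hyps by simp
qed (simp add: pf_const)

lemma pf_power: "pf n d F \<Longrightarrow> pf n (k * d) (\<lambda>a. F a ^ k)"
  using pf_prod[of "{..<k}" n d "\<lambda>_. F"] by simp

definition Poly :: "nat \<Rightarrow> ((nat \<Rightarrow> complex) \<Rightarrow> complex) \<Rightarrow> bool" where
  "Poly n F \<longleftrightarrow> (\<exists>d. pf n d F)"

lemma Poly_const: "Poly n (\<lambda>_. k)"
  unfolding Poly_def using pf_const by blast

lemma Poly_var: "i < n \<Longrightarrow> Poly n (\<lambda>a. a i)"
  unfolding Poly_def using pf_var by blast

lemma Poly_mult: "Poly n F \<Longrightarrow> Poly n G \<Longrightarrow> Poly n (\<lambda>a. F a * G a)"
  unfolding Poly_def using pf_mult by blast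

lemma Poly_add:
  assumes "Poly n F" "Poly n G" shows "Poly n (\<lambda>a. F a + G a)"
proof -
  obtain d d' where "pf n d F" "pf n d' G" using assms unfolding Poly_def by blast
  then have "pf n (max d d') F" "pf n (max d d') G" by (auto intro: pf_mono)
  then show ?thesis unfolding Poly_def using pf_add by blast
qed

lemma Poly_minus: "Poly n F \<Longrightarrow> Poly n (\<lambda>a. - F a)"
  using Poly_mult[OF Poly_const[of n "- 1"], of F] by simp

lemma Poly_diff: "Poly n F \<Longrightarrow> Poly n G \<Longrightarrow> Poly n (\<lambda>a. F a - G a)"
  using Poly_add[OF _ Poly_minus, of n F G] by simp

lemma Poly_sum: "(\<And>i. i \<in> I \<Longrightarrow> Poly n (F i)) \<Longrightarrow> Poly n (\<lambda>a. \<Sum>i\<in>I. F i a)"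
  by (induction I rule: infinite_finite_induct) (simp_all add: Poly_const Poly_add)

lemma Poly_power: "Poly n F \<Longrightarrow> Poly n (\<lambda>a. F a ^ k)"
  unfolding Poly_def using pf_power by blast

lemma common_degree:
  assumes "finite I" "\<And>i. i \<in> I \<Longrightarrow> Poly n (F i)"
  shows "\<exists>d. \<forall>i\<in>I. pf n d (F i)"
  using assms
proof (induction I rule: finite_induct)
  case (insert i I)
  then obtain d where d: "\<forall>i\<in>I. pf n d (F i)" by blast
  obtain d' where d': "pf n d' (F i)" using insert.prems unfolding Poly_def by blast
  show ?case
    by (rule exI[of _ "max d d'"]) (use d d' in \<open>auto intro: pf_mono\<close>)
qed simp

text \<open>The points of a rational parametrisation with common denominator \<open>D\<close>,
  multiplied out so that no division occurs. Parameters with \<open>D a = 0\<close> are left to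
  other charts.\<close>

definition rational_chart :: "nat \<Rightarrow> ((nat \<Rightarrow> complex) \<Rightarrow> complex) \<Rightarrow>
    (int \<Rightarrow> int \<Rightarrow> (nat \<Rightarrow> complex) \<Rightarrow> complex) \<Rightarrow> loop_matrix set" where
  "rational_chart n D P = {z. \<exists>a. D a \<noteq> 0 \<and> (\<forall>p q. D a * ent z p q = P p q a)}"

text \<open>Clearing denominators: the exponent \<open>r\<close> of \<open>D\<close> is accumulated
  along the construction of \<open>f\<close>.\<close>

lemma regular_fun_rational:
  assumes "f \<in> regular_funs" "Poly n D" "\<And>p q. Poly n (P p q)"
  shows "\<exists>r F. Poly n F \<and> (\<forall>z a. (\<forall>p q. D a * ent z p q = P p q a) \<longrightarrow> f z * D a ^ r = F a)"
  using assms(1)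
proof induction
  case (const c)
  show ?case by (rule exI[of _ 0], rule exI[of _ "\<lambda>_. c"]) (simp add: Poly_const)
next
  case (coeff i j k)
  show ?case
    by (rule exI[of _ 1], rule exI[of _ "P (row i) (row j + 3 * k)"])
      (auto simp: assms(3) lcoeff_ent mult.commute)
next
  case (add f h)
  obtain r F where F: "Poly n F"
    "\<And>z a. (\<forall>p q. D a * ent z p q = P p q a) \<Longrightarrow> f z * D a ^ r = F a" using add.IH(1) by blast
  obtain s G where G: "Poly n G"
    "\<And>z a. (\<forall>p q. D a * ent z p q = P p q a) \<Longrightarrow> h z * D a ^ s = G a" using add.IH(2) by blast
  show ?case
  proof (rule exI[of _ "r + s"], rule exI[of _ "\<lambda>a. F a * D a ^ s + G a * D a ^ r"], intro conjI allI impI)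
    show "Poly n (\<lambda>a. F a * D a ^ s + G a * D a ^ r)"
      by (intro Poly_add Poly_mult Poly_power F G assms)
    fix z a assume *: "\<forall>p q. D a * ent z p q = P p q a"
    have "(f z + h z) * D a ^ (r + s) = (f z * D a ^ r) * D a ^ s + (h z * D a ^ s) * D a ^ r"
      by (simp add: power_add algebra_simps)
    then show "(f z + h z) * D a ^ (r + s) = F a * D a ^ s + G a * D a ^ r"
      by (simp only: F(2)[OF *] G(2)[OF *])
  qed
next
  case (mult f h)
  obtain r F where F: "Poly n F"
    "\<And>z a. (\<forall>p q. D a * ent z p q = P p q a) \<Longrightarrow> f z * D a ^ r = F a" using mult.IH(1) by blast
  obtain s G where G: "Poly n G"
    "\<And>z a. (\<forall>p q. D a * ent z p q = P p q a) \<Longrightarrow> h z * D a ^ s = G a" using mult.IH(2) by blast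
  show ?case
  proof (rule exI[of _ "r + s"], rule exI[of _ "\<lambda>a. F a * G a"], intro conjI allI impI)
    show "Poly n (\<lambda>a. F a * G a)" by (intro Poly_mult F G)
    fix z a assume *: "\<forall>p q. D a * ent z p q = P p q a"
    have "(f z * h z) * D a ^ (r + s) = (f z * D a ^ r) * (h z * D a ^ s)"
      by (simp add: power_add algebra_simps)
    then show "(f z * h z) * D a ^ (r + s) = F a * G a"
      by (simp only: F(2)[OF *] G(2)[OF *])
  qed
qed

text \<open>The \<open>(K + 1)\<^sup>n\<^sup>+\<^sup>1\<close> monomials of multidegree at most \<open>K\<close> in \<open>n + 1\<close> functions outnumber, for large \<open>K\<close>,
  the \<open>O(K\<^sup>n)\<close> monomials in \<open>n\<close> parameters through which they are expressed.\<close>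

lemma alg_dependent_rational:
  assumes D: "Poly n D" and P: "\<And>p q. Poly n (P p q)"
  shows "alg_dependent (Suc n) (rational_chart n D P)"
  unfolding alg_dependent_def
proof (intro allI impI)
  fix f assume f: "\<forall>i<Suc n. f i \<in> regular_funs"
  let ?rel = "\<lambda>z a. \<forall>p q. D a * ent z p q = P p q a"
  have "\<forall>i. \<exists>rF. i < Suc n \<longrightarrow> Poly n (snd rF) \<and> (\<forall>z a. ?rel z a \<longrightarrow> f i z * D a ^ fst rF = snd rF a)"
  proof
    fix i
    show "\<exists>rF. i < Suc n \<longrightarrow> Poly n (snd rF) \<and> (\<forall>z a. ?rel z a \<longrightarrow> f i z * D a ^ fst rF = snd rF a)"
    proof (cases "i < Suc n")
      case True
      with f have "f i \<in> regular_funs" by blast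
      from regular_fun_rational[where P = P, OF this D P] obtain r F where
        "Poly n F" "\<forall>z a. ?rel z a \<longrightarrow> f i z * D a ^ r = F a" by blast
      then show ?thesis by (intro exI[of _ "(r, F)"]) simp
    qed simp
  qed
  from choice[OF this] obtain rF where rF: "\<And>i. i < Suc n \<Longrightarrow> Poly n (snd (rF i)) \<and>
    (\<forall>z a. ?rel z a \<longrightarrow> f i z * D a ^ fst (rF i) = snd (rF i) a)" by blast
  define R where "R = (\<Sum>i<Suc n. fst (rF i))"
  define G where "G = (\<lambda>i a. snd (rF i) a * D a ^ (R - fst (rF i)))"
  define E where "E = (\<lambda>a. D a ^ R)"
  have E: "Poly n E" unfolding E_def by (intro Poly_power D)
  have G: "Poly n (G i)" if "i < Suc n" for i
    unfolding G_def using rF[OF that] by (intro Poly_mult Poly_power D) blast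
  have GE: "f i z * E a = G i a" if "i < Suc n" "?rel z a" for i z a
  proof -
    have "fst (rF i) \<le> R" unfolding R_def using that(1) by (intro member_le_sum) auto
    then have "D a ^ R = D a ^ fst (rF i) * D a ^ (R - fst (rF i))" by (simp flip: power_add)
    moreover have "f i z * D a ^ fst (rF i) = snd (rF i) a" using rF[OF that(1)] that(2) by blast
    ultimately show ?thesis unfolding G_def E_def by (simp flip: mult.assoc)
  qed
  obtain d1 where d1: "\<forall>i\<in>{..<Suc n}. pf n d1 (G i)" using common_degree[of "{..<Suc n}" n G] G by auto
  obtain d2 where d2: "pf n d2 E" using E unfolding Poly_def by blast
  define d where "d = max d1 d2"
  have d: "pf n d E" "\<And>i. i < Suc n \<Longrightarrow> pf n d (G i)"
    using d1 d2 by (auto simp: d_def intro: pf_mono)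
  \<comment> \<open>From \<open>?d + 1 \<le> M * (K + 1)\<close> there are at most
    \<open>M ^ n * (K + 1) ^ n\<close> equations for \<open>(K + 1) ^ (n + 1)\<close> unknowns; the
    choice \<open>K = M ^ n\<close> makes the unknowns prevail.\<close>
  define M where "M = Suc n * (2 * d) + 1"
  define K where "K = M ^ n"
  \<comment> \<open>Multiplication by \<open>E a ^ (Suc n * K)\<close> clears the denominators of
    all monomials at once: \<open>f i z ^ e i\<close> consumes \<open>e i\<close> powers of
    \<open>E\<close>, and \<open>K - e i\<close> remain.\<close>
  define T where "T = (\<lambda>e a. \<Prod>i<Suc n. G i a ^ e i * E a ^ (K - e i))"
  let ?d = "Suc n * (K * d + K * d)"
  have T: "pf n ?d (T e)" if "e \<in> exponents (Suc n) K" for e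
  proof -
    have "pf n (K * d + K * d) (\<lambda>a. G i a ^ e i * E a ^ (K - e i))" if i: "i \<in> {..<Suc n}" for i
    proof (rule pf_mult)
      have "e i \<le> K" using i \<open>e \<in> _\<close> by (simp add: exponents_def)
      then show "pf n (K * d) (\<lambda>a. G i a ^ e i)"
        using d(2)[of i] i by (intro pf_mono[OF pf_power]) auto
      show "pf n (K * d) (\<lambda>a. E a ^ (K - e i))"
        using d(1) by (intro pf_mono[OF pf_power]) auto
    qed
    from pf_prod[OF finite_lessThan this] show ?thesis unfolding T_def by (simp only: card_lessThan)
  qed
  have "\<forall>e. \<exists>c. e \<in> exponents (Suc n) K \<longrightarrow> (\<forall>a. T e a = (\<Sum>s\<in>exponents n ?d. c s * pmono n s a))"
    using T unfolding pf_def by blast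
  from choice[OF this] obtain c where
    c: "\<And>e a. e \<in> exponents (Suc n) K \<Longrightarrow> T e a = (\<Sum>s\<in>exponents n ?d. c e s * pmono n s a)" by blast
  have "card (exponents n ?d) < card (exponents (Suc n) K)"
  proof -
    have "?d + 1 \<le> M * (K + 1)" unfolding M_def by (simp add: algebra_simps)
    then have "(?d + 1) ^ n \<le> M ^ n * (K + 1) ^ n" by (metis power_mono power_mult_distrib zero_le)
    also have "\<dots> < (K + 1) * (K + 1) ^ n" unfolding K_def by simp
    finally show ?thesis by (simp add: card_exponents)
  qed
  from homogeneous_system_nontrivial[OF finite_exponents finite_exponents this, of "\<lambda>s e. c e s"]
  obtain v where v: "\<exists>e\<in>exponents (Suc n) K. v e \<noteq> 0"
    "\<And>s. s \<in> exponents n ?d \<Longrightarrow> (\<Sum>e\<in>exponents (Suc n) K. c e s * v e) = 0" by blast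
  have "(\<Sum>e\<in>exponents (Suc n) K. v e * monom_fun (Suc n) f e z) = 0" if z: "z \<in> rational_chart n D P" for z
  proof -
    obtain a where a: "D a \<noteq> 0" "?rel z a" using z unfolding rational_chart_def by blast
    have mono: "monom_fun (Suc n) f e z * E a ^ (Suc n * K) = T e a" if e: "e \<in> exponents (Suc n) K" for e
    proof -
      have "T e a = (\<Prod>i<Suc n. f i z ^ e i * E a ^ K)"
        unfolding T_def
      proof (rule prod.cong)
        fix i assume i: "i \<in> {..<Suc n}"
        then have "e i \<le> K" using e by (simp add: exponents_def)
        then have "E a ^ K = E a ^ e i * E a ^ (K - e i)" by (simp flip: power_add)
        moreover have "G i a = f i z * E a" using i a(2) by (intro GE[symmetric]) auto
        ultimately show "G i a ^ e i * E a ^ (K - e i) = f i z ^ e i * E a ^ K"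
          by (simp only: power_mult_distrib mult.assoc)
      qed simp
      also have "\<dots> = (\<Prod>i<Suc n. f i z ^ e i) * (E a ^ K) ^ Suc n"
        by (simp only: prod.distrib prod_constant card_lessThan)
      finally show ?thesis unfolding monom_fun_def by (metis power_mult mult.commute)
    qed
    have "(\<Sum>e\<in>exponents (Suc n) K. v e * monom_fun (Suc n) f e z) * E a ^ (Suc n * K)
      = (\<Sum>e\<in>exponents (Suc n) K. v e * T e a)"
      unfolding sum_distrib_right by (rule sum.cong) (simp_all only: mult.assoc mono)
    also have "\<dots> = (\<Sum>e\<in>exponents (Suc n) K. \<Sum>s\<in>exponents n ?d. c e s * v e * pmono n s a)"
      unfolding sum_distrib_left by (intro sum.cong refl) (simp add: c sum_distrib_left mult_ac)
    also have "\<dots> = (\<Sum>s\<in>exponents n ?d. (\<Sum>e\<in>exponents (Suc n) K. c e s * v e) * pmono n s a)"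
      by (subst sum.swap) (simp only: sum_distrib_right)
    also have "\<dots> = 0" by (simp add: v(2))
    finally show ?thesis using a(1) by (simp add: E_def)
  qed
  then show "\<exists>d c. (\<exists>e\<in>exponents (Suc n) d. c e \<noteq> 0) \<and>
      (\<forall>z\<in>rational_chart n D P. (\<Sum>e\<in>exponents (Suc n) d. c e * monom_fun (Suc n) f e z) = 0)"
    using v(1) by blast
qed

text \<open>Gaussian elimination: the pivots depend on the parameters, but only finitely many choices occur.\<close>

lemma elimination:
  fixes H :: "'i \<Rightarrow> 'k \<Rightarrow> (nat \<Rightarrow> complex) \<Rightarrow> complex"
  assumes "finite K" "finite I" "\<And>i k. Poly n (H i k)" "\<And>i. Poly n (r i)"
    "\<And>a i. a \<in> A \<Longrightarrow> i \<in> I \<Longrightarrow> (\<Sum>k\<in>K. H i k a * y a k) = r i a"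
    "\<And>a v. a \<in> A \<Longrightarrow> \<forall>i\<in>I. (\<Sum>k\<in>K. H i k a * v k) = 0 \<Longrightarrow> \<forall>k\<in>K. v k = 0"
  shows "\<exists>\<D>. finite \<D> \<and> (\<forall>x\<in>\<D>. Poly n (fst x) \<and> (\<forall>k. Poly n (snd x k))) \<and>
    (\<forall>a\<in>A. \<exists>x\<in>\<D>. fst x a \<noteq> 0 \<and> (\<forall>k\<in>K. fst x a * y a k = snd x k a))"
  using assms
proof (induction K arbitrary: H r A rule: finite_induct)
  case empty
  show ?case by (rule exI[of _ "{(\<lambda>_. 1, \<lambda>_ _. 1)}"]) (simp add: Poly_const)
next
  case (insert k0 K)
  note H = insert.prems(2) and r = insert.prems(3)
  have piv0: "\<exists>\<D>. finite \<D> \<and> (\<forall>x\<in>\<D>. Poly n (fst x) \<and> (\<forall>k. Poly n (snd x k))) \<and>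
    (\<forall>a\<in>{a\<in>A. H i0 k0 a \<noteq> 0}. \<exists>x\<in>\<D>. fst x a \<noteq> 0 \<and> (\<forall>k\<in>insert k0 K. fst x a * y a k = snd x k a))"
    if i0: "i0 \<in> I" for i0
  proof -
    let ?A = "{a\<in>A. H i0 k0 a \<noteq> 0}"
    \<comment> \<open>Fraction-free elimination: cross-multiplication with the pivot keeps the
      coefficients polynomial.\<close>
    let ?H = "\<lambda>i k a. H i0 k0 a * H i k a - H i k0 a * H i0 k a"
    let ?r = "\<lambda>i a. H i0 k0 a * r i a - H i k0 a * r i0 a"
    have split: "(\<Sum>k\<in>K. ?H i k a * v k) = H i0 k0 a * (\<Sum>k\<in>K. H i k a * v k) -
        H i k0 a * (\<Sum>k\<in>K. H i0 k a * v k)" for i a v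
      by (simp add: left_diff_distrib sum_subtractf sum_distrib_left mult.assoc)
    have ins: "(\<Sum>k\<in>insert k0 K. H i k a * v k) = H i k0 a * v k0 + (\<Sum>k\<in>K. H i k a * v k)" for i a v
      using insert.hyps by simp
    have "\<exists>\<D>. finite \<D> \<and> (\<forall>x\<in>\<D>. Poly n (fst x) \<and> (\<forall>k. Poly n (snd x k))) \<and>
      (\<forall>a\<in>?A. \<exists>x\<in>\<D>. fst x a \<noteq> 0 \<and> (\<forall>k\<in>K. fst x a * y a k = snd x k a))"
    proof (rule insert.IH[where H = ?H and r = ?r])
      show "finite I" by fact
      show "Poly n (?H i k)" for i k by (intro Poly_diff Poly_mult H)
      show "Poly n (?r i)" for i by (intro Poly_diff Poly_mult H r)
      show "(\<Sum>k\<in>K. ?H i k a * y a k) = ?r i a" if "a \<in> ?A" "i \<in> I" for a i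
      proof -
        have *: "(\<Sum>k\<in>K. H j k a * y a k) = r j a - H j k0 a * y a k0" if "j \<in> I" for j
          using insert.prems(4)[of a j] \<open>a \<in> ?A\<close> that ins[of j a "y a"] by (simp add: eq_diff_eq add.commute)
        show ?thesis unfolding split *[OF i0] *[OF \<open>i \<in> I\<close>] by (simp add: algebra_simps)
      qed
      show "\<forall>k\<in>K. v k = 0" if a: "a \<in> ?A" and v: "\<forall>i\<in>I. (\<Sum>k\<in>K. ?H i k a * v k) = 0" for a v
      proof -
        \<comment> \<open>A solution of the reduced homogeneous system extends to the full one by
          solving row \<open>i0\<close> for \<open>k0\<close>, so the kernel stays trivial.\<close>
        define w where "w = v(k0 := - (\<Sum>k\<in>K. H i0 k a * v k) / H i0 k0 a)"
        have w: "(\<Sum>k\<in>K. H i k a * w k) = (\<Sum>k\<in>K. H i k a * v k)" for i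
          using insert.hyps by (intro sum.cong) (auto simp: w_def)
        have "\<forall>i\<in>I. (\<Sum>k\<in>insert k0 K. H i k a * w k) = 0"
        proof
          fix i assume i: "i \<in> I"
          let ?S = "\<Sum>k\<in>K. H i k a * v k" and ?U = "\<Sum>k\<in>K. H i0 k a * v k"
          have "(\<Sum>k\<in>K. ?H i k a * v k) = 0" using v i by blast
          then have "H i0 k0 a * ?S = H i k0 a * ?U" unfolding split by simp
          then have "?S = H i k0 a * ?U / H i0 k0 a" using a by (simp add: eq_divide_eq mult.commute)
          then show "(\<Sum>k\<in>insert k0 K. H i k a * w k) = 0"
            unfolding ins w by (simp add: w_def)
        qed
        then have "\<forall>k\<in>insert k0 K. w k = 0" using insert.prems(5)[of a w] a by blast
        then show ?thesis using insert.hyps by (auto simp: w_def split: if_splits)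
      qed
    qed
    then obtain \<D> where \<D>: "finite \<D>" "\<forall>x\<in>\<D>. Poly n (fst x) \<and> (\<forall>k. Poly n (snd x k))"
      "\<forall>a\<in>?A. \<exists>x\<in>\<D>. fst x a \<noteq> 0 \<and> (\<forall>k\<in>K. fst x a * y a k = snd x k a)"
      by (elim exE conjE)
    define up where "up = (\<lambda>x. (\<lambda>a. fst x a * H i0 k0 a,
      \<lambda>k a. if k = k0 then r i0 a * fst x a - (\<Sum>k\<in>K. H i0 k a * snd x k a) else snd x k a * H i0 k0 a))"
    have up1: "Poly n (fst (up x)) \<and> (\<forall>k. Poly n (snd (up x) k))" if "x \<in> \<D>" for x
    proof
      have x: "Poly n (fst x)" "\<And>k. Poly n (snd x k)" using \<D>(2) that by simp_all
      show "Poly n (fst (up x))" unfolding up_def fst_conv by (intro Poly_mult H x)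
      show "\<forall>k. Poly n (snd (up x) k)"
      proof
        fix k
        have "Poly n (\<lambda>a. r i0 a * fst x a - (\<Sum>k\<in>K. H i0 k a * snd x k a))"
          by (intro Poly_diff Poly_sum Poly_mult H r x)
        moreover have "Poly n (\<lambda>a. snd x k a * H i0 k0 a)" by (intro Poly_mult H x)
        ultimately show "Poly n (snd (up x) k)" unfolding up_def by (cases "k = k0") simp_all
      qed
    qed
    have up2: "\<exists>x\<in>\<D>. fst (up x) a \<noteq> 0 \<and> (\<forall>k\<in>insert k0 K. fst (up x) a * y a k = snd (up x) k a)"
      if a: "a \<in> ?A" for a
    proof -
      have "\<exists>x\<in>\<D>. fst x a \<noteq> 0 \<and> (\<forall>k\<in>K. fst x a * y a k = snd x k a)"
        using \<D>(3) a by (rule bspec)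
      then obtain x where x: "x \<in> \<D>" "fst x a \<noteq> 0 \<and> (\<forall>k\<in>K. fst x a * y a k = snd x k a)"
        by (elim bexE)
      have "H i0 k0 a * y a k0 + (\<Sum>k\<in>K. H i0 k a * y a k) = r i0 a"
        using insert.prems(4)[of a i0] a i0 ins[of i0 a "y a"] by simp
      then have "r i0 a * fst x a = (H i0 k0 a * y a k0 + (\<Sum>k\<in>K. H i0 k a * y a k)) * fst x a"
        by simp
      also have "\<dots> = H i0 k0 a * y a k0 * fst x a + (\<Sum>k\<in>K. H i0 k a * snd x k a)"
        unfolding distrib_right sum_distrib_right using x(2)
        by (intro arg_cong2[where f = plus] refl sum.cong) (simp_all add: mult_ac)
      finally have "fst x a * H i0 k0 a * y a k0 = r i0 a * fst x a - (\<Sum>k\<in>K. H i0 k a * snd x k a)"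
        by (simp add: mult_ac)
      moreover have "fst x a * H i0 k0 a * y a k = snd x k a * H i0 k0 a" if "k \<in> K" for k
        using x(2) that by (simp add: mult_ac)
      ultimately have "fst (up x) a * y a k = snd (up x) k a" if "k \<in> insert k0 K" for k
        using that insert.hyps(2) by (cases "k = k0") (simp_all add: up_def)
      moreover have "fst (up x) a \<noteq> 0" using x(2) a by (simp add: up_def)
      ultimately show ?thesis using x(1) by blast
    qed
    show ?thesis
    proof (rule exI[of _ "up ` \<D>"], intro conjI)
      show "finite (up ` \<D>)" using \<D>(1) by simp
      show "\<forall>x\<in>up ` \<D>. Poly n (fst x) \<and> (\<forall>k. Poly n (snd x k))" using up1 by simp
      show "\<forall>a\<in>?A. \<exists>x\<in>up ` \<D>. fst x a \<noteq> 0 \<and> (\<forall>k\<in>insert k0 K. fst x a * y a k = snd x k a)"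
        using up2 by simp
    qed
  qed
  have "\<forall>i0. \<exists>\<D>. i0 \<in> I \<longrightarrow> finite \<D> \<and> (\<forall>x\<in>\<D>. Poly n (fst x) \<and> (\<forall>k. Poly n (snd x k))) \<and>
    (\<forall>a\<in>{a\<in>A. H i0 k0 a \<noteq> 0}. \<exists>x\<in>\<D>. fst x a \<noteq> 0 \<and> (\<forall>k\<in>insert k0 K. fst x a * y a k = snd x k a))"
  proof (intro allI)
    fix i0
    show "\<exists>\<D>. i0 \<in> I \<longrightarrow> finite \<D> \<and> (\<forall>x\<in>\<D>. Poly n (fst x) \<and> (\<forall>k. Poly n (snd x k))) \<and>
      (\<forall>a\<in>{a\<in>A. H i0 k0 a \<noteq> 0}. \<exists>x\<in>\<D>. fst x a \<noteq> 0 \<and> (\<forall>k\<in>insert k0 K. fst x a * y a k = snd x k a))"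
    proof (cases "i0 \<in> I")
      case True
      then show ?thesis by (simp only: simp_thms piv0[OF True])
    qed simp
  qed
  from choice[OF this] obtain \<D> where \<D>: "\<forall>i0. i0 \<in> I \<longrightarrow> finite (\<D> i0) \<and>
      (\<forall>x\<in>\<D> i0. Poly n (fst x) \<and> (\<forall>k. Poly n (snd x k))) \<and>
      (\<forall>a\<in>{a\<in>A. H i0 k0 a \<noteq> 0}. \<exists>x\<in>\<D> i0. fst x a \<noteq> 0 \<and>
        (\<forall>k\<in>insert k0 K. fst x a * y a k = snd x k a))" ..
  \<comment> \<open>If column \<open>k0\<close> vanished at \<open>a\<close>, its indicator vector
    would lie in the kernel.\<close>
  have piv: "\<exists>i0\<in>I. H i0 k0 a \<noteq> 0" if "a \<in> A" for a
  proof (rule ccontr)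
    assume "\<not> ?thesis"
    then have "\<forall>i\<in>I. (\<Sum>k\<in>insert k0 K. H i k a * (if k = k0 then 1 else 0)) = 0"
      using insert.hyps by (auto intro!: sum.neutral)
    from insert.prems(5)[OF that this] show False by auto
  qed
  show ?case
  proof (rule exI[of _ "\<Union>i0\<in>I. \<D> i0"], intro conjI)
    show "finite (\<Union>i0\<in>I. \<D> i0)" using insert.prems(1) \<D> by simp
    show "\<forall>x\<in>\<Union>i0\<in>I. \<D> i0. Poly n (fst x) \<and> (\<forall>k. Poly n (snd x k))" using \<D> by simp
    show "\<forall>a\<in>A. \<exists>x\<in>\<Union>i0\<in>I. \<D> i0. fst x a \<noteq> 0 \<and> (\<forall>k\<in>insert k0 K. fst x a * y a k = snd x k a)"
    proof
      fix a assume a: "a \<in> A"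
      then obtain i0 where i0: "i0 \<in> I" "H i0 k0 a \<noteq> 0" using piv by blast
      have "\<exists>x\<in>\<D> i0. fst x a \<noteq> 0 \<and> (\<forall>k\<in>insert k0 K. fst x a * y a k = snd x k a)"
        using \<D> i0 a by simp
      with i0(1) show "\<exists>x\<in>\<Union>i0\<in>I. \<D> i0. fst x a \<noteq> 0 \<and> (\<forall>k\<in>insert k0 K. fst x a * y a k = snd x k a)"
        by blast
    qed
  qed
qed

section \<open>Root groups and monomial matrices\<close>

text \<open>For \<open>c\<close> and \<open>d\<close> incongruent modulo 3 this is a real root
  vector of the loop algebra. It depends on \<open>(c, d)\<close> only up to a common translation by
  3.\<close>

definition unit_mat :: "int \<Rightarrow> int \<Rightarrow> loop_matrix" where
  "unit_mat c d = (\<chi> i j. if i = of_int c \<and> j = of_int d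
     then lmonom ((d - 1) div 3 - (c - 1) div 3) 1 else 0)"

definition emat :: "int \<Rightarrow> int \<Rightarrow> complex \<Rightarrow> loop_matrix" where
  "emat c d x = mat 1 + lscale x (unit_mat c d)"

lemma of_int_eq_iff3: "(of_int p :: 3) = of_int q \<longleftrightarrow> 3 dvd p - q"
proof
  assume "(of_int p :: 3) = of_int q"
  then have "(p - 1) mod 3 = (q - 1) mod 3" by (metis row_of_int add_right_cancel)
  then show "3 dvd p - q" by presburger
next
  assume "3 dvd p - q"
  then obtain k where "p - q = 3 * k" ..
  then have "p = q + 3 * k" by simp
  then show "(of_int p :: 3) = of_int q" by (simp only: of_int_period)
qed

lemma ent_unit_mat: "ent (unit_mat c d) p q = (if 3 dvd p - c \<and> q - d = p - c then 1 else 0)"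
proof -
  have "ent (unit_mat c d) p q =
    (if 3 dvd p - c \<and> 3 dvd q - d \<and> (d - 1) div 3 - (c - 1) div 3 = (q - 1) div 3 - (p - 1) div 3 then 1 else 0)"
    unfolding ent_def unit_mat_def vec_lambda_beta of_int_eq_iff3
    by (cases "3 dvd p - c"; cases "3 dvd q - d") (simp_all only: if_True if_False simp_thms lookup_single when_def lookup_zero)
  also have "(3 dvd p - c \<and> 3 dvd q - d \<and> (d - 1) div 3 - (c - 1) div 3 = (q - 1) div 3 - (p - 1) div 3)
    \<longleftrightarrow> (3 dvd p - c \<and> q - d = p - c)"
  proof -
    have sh: "(x + 3 * k - 1) div 3 = (x - 1) div 3 + k" for x k :: int by presburger
    show ?thesis
    proof (cases "3 dvd p - c \<and> 3 dvd q - d")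
      case True
      then obtain k l where kl: "p - c = 3 * k" "q - d = 3 * l" by (elim conjE dvdE)
      then have pq: "p = c + 3 * k" "q = d + 3 * l" by simp_all
      show ?thesis using True unfolding pq sh by auto
    next
      case False
      then show ?thesis by auto
    qed
  qed
  finally show ?thesis .
qed

lemma ent_emat: "ent (emat c d x) p q =
    (if p = q then 1 else 0) + (if 3 dvd p - c \<and> q - d = p - c then x else 0)"
  unfolding emat_def ent_add ent_lscale ent_one ent_unit_mat by simp

lemma ent_unit_mult: "ent (unit_mat c d ** g) p q = (if 3 dvd p - c then ent g (p - c + d) q else 0)"
proof -
  have "ent (unit_mat c d ** g) p q = (\<Sum>r\<in>{p - c + d}. ent (unit_mat c d) p r * ent g r q)"
    by (rule ent_mult) (auto simp: ent_unit_mat)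
  then show ?thesis by (simp add: ent_unit_mat)
qed

lemma ent_mult_unit: "ent (g ** unit_mat c d) p q = (if 3 dvd q - d then ent g p (q - d + c) else 0)"
proof -
  have "ent (g ** unit_mat c d) p q = (\<Sum>r\<in>{q - d + c}. ent g p r * ent (unit_mat c d) r q)"
    by (rule ent_mult) (auto simp: ent_unit_mat)
  then show ?thesis by (simp add: ent_unit_mat)
qed

lemma ent_emat_mult: "ent (emat c d x ** g) p q = ent g p q + (if 3 dvd p - c then x * ent g (p - c + d) q else 0)"
  unfolding emat_def matrix_add_rdistrib mult_lscale_left ent_add ent_lscale ent_unit_mult by simp

lemma ent_mult_emat: "ent (g ** emat c d x) p q = ent g p q + (if 3 dvd q - d then x * ent g p (q - d + c) else 0)"
  unfolding emat_def matrix_add_ldistrib mult_lscale_right ent_add ent_lscale ent_mult_unit by simp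

lemma unit_mat_square: "\<not> 3 dvd c - d \<Longrightarrow> unit_mat c d ** unit_mat c d = 0"
proof (rule ent_eqI)
  fix p q assume cd: "\<not> 3 dvd c - d"
  have "\<not> (3 dvd p - c \<and> 3 dvd p - c + d - c)"
  proof
    assume a: "3 dvd p - c \<and> 3 dvd p - c + d - c"
    then have "3 dvd (p - c) - (p - c + d - c)" using dvd_diff by blast
    with cd show False by simp
  qed
  then show "ent (unit_mat c d ** unit_mat c d) p q = ent 0 p q"
    unfolding ent_unit_mult ent_unit_mat by auto
qed

lemma emat_mult_neg: "\<not> 3 dvd c - d \<Longrightarrow> emat c d x ** emat c d (- x) = mat 1"
  using one_minus_square_zero[OF unit_mat_square, of c d "- x"] by (simp add: emat_def)

lemma root_elem_pos_emat: "root_elem_pos i x = emat (row i) (row i + 1) x"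
proof (rule ent_eqI)
  fix p q
  have l: "(of_int (row i + 1) :: 3) = i + 1" by simp
  have "(0::3) = 3" by simp
  then have z: "i = 0 \<longleftrightarrow> i = 3" by (simp only:)
  have k: "(row i + 1 - 1) div 3 - (row i - 1) div 3 = (if i = 0 then 1 else 0)"
    unfolding z using exhaust3[of i] by auto
  have "root_elem_pos i x = emat (row i) (row i + 1) x"
    unfolding root_elem_pos_def elem_matrix_def emat_def unit_mat_def l k of_int_row
    by (simp add: vec_eq_iff mat_def lscale_def mult_single)
  then show "ent (root_elem_pos i x) p q = ent (emat (row i) (row i + 1) x) p q" by simp
qed

lemma root_elem_neg_emat: "root_elem_neg i x = emat (row i + 1) (row i) x"
proof -
  have l: "(of_int (row i + 1) :: 3) = i + 1" by simp
  have "(0::3) = 3" by simp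
  then have z: "i = 0 \<longleftrightarrow> i = 3" by (simp only:)
  have k: "(row i - 1) div 3 - (row i + 1 - 1) div 3 = (if i = 0 then -1 else 0)"
    unfolding z using exhaust3[of i] by auto
  show ?thesis
    unfolding root_elem_neg_def elem_matrix_def emat_def unit_mat_def l k of_int_row
    by (simp add: vec_eq_iff mat_def lscale_def mult_single)
qed

lemma det_emat: "\<not> 3 dvd c - d \<Longrightarrow> det (emat c d x) = 1"
proof -
  assume "\<not> 3 dvd c - d"
  then have ne: "(of_int c :: 3) \<noteq> of_int d" by (simp add: of_int_eq_iff3)
  define i j where "i = (of_int c :: 3)" and "j = (of_int d :: 3)"
  define f where "f = lmonom ((d - 1) div 3 - (c - 1) div 3) x"
  have e: "emat c d x = elem_matrix i j f"
    unfolding emat_def unit_mat_def elem_matrix_def i_def j_def f_def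
    by (simp add: vec_eq_iff mat_def lscale_def mult_single)
  have "i \<noteq> j" using ne by (simp add: i_def j_def)
  then show "det (emat c d x) = 1"
    unfolding e elem_matrix_def det_3 using exhaust3[of i] exhaust3[of j]
    by (elim disjE) (simp_all only: vec_lambda_beta three_neq simp_thms if_True if_False, simp_all)
qed

lemma emat_KM: "\<not> 3 dvd c - d \<Longrightarrow> emat c d x \<in> KM_group"
  by (simp add: KM_group_def det_emat)

lemma emat_Borel: "c < d \<Longrightarrow> \<not> 3 dvd c - d \<Longrightarrow> emat c d x \<in> Borel"
  by (auto simp: Borel_iff det_emat upper_def ent_emat)

text \<open>Here \<open>z\<close> sends a row to the column of its nonzero entry, so matrix products
  reverse the order of composition. The same convention governs \<open>win\<close>.\<close>

definition monomial :: "loop_matrix \<Rightarrow> (int \<Rightarrow> int) \<Rightarrow> bool" where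
  "monomial M z \<longleftrightarrow> (\<forall>p. ent M p (z p) \<noteq> 0) \<and> (\<forall>p q. q \<noteq> z p \<longrightarrow> ent M p q = 0)"

lemma ent_monomial_mult:
  assumes "monomial M z" shows "ent (M ** g) p q = ent M p (z p) * ent g (z p) q"
proof -
  have "ent (M ** g) p q = (\<Sum>r\<in>{z p}. ent M p r * ent g r q)"
    by (rule ent_mult) (use assms in \<open>auto simp: monomial_def\<close>)
  then show ?thesis by simp
qed

lemma ent_mult_monomial:
  assumes "monomial M z" "inj z" shows "ent (g ** M) p (z r) = ent g p r * ent M r (z r)"
proof -
  have "ent (g ** M) p (z r) = (\<Sum>r\<in>{r}. ent g p r * ent M r (z r))"
    by (subst ent_mult[of "{r}"]) (use assms in \<open>auto simp: monomial_def inj_eq\<close>)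
  then show ?thesis by simp
qed

lemma monomial_mult:
  assumes "monomial M z" "monomial M' z'" shows "monomial (M ** M') (z' \<circ> z)"
  unfolding monomial_def ent_monomial_mult[OF assms(1)]
  using assms by (auto simp: monomial_def)

lemma monomial_one: "monomial (mat 1) id"
  by (simp add: monomial_def ent_one)

definition swap :: "int \<Rightarrow> int \<Rightarrow> int \<Rightarrow> int" where
  "swap c d p = (if 3 dvd p - c then p - c + d else if 3 dvd p - d then p - d + c else p)"

lemma swap_swap: "\<not> 3 dvd c - d \<Longrightarrow> swap c d (swap c d p) = p"
proof -
  assume cd: "\<not> 3 dvd c - d"
  have 1: "3 dvd p - c + d - c \<Longrightarrow> 3 dvd p - c \<Longrightarrow> False"
    using cd dvd_diff[of 3 "p - c" "p - c + d - c"] by simp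
  have 2: "3 dvd p - d \<Longrightarrow> 3 dvd p - c \<Longrightarrow> False"
    using cd dvd_diff[of 3 "p - d" "p - c"] by simp
  show ?thesis unfolding swap_def using 1 2 by auto
qed

text \<open>The standard SL(2) representative of a reflection. The parameter is kept free because
  \<open>emat_lower_decomposition\<close> uses all nonzero values.\<close>

definition weyl_mat :: "int \<Rightarrow> int \<Rightarrow> complex \<Rightarrow> loop_matrix" where
  "weyl_mat c d x = emat c d x ** emat d c (- inverse x) ** emat c d x"

lemma ent_weyl_mat:
  assumes "\<not> 3 dvd c - d" "x \<noteq> 0"
  shows "ent (weyl_mat c d x) p q = (if q = swap c d p then if 3 dvd p - c then x
    else if 3 dvd p - d then - inverse x else 1 else 0)"
proof -
  have dc: "\<not> 3 dvd d - c" using assms(1) by (simp add: dvd_diff_commute)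
  have 1: "3 dvd p - c \<Longrightarrow> \<not> 3 dvd p - d" for p
    using assms(1) dvd_diff[of 3 "p - d" "p - c"] by auto
  have 3: "3 dvd p - d \<Longrightarrow> 3 dvd p - d + c - c" "3 dvd p - c \<Longrightarrow> 3 dvd p - c + d - d" by simp_all
  show ?thesis
  proof (cases "3 dvd p - c")
    case True
    then show ?thesis using 1[OF True] dc assms 1[of "p - c + d"]
      unfolding weyl_mat_def matrix_mul_assoc[symmetric] ent_emat_mult ent_emat swap_def
      by (auto simp: field_simps)
  next
    case False
    show ?thesis
    proof (cases "3 dvd p - d")
      case True
      then show ?thesis using False dc assms 1[of "p - d + c"]
        unfolding weyl_mat_def matrix_mul_assoc[symmetric] ent_emat_mult ent_emat swap_def
        by (auto simp: field_simps)
    next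
      case f: False
      with False show ?thesis
        unfolding weyl_mat_def matrix_mul_assoc[symmetric] ent_emat_mult ent_emat swap_def by auto
    qed
  qed
qed

lemma monomial_weyl_mat: "\<not> 3 dvd c - d \<Longrightarrow> x \<noteq> 0 \<Longrightarrow> monomial (weyl_mat c d x) (swap c d)"
  by (simp add: monomial_def ent_weyl_mat)

lemma weyl_mat_KM: "\<not> 3 dvd c - d \<Longrightarrow> weyl_mat c d x \<in> KM_group"
  unfolding weyl_mat_def by (intro KM_mult emat_KM) (simp_all add: dvd_diff_commute)

lemma weyl_mat_inverse:
  assumes "\<not> 3 dvd c - d" shows "weyl_mat c d x ** weyl_mat c d (- x) = mat 1"
proof -
  have dc: "\<not> 3 dvd d - c" using assms(1) by (simp add: dvd_diff_commute)
  have "weyl_mat c d x ** weyl_mat c d (- x) = emat c d x ** (emat d c (- inverse x) **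
    (emat c d x ** emat c d (- x)) ** emat d c (inverse x)) ** emat c d (- x)"
    by (simp add: weyl_mat_def matrix_mul_assoc)
  then show ?thesis using emat_mult_neg[OF assms] emat_mult_neg[OF dc, of "- inverse x"] by simp
qed

lemma simple_lift_weyl: "simple_lift i = weyl_mat (row i) (row i + 1) 1"
  by (simp add: simple_lift_def weyl_mat_def root_elem_pos_emat root_elem_neg_emat)

lemma row_ndvd: "\<not> 3 dvd row i - (row i + 1)" "\<not> 3 dvd (row i + 1) - row i"
  by simp_all

text \<open>Positive roots are pairs of positions \<open>q < p\<close>; a simple reflection permutes
  all of them except its own.\<close>

lemma swap_mono:
  assumes "q < p" "\<not> (3 dvd q - c \<and> p = q + 1)"
  shows "swap c (c + 1) q < swap c (c + 1) p"
proof -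
  have c: "swap c (c + 1) x = (if 3 dvd x - c then x + 1 else if 3 dvd x - (c + 1) then x - 1 else x)" for x
    by (simp add: swap_def)
  have n: "\<not> (3 dvd x - c \<and> 3 dvd x - (c + 1))" for x by presburger
  have m: "\<not> (3 dvd q - c \<and> 3 dvd p - c \<and> p \<le> q + 2)" using assms(1) by presburger
  have m': "\<not> (3 dvd q - c \<and> p = q + 2 \<and> 3 dvd p - (c + 1))" by presburger
  have m'': "\<not> (3 dvd q - (c + 1) \<and> 3 dvd p - (c + 1) \<and> p \<le> q + 2)" using assms(1) by presburger
  show ?thesis unfolding c using assms n[of p] n[of q] m m' m'' by (smt (verit))
qed

text \<open>Splitting off the simple root group: \<open>x\<close> is chosen to kill the entries of
  \<open>b\<close> at the simple root. By \<open>swap_mono\<close> the rest stays upper triangular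
  when conjugated by the simple reflection.\<close>

lemma Borel_simple:
  assumes "b \<in> Borel"
  shows "\<exists>x. \<exists>b'\<in>Borel. b ** simple_lift i = root_elem_pos i x ** simple_lift i ** b'"
proof -
  let ?c = "row i"
  let ?s = "weyl_mat ?c (?c + 1) 1" and ?t = "weyl_mat ?c (?c + 1) (- 1)"
  define x where "x = ent b ?c (?c + 1) / ent b (?c + 1) (?c + 1)"
  define b1 where "b1 = emat ?c (?c + 1) (- x) ** b"
  have b1: "upper b1" "det b1 = 1"
    unfolding b1_def using assms emat_Borel[of ?c "?c + 1"] row_ndvd[of i]
    by (auto simp: Borel_iff upper_mult det_mul)
  have z: "ent b1 q (q + 1) = 0" if "3 dvd q - ?c" for q
  proof -
    from that obtain k where k: "q - ?c = 3 * k" ..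
    then have "q = ?c + 3 * k" by simp
    then have "ent b1 q (q + 1) = ent b1 (?c + 3 * k) (?c + 1 + 3 * k)" by (simp add: add_ac)
    also have "\<dots> = ent b1 ?c (?c + 1)" by (rule ent_period)
    also have "\<dots> = 0" unfolding b1_def ent_emat_mult using Borel_diag[OF assms] by (simp add: x_def)
    finally show ?thesis .
  qed
  define b' where "b' = ?t ** b1 ** ?s"
  have nd: "\<not> 3 dvd ?c - (?c + 1)" by simp
  have ms: "monomial ?s (swap ?c (?c + 1))" "monomial ?t (swap ?c (?c + 1))"
    using monomial_weyl_mat[OF nd] by simp_all
  have inj: "inj (swap ?c (?c + 1))" using swap_swap[OF nd] by (metis injI)
  have "upper b'"
    unfolding upper_def
  proof (intro allI impI)
    fix p q :: int assume qp: "q < p"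
    let ?q = "swap ?c (?c + 1) q" and ?p = "swap ?c (?c + 1) p"
    have "ent b' p q = ent ?t p ?p * (ent b1 ?p ?q * ent ?s ?q q)"
      using ent_mult_monomial[OF ms(1) inj, of b1 ?p ?q]
      unfolding b'_def matrix_mul_assoc[symmetric] ent_monomial_mult[OF ms(2)] swap_swap[OF nd] by simp
    moreover have "ent b1 ?p ?q = 0"
    proof (cases "3 dvd q - ?c \<and> p = q + 1")
      case True
      then have "\<not> 3 dvd q + 1 - ?c" by presburger
      with True have "?q = q + 1" "?p = q" by (auto simp: swap_def)
      with True z show ?thesis by simp
    next
      case False
      then show ?thesis using swap_mono[OF qp False] b1(1) by (simp add: upper_def)
    qed
    ultimately show "ent b' p q = 0" by simp
  qed
  moreover have "det b' = 1"
    using b1(2) weyl_mat_KM[OF nd] by (simp add: b'_def det_mul KM_group_def)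
  ultimately have "b' \<in> Borel" by (simp add: Borel_iff)
  moreover have "b ** ?s = emat ?c (?c + 1) x ** ?s ** b'"
  proof -
    have "emat ?c (?c + 1) x ** ?s ** b' = emat ?c (?c + 1) x ** (?s ** ?t) ** b1 ** ?s"
      by (simp add: b'_def matrix_mul_assoc)
    also have "?s ** ?t = mat 1" by (rule weyl_mat_inverse[OF nd])
    also have "emat ?c (?c + 1) x ** mat 1 ** b1 = (emat ?c (?c + 1) x ** emat ?c (?c + 1) (- x)) ** b"
      by (simp add: b1_def matrix_mul_assoc)
    also have "emat ?c (?c + 1) x ** emat ?c (?c + 1) (- x) = mat 1" by (rule emat_mult_neg[OF nd])
    finally show ?thesis by simp
  qed
  ultimately show ?thesis unfolding simple_lift_weyl root_elem_pos_emat by blast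
qed

text \<open>Coordinates on a Bruhat cell, one parameter per letter of an arbitrary word;
  \<open>k\<close> is the index of the first parameter used.\<close>

fun cell_param :: "nat \<Rightarrow> 3 list \<Rightarrow> (nat \<Rightarrow> complex) \<Rightarrow> loop_matrix" where
  "cell_param k [] a = mat 1"
| "cell_param k (i # is) a = root_elem_pos i (a k) ** simple_lift i ** cell_param (Suc k) is a"

fun cell_param_inv :: "nat \<Rightarrow> 3 list \<Rightarrow> (nat \<Rightarrow> complex) \<Rightarrow> loop_matrix" where
  "cell_param_inv k [] a = mat 1"
| "cell_param_inv k (i # is) a = cell_param_inv (Suc k) is a **
     (weyl_mat (row i) (row i + 1) (- 1) ** root_elem_pos i (- a k))"

lemma cell_param_cong: "(\<And>j. j \<ge> k \<Longrightarrow> a j = a' j) \<Longrightarrow> cell_param k is a = cell_param k is a'"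
  by (induction "is" arbitrary: k) auto

lemma Borel_word:
  assumes "b \<in> Borel"
  shows "\<exists>a. \<exists>b'\<in>Borel. b ** word_lift is = cell_param k is a ** b'"
  using assms
proof (induction "is" arbitrary: b k)
  case Nil
  then show ?case by (auto simp: word_lift_def)
next
  case (Cons i "is")
  obtain x b1 where b1: "b1 \<in> Borel" "b ** simple_lift i = root_elem_pos i x ** simple_lift i ** b1"
    using Borel_simple[OF Cons.prems] by blast
  obtain a b' where b': "b' \<in> Borel" "b1 ** word_lift is = cell_param (Suc k) is a ** b'"
    using Cons.IH[OF b1(1)] by blast
  let ?a = "a(k := x)"
  have "b ** word_lift (i # is) = b ** simple_lift i ** word_lift is"
    by (simp add: word_lift_def matrix_mul_assoc)
  also have "\<dots> = root_elem_pos i x ** simple_lift i ** (b1 ** word_lift is)"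
    by (simp add: b1 matrix_mul_assoc)
  also have "\<dots> = root_elem_pos i x ** simple_lift i ** cell_param (Suc k) is a ** b'"
    by (simp add: b' matrix_mul_assoc)
  also have "cell_param (Suc k) is a = cell_param (Suc k) is ?a"
    by (rule cell_param_cong) auto
  finally have "b ** word_lift (i # is) = cell_param k (i # is) ?a ** b'" by simp
  with b'(1) show ?case by blast
qed

lemma cell_param_KM: "cell_param k is a \<in> KM_group"
  by (induction "is" arbitrary: k)
    (auto intro!: KM_mult KM_one emat_KM weyl_mat_KM simp: root_elem_pos_emat simple_lift_weyl)

lemma cell_param_inverse: "cell_param k is a ** cell_param_inv k is a = mat 1"
proof (induction "is" arbitrary: k)
  case (Cons i "is")
  let ?s = "weyl_mat (row i) (row i + 1) 1" and ?t = "weyl_mat (row i) (row i + 1) (- 1)"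
  have "cell_param k (i # is) a ** cell_param_inv k (i # is) a = root_elem_pos i (a k) **
    (?s ** (cell_param (Suc k) is a ** cell_param_inv (Suc k) is a) ** ?t) ** root_elem_pos i (- a k)"
    by (simp add: matrix_mul_assoc simple_lift_weyl)
  also have "\<dots> = root_elem_pos i (a k) ** (?s ** ?t) ** root_elem_pos i (- a k)"
    by (simp add: Cons.IH)
  also have "?s ** ?t = mat 1" by (rule weyl_mat_inverse) simp
  also have "root_elem_pos i (a k) ** mat 1 ** root_elem_pos i (- a k) = mat 1"
    unfolding root_elem_pos_emat by (simp add: emat_mult_neg)
  finally show ?case .
qed simp

text \<open>The bandwidth is uniform in the parameters, so that a product is a sum over a fixed
  finite range and hence again polynomial.\<close>

definition poly_family :: "nat \<Rightarrow> ((nat \<Rightarrow> complex) \<Rightarrow> loop_matrix) \<Rightarrow> bool" where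
  "poly_family n G \<longleftrightarrow> (\<forall>p q. Poly n (\<lambda>a. ent (G a) p q)) \<and>
     (\<exists>N. \<forall>a p q. \<bar>p - q\<bar> > N \<longrightarrow> ent (G a) p q = 0)"

lemma poly_family_const: "poly_family n (\<lambda>_. g)"
  unfolding poly_family_def using ent_banded[of g] by (auto simp: Poly_const)

lemma poly_family_mult:
  assumes "poly_family n G" "poly_family n G'" shows "poly_family n (\<lambda>a. G a ** G' a)"
proof -
  obtain N where N: "\<And>a p q. \<bar>p - q\<bar> > N \<Longrightarrow> ent (G a) p q = 0"
    using assms(1) unfolding poly_family_def by blast
  obtain N' where N': "\<And>a p q. \<bar>p - q\<bar> > N' \<Longrightarrow> ent (G' a) p q = 0"
    using assms(2) unfolding poly_family_def by blast
  have m: "ent (G a ** G' a) p q = (\<Sum>r\<in>{p-N..p+N}. ent (G a) p r * ent (G' a) r q)" for a p q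
  proof (rule ent_mult)
    fix r assume "r \<notin> {p-N..p+N}"
    then have "\<bar>p - r\<bar> > N" by auto
    then show "ent (G a) p r * ent (G' a) r q = 0" by (simp add: N)
  qed simp
  show ?thesis
    unfolding poly_family_def
  proof (intro conjI allI exI impI)
    fix p q show "Poly n (\<lambda>a. ent (G a ** G' a) p q)"
      unfolding m using assms by (intro Poly_sum Poly_mult) (simp_all add: poly_family_def)
    fix a p q assume *: "\<bar>p - q\<bar> > \<bar>N\<bar> + \<bar>N'\<bar>"
    have "ent (G a) p r * ent (G' a) r q = 0" for r
    proof (cases "\<bar>p - r\<bar> > N")
      case False
      then have "\<bar>r - q\<bar> > N'" using * by linarith
      then show ?thesis by (simp add: N')
    qed (simp add: N)
    then show "ent (G a ** G' a) p q = 0" unfolding m by (intro sum.neutral ballI)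
  qed
qed

lemma poly_family_emat:
  assumes "Poly n F" shows "poly_family n (\<lambda>a. emat c d (F a))"
  unfolding poly_family_def
proof (intro conjI allI exI impI)
  fix p q
  have "Poly n (\<lambda>a. if 3 dvd p - c \<and> q - d = p - c then F a else 0)"
  proof (cases "3 dvd p - c \<and> q - d = p - c")
    case True
    show ?thesis unfolding if_P[OF True] using assms by simp
  next
    case False
    show ?thesis unfolding if_not_P[OF False] by (rule Poly_const)
  qed
  then show "Poly n (\<lambda>a. ent (emat c d (F a)) p q)"
    unfolding ent_emat by (intro Poly_add Poly_const)
  fix a p q assume "\<bar>p - q\<bar> > \<bar>c - d\<bar>"
  then have "p \<noteq> q" "q - d \<noteq> p - c" by auto
  then show "ent (emat c d (F a)) p q = 0" by (simp only: ent_emat if_False simp_thms) simp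
qed

lemma poly_family_cell_param: "k + length is \<le> n \<Longrightarrow> poly_family n (cell_param k is)"
proof (induction "is" arbitrary: k)
  case Nil
  show ?case using poly_family_const[of n "mat 1"] by simp
next
  case (Cons i "is")
  have "poly_family n (\<lambda>a. root_elem_pos i (a k) ** simple_lift i ** cell_param (Suc k) is a)"
    unfolding root_elem_pos_emat using Cons
    by (intro poly_family_mult poly_family_const poly_family_emat Poly_var) simp_all
  then show ?case by simp
qed

lemma poly_family_cell_param_inv: "k + length is \<le> n \<Longrightarrow> poly_family n (cell_param_inv k is)"
proof (induction "is" arbitrary: k)
  case Nil
  show ?case using poly_family_const[of n "mat 1"] by simp
next
  case (Cons i "is")
  have "poly_family n (\<lambda>a. cell_param_inv (Suc k) is a **
     (weyl_mat (row i) (row i + 1) (- 1) ** root_elem_pos i (- a k)))"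
    unfolding root_elem_pos_emat using Cons
    by (intro poly_family_mult poly_family_const poly_family_emat Poly_minus Poly_var) simp_all
  then show ?case by simp
qed

text \<open>The factor \<open>u\<close> of \<open>h = u b\<close> is the unique solution of the linear equations which say that
  \<open>h\<^sup>-\<^sup>1 u\<close> is upper triangular.\<close>

lemma alg_dependent_cell:
  assumes h: "poly_family n h" and L: "poly_family n L"
    and inv: "\<And>a. h a ** L a = mat 1" "\<And>a. L a ** h a = mat 1" "\<And>a. h a \<in> KM_group"
  shows "\<exists>\<S>. finite \<S> \<and> (\<forall>S\<in>\<S>. alg_dependent (Suc n) S) \<and>
    {u \<in> opp_unipotent. \<exists>a. upper (L a ** u)} \<subseteq> \<Union>\<S>"
proof -
  obtain N0 where N0: "\<And>a p q. \<bar>p - q\<bar> > N0 \<Longrightarrow> ent (h a) p q = 0"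
    using h unfolding poly_family_def by blast
  obtain N1 where N1: "\<And>a p q. \<bar>p - q\<bar> > N1 \<Longrightarrow> ent (L a) p q = 0"
    using L unfolding poly_family_def by blast
  define N where "N = max N0 N1"
  have N: "ent (h a) p q = 0" "ent (L a) p q = 0" if "\<bar>p - q\<bar> > N" for a p q
    using that N0[of p q] N1[of p q] by (auto simp: N_def)
  have polyL: "Poly n (\<lambda>a. ent (L a) p q)" for p q using L unfolding poly_family_def by blast
  define A where "A = {a. \<exists>u. u \<in> opp_unipotent \<and> upper (L a ** u)}"
  define U where "U = (\<lambda>a. SOME u. u \<in> opp_unipotent \<and> upper (L a ** u))"
  have U: "U a \<in> opp_unipotent \<and> upper (L a ** U a)" if "a \<in> A" for a
    using that unfolding U_def A_def by (metis (mono_tags, lifting) mem_Collect_eq someI)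
  have hL: "u = h a ** (L a ** u)" for a u by (simp add: matrix_mul_assoc inv)
  have unique: "u' = u" if "u \<in> opp_unipotent" "upper (L a ** u)" "lower_uni u'" "upper (L a ** u')" for a u u'
  proof -
    have lu: "lower_uni u" using that(1) by (simp add: opp_unipotent_iff)
    have "L a ** u \<in> Borel"
      using lower_upper_factor(2)[OF inv(3) lu that(2) hL] .
    then obtain c where c: "(L a ** u) ** c = mat 1" "c \<in> Borel" by (rule Borel_inverse)
    have "u ** (c ** (L a ** u')) = h a ** ((L a ** u) ** c) ** (L a ** u')"
      by (subst hL[of u a]) (simp only: matrix_mul_assoc)
    also have "\<dots> = u'" unfolding c(1) by (simp flip: hL)
    finally have "u' = u ** (c ** (L a ** u'))" by simp
    moreover have "upper (c ** (L a ** u'))"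
      by (rule upper_mult) (use c(2) that(4) in \<open>simp_all add: Borel_iff\<close>)
    ultimately show ?thesis using lower_upper_unique[OF lu that(3)] by blast
  qed
  have band: "ent u p q = 0" if "upper (L a ** u)" "p > q + N" for a u p q
  proof -
    have "ent (h a) p r * ent (L a ** u) r q = 0" for r
      using that N(1)[of p r a] by (cases "q < r") (auto simp: upper_def)
    then have "ent (h a ** (L a ** u)) p q = 0" by (subst ent_mult[of "{}"]) auto
    then show ?thesis by (simp flip: hL)
  qed
  \<comment> \<open>By periodicity the columns 1, 2, 3 represent all. The unknown entries of
    \<open>u\<close> reach distance \<open>N\<close> below the diagonal, since \<open>h a\<close>
    has that bandwidth; in the product with \<open>L a\<close> they reach distance
    \<open>2 * N\<close>, which bounds the range of the equations.\<close>
  define K where "K = Sigma {1, 2, 3::int} (\<lambda>q. {q<..q + N})"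
  define I where "I = Sigma {1, 2, 3::int} (\<lambda>q. {q<..q + 2 * N})"
  define H where "H = (\<lambda>(q :: int, p) (q', p') a. if q' = q then ent (L a) p p' else 0)"
  define r where "r = (\<lambda>(q :: int, p) a. - ent (L a) p q)"
  define y where "y = (\<lambda>a (q, p). ent (U a) p q)"
  have sumK: "(\<Sum>k\<in>K. H (q, p) k a * v k) = (\<Sum>p'\<in>{q<..q + N}. ent (L a) p p' * v (q, p'))"
    if "q \<in> {1, 2, 3}" for q p a v
  proof -
    define f where "f = (\<lambda>q' p'. if q' = q then ent (L a) p p' * v (q, p') else 0)"
    have "(\<Sum>k\<in>K. H (q, p) k a * v k) = (\<Sum>k\<in>K. case k of (q', p') \<Rightarrow> f q' p')"
    proof (rule sum.cong)
      fix k assume "k \<in> K"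
      show "H (q, p) k a * v k = (case k of (q', p') \<Rightarrow> f q' p')"
        by (cases k) (simp add: H_def f_def)
    qed simp
    also have "\<dots> = (\<Sum>q'\<in>{1,2,3}. \<Sum>p'\<in>{q'<..q' + N}. f q' p')"
      unfolding K_def by (rule sum.Sigma[symmetric]) simp_all
    also have "\<dots> = (\<Sum>p'\<in>{q<..q + N}. f q p')"
      using that by (elim insertE emptyE) (simp_all add: f_def)
    finally show ?thesis by (simp add: f_def)
  qed
  have "\<exists>\<D>. finite \<D> \<and> (\<forall>x\<in>\<D>. Poly n (fst x) \<and> (\<forall>k. Poly n (snd x k))) \<and>
    (\<forall>a\<in>A. \<exists>x\<in>\<D>. fst x a \<noteq> 0 \<and> (\<forall>k\<in>K. fst x a * y a k = snd x k a))"
  proof (rule elimination[where H = H and r = r and I = I])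
    show "finite K" "finite I" by (auto simp: K_def I_def)
    show "Poly n (H i k)" for i k
    proof -
      obtain q p q' p' where ik: "i = (q, p)" "k = (q', p')" by (metis surj_pair)
      show ?thesis unfolding ik H_def by (cases "q' = q") (simp_all add: polyL Poly_const)
    qed
    show "Poly n (r i)" for i
    proof -
      obtain q p where i: "i = (q, p)" by (metis surj_pair)
      have "Poly n (\<lambda>a. - ent (L a) p q)" by (intro Poly_minus polyL)
      then show ?thesis unfolding i r_def by simp
    qed
    show "(\<Sum>k\<in>K. H i k a * y a k) = r i a" if a: "a \<in> A" and i: "i \<in> I" for a i
    proof -
      obtain q p where qp: "i = (q, p)" "q \<in> {1, 2, 3}" "q < p" using i by (auto simp: I_def)
      have lu: "lower_uni (U a)" using U[OF a] by (simp add: opp_unipotent_iff)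
      have b: "ent (U a) r q = 0" if "r \<notin> insert q {q<..q + N}" for r
        using that lu band[of a "U a" q r] U[OF a] by (auto simp: lower_uni_def)
      have "0 = ent (L a ** U a) p q" using U[OF a] qp by (simp add: upper_def)
      also have "\<dots> = (\<Sum>r\<in>insert q {q<..q + N}. ent (L a) p r * ent (U a) r q)"
        by (rule ent_mult) (simp_all add: b)
      also have "\<dots> = ent (L a) p q + (\<Sum>r\<in>{q<..q + N}. ent (L a) p r * ent (U a) r q)"
        using lu by (simp add: lower_uni_def)
      finally show ?thesis unfolding qp(1) sumK[OF qp(2)] by (simp add: r_def y_def eq_neg_iff_add_eq_0 add.commute)
    qed
    \<comment> \<open>A kernel vector, extended periodically to a strictly lower triangular
      \<open>V\<close>, could be added to the solution \<open>U a\<close>. Uniqueness of the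
      factorisation then forces \<open>V\<close> to vanish.\<close>
    show "\<forall>k\<in>K. v k = 0" if a: "a \<in> A" and v: "\<forall>i\<in>I. (\<Sum>k\<in>K. H i k a * v k) = 0" for a v
    proof -
      define sh where "sh = (\<lambda>q::int. 3 * ((q - 1) div 3))"
      have sh: "sh (q + 3 * k) = sh q + 3 * k" for q k unfolding sh_def by presburger
      have rq: "q - sh q \<in> {1, 2, 3}" for q unfolding sh_def insert_iff empty_iff by presburger
      have "\<exists>V. ent V = (\<lambda>p q. if q < p \<and> p \<le> q + N then v (q - sh q, p - sh q) else 0)"
      proof (rule ex_ent)
        fix p :: int
        have "{q. (if q < p \<and> p \<le> q + N then v (q - sh q, p - sh q) else 0) \<noteq> 0} \<subseteq> {p - N..p}"
          by auto
        then show "finite {q. (if q < p \<and> p \<le> q + N then v (q - sh q, p - sh q) else 0) \<noteq> 0}"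
          using finite_subset by blast
      qed (simp add: sh)
      then obtain V where V: "\<And>p q. ent V p q = (if q < p \<and> p \<le> q + N then v (q - sh q, p - sh q) else 0)"
        by (metis (full_types))
      have LV: "upper (L a ** V)"
        unfolding upper_def
      proof (intro allI impI)
        fix p q :: int assume qp: "q < p"
        have e: "ent (L a ** V) p q = (\<Sum>r\<in>{q<..q + N}. ent (L a) p r * ent V r q)"
          by (rule ent_mult) (auto simp: V)
        show "ent (L a ** V) p q = 0"
        proof (cases "p \<le> q + 2 * N")
          case True
          let ?q = "q - sh q" and ?p = "p - sh q"
          have "(?q, ?p) \<in> I" using qp True rq[of q] by (simp add: I_def)
          with v have "(\<Sum>k\<in>K. H (?q, ?p) k a * v k) = 0" by blast
          then have "0 = (\<Sum>r\<in>{?q<..?q + N}. ent (L a) ?p r * v (?q, r))"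
            unfolding sumK[OF rq] by simp
          also have "\<dots> = (\<Sum>r\<in>{q<..q + N}. ent (L a) p r * ent V r q)"
          proof (rule sum.reindex_bij_witness[of _ "\<lambda>r. r - sh q" "\<lambda>r. r + sh q"])
            fix r assume r: "r \<in> {?q<..?q + N}"
            have "ent (L a) p (r + sh q) = ent (L a) ?p r"
              using ent_period[of "L a" ?p "(q - 1) div 3" r] by (simp add: sh_def)
            then show "ent (L a) p (r + sh q) * ent V (r + sh q) q = ent (L a) ?p r * v (?q, r)"
              using r by (simp add: V)
          qed auto
          finally show ?thesis by (simp add: e)
        next
          case False
          have "ent (L a) p r = 0" if "r \<in> {q<..q + N}" for r using False that by (intro N(2)) auto
          then show ?thesis by (simp add: e)
        qed
      qed
      have lu: "lower_uni (U a)" using U[OF a] by (simp add: opp_unipotent_iff)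
      have "U a + V = U a"
      proof (rule unique)
        show "U a \<in> opp_unipotent" "upper (L a ** U a)" using U[OF a] by simp_all
        show "lower_uni (U a + V)" using lu by (simp add: lower_uni_def ent_add V)
        show "upper (L a ** (U a + V))"
          using LV U[OF a] by (simp add: upper_def matrix_add_ldistrib ent_add)
      qed
      then have V0: "ent V p q = 0" for p q by simp
      show ?thesis
      proof
        fix k assume k: "k \<in> K"
        obtain q p where qp: "k = (q, p)" "q \<in> {1, 2, 3}" "q < p" "p \<le> q + N"
          using k by (auto simp: K_def)
        have "sh q = 0" using qp(2) by (auto simp: sh_def)
        then show "v k = 0" using V0[of p q] qp by (simp add: V)
      qed
    qed
  qed
  then obtain \<D> where \<D>: "finite \<D>" "\<forall>x\<in>\<D>. Poly n (fst x) \<and> (\<forall>k. Poly n (snd x k))"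
    "\<forall>a\<in>A. \<exists>x\<in>\<D>. fst x a \<noteq> 0 \<and> (\<forall>k\<in>K. fst x a * y a k = snd x k a)"
    by (elim exE conjE)
  \<comment> \<open>Numerators for all entries of \<open>u\<close>: the diagonal entry 1 becomes the
    denominator itself, and entries outside the band become 0.\<close>
  define Q where "Q = (\<lambda>x p q. if p < q then (\<lambda>_. 0) else if p = q then fst (x :: ((nat \<Rightarrow> complex) \<Rightarrow> complex) \<times> (int \<times> int \<Rightarrow> (nat \<Rightarrow> complex) \<Rightarrow> complex))
    else if p \<le> q + N then snd x (row (of_int q), p - 3 * ((q - 1) div 3)) else (\<lambda>_. 0 :: complex))"
  have polyQ: "Poly n (Q x p q)" if "x \<in> \<D>" for x p q
    using \<D>(2) that unfolding Q_def by (simp add: Poly_const)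
  show ?thesis
  proof (rule exI[of _ "(\<lambda>x. rational_chart n (fst x) (Q x)) ` \<D>"], intro conjI)
    show "finite ((\<lambda>x. rational_chart n (fst x) (Q x)) ` \<D>)" using \<D>(1) by simp
    show "\<forall>S\<in>(\<lambda>x. rational_chart n (fst x) (Q x)) ` \<D>. alg_dependent (Suc n) S"
      using \<D>(2) polyQ by (auto intro: alg_dependent_rational)
    show "{u \<in> opp_unipotent. \<exists>a. upper (L a ** u)} \<subseteq> \<Union>((\<lambda>x. rational_chart n (fst x) (Q x)) ` \<D>)"
    proof
      fix u assume "u \<in> {u \<in> opp_unipotent. \<exists>a. upper (L a ** u)}"
      then obtain a where u: "u \<in> opp_unipotent" "upper (L a ** u)" by blast
      then have a: "a \<in> A" unfolding A_def by blast
      have lu: "lower_uni u" using u(1) by (simp add: opp_unipotent_iff)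
      have Uu: "U a = u" using unique[OF u, of "U a"] U[OF a] by (simp add: opp_unipotent_iff)
      have "\<exists>x\<in>\<D>. fst x a \<noteq> 0 \<and> (\<forall>k\<in>K. fst x a * y a k = snd x k a)" using \<D>(3) a by (rule bspec)
      then obtain x where x: "x \<in> \<D>" "fst x a \<noteq> 0 \<and> (\<forall>k\<in>K. fst x a * y a k = snd x k a)"
        by (elim bexE)
      have "fst x a * ent u p q = Q x p q a" for p q
      proof -
        consider "p < q" | "p = q" | "q < p" "p \<le> q + N" | "p > q + N" "p > q" by linarith
        then show ?thesis
        proof cases
          case 3
          let ?k = "(q - 1) div 3"
          have q: "q = row (of_int q) + 3 * ?k" by (simp add: row_of_int)
          have "(row (of_int q), p - 3 * ?k) \<in> K"
            unfolding K_def
          proof (rule SigmaI)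
            show "row (of_int q) \<in> {1, 2, 3}" by (rule row_cases)
            have "row (of_int q) = q - 3 * ?k" using q by linarith
            then show "p - 3 * ?k \<in> {row (of_int q)<..row (of_int q) + N}" using 3 by simp
          qed
          then have "fst x a * ent u (p - 3 * ?k) (row (of_int q)) = snd x (row (of_int q), p - 3 * ?k) a"
            using x(2) by (auto simp: y_def Uu)
          moreover have "ent u (p - 3 * ?k) (row (of_int q)) = ent u p q"
            using ent_period[of u "p - 3 * ?k" ?k "row (of_int q)"] q by simp
          ultimately show ?thesis using 3 by (simp add: Q_def)
        qed (use lu band[OF u(2), of q p] in \<open>auto simp: Q_def lower_uni_def\<close>)
      qed
      then have "u \<in> rational_chart n (fst x) (Q x)"
        unfolding rational_chart_def using x(2) by (intro CollectI exI[of _ a] conjI allI) simp_all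
      with x(1) show "u \<in> \<Union>((\<lambda>x. rational_chart n (fst x) (Q x)) ` \<D>)" by blast
    qed
  qed
qed

text \<open>\<open>Borel_word\<close> expresses each point of \<open>X\<close> by a cell
  parametrisation with at most \<open>n\<close> parameters. There are finitely many such words, so
  finitely many rational charts cover the part of \<open>X\<close> seen in the chart at
  \<open>g\<close>.\<close>

lemma local_dim_chart_le:
  assumes g: "g \<in> KM_group"
    and X: "\<And>P. P \<in> X \<Longrightarrow> \<exists>b\<in>Borel. \<exists>is. length is \<le> n \<and> P = flag (b ** word_lift is)"
  shows "local_dim (chart X g) p \<le> enat n"
proof -
  obtain g' where g': "g ** g' = mat 1" "g' ** g = mat 1" "g' \<in> KM_group" using KM_inverse[OF g] .
  define T where "T = (\<lambda>is. {u \<in> opp_unipotent. \<exists>a. upper (cell_param_inv 0 is a ** g ** u)})"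
  have inv': "cell_param_inv 0 is a ** cell_param 0 is a = mat 1" for "is" a
  proof -
    obtain m where m: "m ** cell_param 0 is a = mat 1" "cell_param 0 is a ** m = mat 1"
      using KM_inverse[OF cell_param_KM] by metis
    have "cell_param_inv 0 is a = m ** cell_param 0 is a ** cell_param_inv 0 is a" by (simp add: m)
    also have "\<dots> = m" by (simp add: cell_param_inverse flip: matrix_mul_assoc)
    finally show ?thesis by (simp add: m)
  qed
  have cell: "\<exists>\<S>. finite \<S> \<and> (\<forall>S\<in>\<S>. alg_dependent (Suc n) S) \<and> T is \<subseteq> \<Union>\<S>" if "length is \<le> n" for "is"
    unfolding T_def
  proof (rule alg_dependent_cell)
    show "poly_family n (\<lambda>a. g' ** cell_param 0 is a)"
      using that by (intro poly_family_mult poly_family_const poly_family_cell_param) simp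
    show "poly_family n (\<lambda>a. cell_param_inv 0 is a ** g)"
      using that by (intro poly_family_mult poly_family_const poly_family_cell_param_inv) simp
    show "g' ** cell_param 0 is a \<in> KM_group" for a by (intro KM_mult g' cell_param_KM)
    have "g' ** cell_param 0 is a ** (cell_param_inv 0 is a ** g) =
      g' ** (cell_param 0 is a ** cell_param_inv 0 is a) ** g" for a by (simp add: matrix_mul_assoc)
    then show "g' ** cell_param 0 is a ** (cell_param_inv 0 is a ** g) = mat 1" for a
      by (simp add: cell_param_inverse g')
    have "cell_param_inv 0 is a ** g ** (g' ** cell_param 0 is a) =
      cell_param_inv 0 is a ** (g ** g') ** cell_param 0 is a" for a by (simp add: matrix_mul_assoc)
    then show "cell_param_inv 0 is a ** g ** (g' ** cell_param 0 is a) = mat 1" for a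
      by (simp add: inv' g')
  qed
  have "\<forall>is. \<exists>\<S>. length is \<le> n \<longrightarrow> finite \<S> \<and> (\<forall>S\<in>\<S>. alg_dependent (Suc n) S) \<and> T is \<subseteq> \<Union>\<S>"
  proof
    fix "is"
    show "\<exists>\<S>. length is \<le> n \<longrightarrow> finite \<S> \<and> (\<forall>S\<in>\<S>. alg_dependent (Suc n) S) \<and> T is \<subseteq> \<Union>\<S>"
    proof (cases "length is \<le> n")
      case True
      show ?thesis using cell[OF True] by (elim exE) (rule exI, rule impI)
    qed simp
  qed
  from choice[OF this] obtain \<S> where \<S>: "\<forall>is. length is \<le> n \<longrightarrow>
    finite (\<S> is) \<and> (\<forall>S\<in>\<S> is. alg_dependent (Suc n) S) \<and> T is \<subseteq> \<Union>(\<S> is)" ..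
  have fin: "finite {is :: 3 list. length is \<le> n}"
    using finite_lists_length_le[of "UNIV :: 3 set" n] by simp
  show ?thesis
  proof (rule local_dim_le)
    show "finite (\<Union>is\<in>{is. length is \<le> n}. \<S> is)"
      by (rule finite_UN_I[OF fin]) (simp add: \<S>)
    show "alg_dependent (Suc n) S" if "S \<in> (\<Union>is\<in>{is. length is \<le> n}. \<S> is)" for S
    proof -
      from that obtain "is" where "length is \<le> n" "S \<in> \<S> is" by (elim UN_E CollectE)
      with \<S> show ?thesis by blast
    qed
    show "chart X g \<subseteq> \<Union>(\<Union>is\<in>{is. length is \<le> n}. \<S> is)"
    proof
      fix u assume u: "u \<in> chart X g"
      then obtain b "is" where b: "b \<in> Borel" "length is \<le> n" "flag (g ** u) = flag (b ** word_lift is)"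
        using X[of "flag (g ** u)"] unfolding chart_def by blast
      obtain c where c: "c \<in> Borel" "g ** u = b ** word_lift is ** c" using flag_eqD[OF b(3)] by blast
      obtain a b' where b': "b' \<in> Borel" "b ** word_lift is = cell_param 0 is a ** b'"
        using Borel_word[OF b(1)] by blast
      have "cell_param_inv 0 is a ** g ** u = cell_param_inv 0 is a ** (g ** u)"
        by (simp add: matrix_mul_assoc)
      also have "\<dots> = cell_param_inv 0 is a ** cell_param 0 is a ** (b' ** c)"
        by (simp add: c b' matrix_mul_assoc)
      also have "\<dots> = b' ** c" by (simp add: inv')
      finally have "upper (cell_param_inv 0 is a ** g ** u)"
        using Borel_mult[OF b'(1) c(1)] by (simp add: Borel_iff)
      then have "u \<in> T is" using u unfolding T_def chart_def by blast
      then have "u \<in> \<Union>(\<S> is)" using \<S>[rule_format, OF b(2)] by (elim conjE subsetD)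
      with b(2) show "u \<in> \<Union>(\<Union>is\<in>{is. length is \<le> n}. \<S> is)" by blast
    qed
  qed
qed

section \<open>Affine permutations and the Bruhat order\<close>

text \<open>The second condition is injectivity modulo 3; together with periodicity it makes
  \<open>z\<close> a bijection of the integers (\<open>affine_inj\<close>,
  \<open>affine_surj\<close>).\<close>

definition affine :: "(int \<Rightarrow> int) \<Rightarrow> bool" where
  "affine z \<longleftrightarrow> (\<forall>i. z (i + 3) = z i + 3) \<and> (\<forall>i j. 3 dvd z i - z j \<longrightarrow> 3 dvd i - j)"

text \<open>The Bruhat order on affine permutations. In rank two it suffices to compare, at each position, the
  running maxima and minima; in a window this is a box condition (\<open>below_window\<close>).\<close>

definition below :: "(int \<Rightarrow> int) \<Rightarrow> (int \<Rightarrow> int) \<Rightarrow> bool" where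
  "below x w \<longleftrightarrow> (\<forall>i. \<exists>j\<le>i. x i \<le> w j) \<and> (\<forall>i. \<exists>j\<ge>i. w j \<le> x i)"

text \<open>Shi's formula for the Coxeter length: each pair of window entries contributes the number
  of hyperplanes of one direction that separate the two alcoves.\<close>

definition inversions :: "(int \<Rightarrow> int) \<Rightarrow> int" where
  "inversions z = \<bar>(z 2 - z 1) div 3\<bar> + \<bar>(z 3 - z 1) div 3\<bar> + \<bar>(z 3 - z 2) div 3\<bar>"

lemma affine_shift:
  assumes "affine z" shows "z (i + 3 * k) = z i + 3 * k"
proof -
  have s: "z (i + 3) = z i + 3" for i using assms unfolding affine_def by blast
  have n: "z (i + 3 * int n) = z i + 3 * int n" for i n
  proof (induction n)
    case (Suc n)
    have e: "i + 3 * int (Suc n) = i + 3 * int n + 3" by simp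
    show ?case unfolding e s Suc.IH by simp
  qed simp
  show ?thesis
  proof (cases "k \<ge> 0")
    case True
    then show ?thesis using n[of i "nat k"] by simp
  next
    case False
    then show ?thesis using n[of "i + 3 * k" "nat (- k)"] by simp
  qed
qed

lemma affine_dvd:
  assumes "affine z" shows "3 dvd z i - z j \<longleftrightarrow> 3 dvd i - j"
proof
  assume "3 dvd i - j"
  then obtain k where "i - j = 3 * k" ..
  then have i: "i = j + 3 * k" by simp
  show "3 dvd z i - z j" unfolding i affine_shift[OF assms] by simp
next
  assume "3 dvd z i - z j"
  then show "3 dvd i - j" using assms unfolding affine_def by blast
qed

lemma affine_inj: "affine z \<Longrightarrow> z i = z j \<Longrightarrow> i = j"
proof -
  assume z: "affine z" "z i = z j"
  then have "3 dvd i - j" using affine_dvd[of z i j] by simp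
  then obtain k where "i - j = 3 * k" ..
  then have i: "i = j + 3 * k" by simp
  have "3 * k = 0" using z(2) unfolding i affine_shift[OF z(1)] by simp
  then show "i = j" unfolding i by simp
qed

lemma affine_residues:
  assumes "affine z"
  obtains a b c where "(z t, z (t + 1), z (t + 2)) \<in> {(3*a, 3*b+1, 3*c+2), (3*a, 3*b+2, 3*c+1),
    (3*a+1, 3*b, 3*c+2), (3*a+1, 3*b+2, 3*c), (3*a+2, 3*b, 3*c+1), (3*a+2, 3*b+1, 3*c)}"
proof -
  have d: "\<not> 3 dvd z t - z (t + 1)" "\<not> 3 dvd z t - z (t + 2)" "\<not> 3 dvd z (t + 1) - z (t + 2)"
    unfolding affine_dvd[OF assms] by simp_all
  obtain a r where a: "z t = 3 * a + r" "r = 0 \<or> r = 1 \<or> r = 2"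
    by (rule that[of "z t div 3" "z t mod 3"]) (simp, presburger)
  obtain b s where b: "z (t + 1) = 3 * b + s" "s = 0 \<or> s = 1 \<or> s = 2"
    by (rule that[of "z (t + 1) div 3" "z (t + 1) mod 3"]) (simp, presburger)
  obtain c u where c: "z (t + 2) = 3 * c + u" "u = 0 \<or> u = 1 \<or> u = 2"
    by (rule that[of "z (t + 2) div 3" "z (t + 2) mod 3"]) (simp, presburger)
  have e: "3 * x + y - (3 * x' + y') = 3 * (x - x') + (y - y')" for x x' y y' :: int by simp
  have ne: "\<not> 3 dvd r - s" "\<not> 3 dvd r - u" "\<not> 3 dvd s - u"
    using d unfolding a(1) b(1) c(1) e by (simp_all add: dvd_add_right_iff)
  show ?thesis
    by (rule that[of a b c], use a(2) b(2) c(2) ne in \<open>elim disjE\<close>) (simp_all add: a(1) b(1) c(1))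
qed

lemma affine_id: "affine id"
  by (simp add: affine_def)

lemma swap_shift: "swap c d (p + 3 * k) = swap c d p + 3 * k"
proof -
  have e: "p + 3 * k - x = (p - x) + 3 * k" for x by simp
  have "3 dvd p + 3 * k - x \<longleftrightarrow> 3 dvd p - x" for x
    unfolding e by (simp add: dvd_add_left_iff)
  then show ?thesis unfolding swap_def by simp
qed

lemma swap_shift_args: "swap (c + 3 * k) (d + 3 * k) = swap c d"
proof
  fix p
  have e: "p - (x + 3 * k) = (p - x) - 3 * k" for x by simp
  have "3 dvd p - (x + 3 * k) \<longleftrightarrow> 3 dvd p - x" for x
    unfolding e by (simp add: dvd_diff_left_iff)
  then show "swap (c + 3 * k) (d + 3 * k) p = swap c d p" unfolding swap_def by simp
qed

lemma affine_swap:
  assumes "\<not> 3 dvd c - d" shows "affine (swap c d)"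
proof -
  have "3 dvd i - j" if a: "3 dvd swap c d i - swap c d j" for i j
  proof -
    from a obtain k where "swap c d i - swap c d j = 3 * k" ..
    then have "swap c d i = swap c d j + 3 * k" by simp
    then have "swap c d (swap c d i) = swap c d (swap c d j) + 3 * k" by (simp add: swap_shift)
    then show ?thesis by (simp add: swap_swap[OF assms])
  qed
  then show ?thesis unfolding affine_def using swap_shift[of c d _ 1] by simp
qed

lemma affine_comp:
  assumes "affine z" "affine z'" shows "affine (z \<circ> z')"
  unfolding affine_def o_apply
proof (intro conjI allI impI)
  fix i show "z (z' (i + 3)) = z (z' i) + 3"
    using affine_shift[OF assms(2), of i 1] affine_shift[OF assms(1), of "z' i" 1] by simp
  fix j assume "3 dvd z (z' i) - z (z' j)"
  then show "3 dvd i - j" unfolding affine_dvd[OF assms(1)] affine_dvd[OF assms(2)] .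
qed

lemma below_refl: "below x x"
  unfolding below_def
proof (intro conjI allI)
  fix i
  show "\<exists>j\<le>i. x i \<le> x j" "\<exists>j\<ge>i. x j \<le> x i" by (rule exI[of _ i], simp)+
qed

lemma belowD:
  assumes "below x w"
  shows "(\<And>j. j \<le> i \<Longrightarrow> x i \<le> w j \<Longrightarrow> P) \<Longrightarrow> P" "(\<And>j. j \<ge> i \<Longrightarrow> w j \<le> x i \<Longrightarrow> P) \<Longrightarrow> P"
proof -
  have 1: "\<exists>j\<le>i. x i \<le> w j" using assms unfolding below_def by (elim conjE) (rule spec)
  have 2: "\<exists>j\<ge>i. w j \<le> x i" using assms unfolding below_def by (elim conjE) (rule spec)
  show "(\<And>j. j \<le> i \<Longrightarrow> x i \<le> w j \<Longrightarrow> P) \<Longrightarrow> P" using 1 by (elim exE conjE)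
  show "(\<And>j. j \<ge> i \<Longrightarrow> w j \<le> x i \<Longrightarrow> P) \<Longrightarrow> P" using 2 by (elim exE conjE)
qed

lemma below_trans:
  assumes "below x y" "below y w" shows "below x w"
  unfolding below_def
proof (intro conjI allI)
  fix i
  obtain j where j: "j \<le> i" "x i \<le> y j" using belowD(1)[OF assms(1), of i] .
  obtain k where k: "k \<le> j" "y j \<le> w k" using belowD(1)[OF assms(2), of j] .
  show "\<exists>j\<le>i. x i \<le> w j" by (rule exI[of _ k]) (use j k in simp)
next
  fix i
  obtain j where j: "j \<ge> i" "y j \<le> x i" using belowD(2)[OF assms(1), of i] .
  obtain k where k: "k \<ge> j" "w k \<le> y j" using belowD(2)[OF assms(2), of j] .
  show "\<exists>j\<ge>i. w j \<le> x i" by (rule exI[of _ k]) (use j k in simp)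
qed

text \<open>The swap moves the larger values to the left and the smaller ones to the right.
  Positions congruent to \<open>c\<close> witness the running maxima, those congruent to
  \<open>d\<close> the running minima.\<close>

lemma below_swap_up:
  assumes "affine z" "c < d" "\<not> 3 dvd c - d" "z c < z d"
  shows "below z (z \<circ> swap c d)"
proof -
  have "\<not> 3 dvd d - c" using assms(3) by presburger
  then have "swap c d c = d" "swap c d d = c" by (simp_all add: swap_def)
  then have s: "(z \<circ> swap c d) (c + 3 * k) = z d + 3 * k" "(z \<circ> swap c d) (d + 3 * k) = z c + 3 * k" for k
    by (simp_all only: o_apply swap_shift affine_shift[OF assms(1)])
  have sh: "z (c + 3 * k) = z c + 3 * k" "z (d + 3 * k) = z d + 3 * k" for k
    using affine_shift[OF assms(1)] by simp_all
  have cs: "(\<exists>k. i = c + 3 * k) \<or> (\<exists>k. i = d + 3 * k) \<or> (z \<circ> swap c d) i = z i" for i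
  proof -
    have "i = c + 3 * ((i - c) div 3)" if "3 dvd i - c" using that by simp
    moreover have "i = d + 3 * ((i - d) div 3)" if "3 dvd i - d" using that by simp
    moreover have "(z \<circ> swap c d) i = z i" if "\<not> 3 dvd i - c" "\<not> 3 dvd i - d"
      using that by (simp add: swap_def)
    ultimately show ?thesis by blast
  qed
  show ?thesis
    unfolding below_def
  proof (intro conjI allI)
    fix i
    consider k where "i = c + 3 * k" | k where "i = d + 3 * k" | "(z \<circ> swap c d) i = z i"
      using cs[of i] by (elim disjE exE)
    then show "\<exists>j\<le>i. z i \<le> (z \<circ> swap c d) j"
    proof cases
      case (1 k)
      show ?thesis unfolding 1 by (rule exI[of _ "c + 3 * k"]) (simp only: s sh, use assms(4) in simp)
    next
      case (2 k)
      show ?thesis unfolding 2 by (rule exI[of _ "c + 3 * k"]) (simp only: s sh, use assms(2) in simp)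
    next
      case 3
      show ?thesis by (rule exI[of _ i]) (simp only: 3 order_refl simp_thms)
    qed
    consider k where "i = c + 3 * k" | k where "i = d + 3 * k" | "(z \<circ> swap c d) i = z i"
      using cs[of i] by (elim disjE exE)
    then show "\<exists>j\<ge>i. (z \<circ> swap c d) j \<le> z i"
    proof cases
      case (1 k)
      show ?thesis unfolding 1 by (rule exI[of _ "d + 3 * k"]) (simp only: s sh, use assms(2) in simp)
    next
      case (2 k)
      show ?thesis unfolding 2 by (rule exI[of _ "d + 3 * k"]) (simp only: s sh, use assms(4) in simp)
    next
      case 3
      show ?thesis by (rule exI[of _ i]) (simp only: 3 order_refl simp_thms)
    qed
  qed
qed

text \<open>Going back by a period lowers \<open>w\<close> by 3, so a running maximum is attained
  among the last three positions and a running minimum among the next three. Both conditions are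
  periodic, hence one window suffices; positions outside it account for the shifts by 3.\<close>

lemma below_window:
  assumes x: "affine x" and w: "affine w"
  shows "below x w \<longleftrightarrow>
    x t \<le> max (w t) (max (w (t+1) - 3) (w (t+2) - 3)) \<and>
    x (t+1) \<le> max (w t) (max (w (t+1)) (w (t+2) - 3)) \<and>
    x (t+2) \<le> max (w t) (max (w (t+1)) (w (t+2))) \<and>
    x t \<ge> min (w t) (min (w (t+1)) (w (t+2))) \<and>
    x (t+1) \<ge> min (w t + 3) (min (w (t+1)) (w (t+2))) \<and>
    x (t+2) \<ge> min (w t + 3) (min (w (t+1) + 3) (w (t+2)))" (is "_ \<longleftrightarrow> ?R")
proof -
  have cs: "\<exists>k. j = t + 3 * k \<or> j = t + 1 + 3 * k \<or> j = t + 2 + 3 * k" for j by presburger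
  have shx: "x (i + 3 * k) = x i + 3 * k" "w (i + 3 * k) = w i + 3 * k" for i k
    using affine_shift x w by auto
  have up: "(\<exists>j\<le>i. v \<le> w j) \<longleftrightarrow> v \<le> w i \<or> v \<le> w (i - 1) \<or> v \<le> w (i - 2)" for i v
  proof
    assume "\<exists>j\<le>i. v \<le> w j"
    then obtain j where j: "j \<le> i" "v \<le> w j" by blast
    obtain k where k: "i - j = 3 * k \<or> i - j = 3 * k + 1 \<or> i - j = 3 * k + 2" "k \<ge> 0"
      using j(1) by (intro that[of "(i - j) div 3"]) presburger+
    then consider "i = j + 3 * k" | "i - 1 = j + 3 * k" | "i - 2 = j + 3 * k" by linarith
    then show "v \<le> w i \<or> v \<le> w (i - 1) \<or> v \<le> w (i - 2)"
      using j(2) k(2) shx(2)[of j k] by cases auto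
  next
    assume "v \<le> w i \<or> v \<le> w (i - 1) \<or> v \<le> w (i - 2)"
    then show "\<exists>j\<le>i. v \<le> w j" by (elim disjE) (intro exI, erule conjI[rotated], simp)+
  qed
  have dn: "(\<exists>j\<ge>i. w j \<le> v) \<longleftrightarrow> w i \<le> v \<or> w (i + 1) \<le> v \<or> w (i + 2) \<le> v" for i v
  proof
    assume "\<exists>j\<ge>i. w j \<le> v"
    then obtain j where j: "j \<ge> i" "w j \<le> v" by blast
    obtain k where k: "j - i = 3 * k \<or> j - i = 3 * k + 1 \<or> j - i = 3 * k + 2" "k \<ge> 0"
      using j(1) by (intro that[of "(j - i) div 3"]) presburger+
    then consider "j = i + 3 * k" | "j = i + 1 + 3 * k" | "j = i + 2 + 3 * k" by linarith
    then show "w i \<le> v \<or> w (i + 1) \<le> v \<or> w (i + 2) \<le> v"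
      using j(2) k(2) shx(2)[of i k] shx(2)[of "i + 1" k] shx(2)[of "i + 2" k] by cases auto
  next
    assume "w i \<le> v \<or> w (i + 1) \<le> v \<or> w (i + 2) \<le> v"
    then show "\<exists>j\<ge>i. w j \<le> v" by (elim disjE) (intro exI, erule conjI[rotated], simp)+
  qed
  have per: "P i" if "\<And>i k. P (i + 3 * k) = P i" "P t" "P (t + 1)" "P (t + 2)" for P :: "int \<Rightarrow> bool" and i
    using cs[of i] that(1)[of t] that(1)[of "t + 1"] that(1)[of "t + 2"] that(2-4) by auto
  have idx: "t + 1 - 1 = t" "t + 1 - 2 = t + 2 + 3 * - 1" "t + 2 - 1 = t + 1" "t + 2 - 2 = t"
    "t + 1 + 1 = t + 2" "t + 1 + 2 = t + 3 * 1" "t + 2 + 1 = t + 3 * 1" "t + 2 + 2 = t + 1 + 3 * 1"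
    "t - 1 = t + 2 + 3 * - 1" "t - 2 = t + 1 + 3 * - 1" by simp_all
  define U where "U = (\<lambda>i. x i \<le> w i \<or> x i \<le> w (i - 1) \<or> x i \<le> w (i - 2))"
  define D where "D = (\<lambda>i. w i \<le> x i \<or> w (i + 1) \<le> x i \<or> w (i + 2) \<le> x i)"
  have pU: "U (i + 3 * k) = U i" for i k
  proof -
    have e: "i + 3 * k - 1 = i - 1 + 3 * k" "i + 3 * k - 2 = i - 2 + 3 * k" by simp_all
    show ?thesis unfolding U_def e shx by simp
  qed
  have pD: "D (i + 3 * k) = D i" for i k
  proof -
    have e: "i + 3 * k + 1 = i + 1 + 3 * k" "i + 3 * k + 2 = i + 2 + 3 * k" by simp_all
    show ?thesis unfolding D_def e shx by simp
  qed
  have "(\<forall>i. U i) \<longleftrightarrow> U t \<and> U (t + 1) \<and> U (t + 2)" using per[of U, OF pU] by blast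
  moreover have "(\<forall>i. D i) \<longleftrightarrow> D t \<and> D (t + 1) \<and> D (t + 2)" using per[of D, OF pD] by blast
  moreover have "below x w \<longleftrightarrow> (\<forall>i. U i) \<and> (\<forall>i. D i)"
    unfolding below_def up dn U_def D_def ..
  moreover have "U t \<longleftrightarrow> x t \<le> max (w t) (max (w (t+1) - 3) (w (t+2) - 3))"
    "U (t + 1) \<longleftrightarrow> x (t+1) \<le> max (w t) (max (w (t+1)) (w (t+2) - 3))"
    "U (t + 2) \<longleftrightarrow> x (t+2) \<le> max (w t) (max (w (t+1)) (w (t+2)))"
    unfolding U_def idx shx le_max_iff_disj by (simp_all add: disj_ac)
  moreover have "D t \<longleftrightarrow> x t \<ge> min (w t) (min (w (t+1)) (w (t+2)))"
    "D (t + 1) \<longleftrightarrow> x (t+1) \<ge> min (w t + 3) (min (w (t+1)) (w (t+2)))"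
    "D (t + 2) \<longleftrightarrow> x (t+2) \<ge> min (w t + 3) (min (w (t+1) + 3) (w (t+2)))"
    unfolding D_def idx shx min_le_iff_disj by (simp_all add: disj_ac)
  ultimately show ?thesis by (simp only: conj_assoc)
qed

lemma affine_shift3:
  assumes "affine z"
  shows "z (i + 3) = z i + 3" "z (i - 3) = z i - 3"
  using affine_shift[OF assms, of i 1] affine_shift[OF assms, of i "-1"] by simp_all

lemma affine_neq: "affine z \<Longrightarrow> i \<noteq> j \<Longrightarrow> z i \<noteq> z j"
  using affine_inj by blast

text \<open>The values are those at \<open>p - 1\<close>, \<open>p\<close>, \<open>p + 1\<close>.
  After removal of a possible descent of \<open>x\<close> at \<open>p\<close> its entries there are
  \<open>min X1 X2\<close> and \<open>max X1 X2\<close>, while \<open>W1\<close> and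
  \<open>W2\<close> are exchanged.\<close>

lemma lift_arith:
  fixes X0 X1 X2 W0 W1 W2 :: int
  assumes "X1 \<noteq> X2" "W0 \<noteq> W1 - 3" "W0 \<noteq> W2" "W1 \<noteq> W2 + 3"
    "X0 + X1 + X2 = W0 + W1 + W2" "W2 < W1"
    "X0 \<le> max W0 (max (W1 - 3) (W2 - 3))" "X1 \<le> max W0 (max W1 (W2 - 3))"
    "X2 \<le> max W0 (max W1 W2)" "X0 \<ge> min W0 (min W1 W2)" "X1 \<ge> min (W0 + 3) (min W1 W2)"
    "X2 \<ge> min (W0 + 3) (min (W1 + 3) W2)"
  shows "min X1 X2 \<le> max W0 (max W2 (W1 - 3))" "max X1 X2 \<ge> min (W0 + 3) (min (W2 + 3) W1)"
    "X0 \<le> max W0 (max (W2 - 3) (W1 - 3))" "max X1 X2 \<le> max W0 (max W2 W1)"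
    "X0 \<ge> min W0 (min W2 W1)" "min X1 X2 \<ge> min (W0 + 3) (min W2 W1)"
  using assms by (smt (verit))+

text \<open>The lifting property of the Bruhat order, for multiplication by the simple transposition of \<open>p\<close> and \<open>p + 1\<close>.\<close>

lemma below_lift:
  assumes x: "affine x" and w: "affine w"
    and sum: "x (p - 1) + x p + x (p + 1) = w (p - 1) + w p + w (p + 1)"
    and b: "below x w" and d: "w p > w (p + 1)"
  shows "below (if x p > x (p + 1) then x \<circ> swap p (p + 1) else x) (w \<circ> swap p (p + 1))"
proof -
  let ?s = "swap p (p + 1)"
  have nd: "\<not> 3 dvd p - (p + 1)" by simp
  note as = affine_swap[OF nd]
  have idx: "p - 1 + 1 = p" "p - 1 + 2 = p + 1" by simp_all
  have s: "?s (p - 1) = p - 1" "?s p = p + 1" "?s (p + 1) = p" by (simp_all add: swap_def)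
  have bw: "x (p-1) \<le> max (w (p-1)) (max (w p - 3) (w (p+1) - 3)) \<and>
    x p \<le> max (w (p-1)) (max (w p) (w (p+1) - 3)) \<and>
    x (p+1) \<le> max (w (p-1)) (max (w p) (w (p+1))) \<and>
    x (p-1) \<ge> min (w (p-1)) (min (w p) (w (p+1))) \<and>
    x p \<ge> min (w (p-1) + 3) (min (w p) (w (p+1))) \<and>
    x (p+1) \<ge> min (w (p-1) + 3) (min (w p + 3) (w (p+1)))"
    using b unfolding below_window[OF x w, of "p - 1"] idx .
  have ne: "x p \<noteq> x (p + 1)" "w (p - 1) \<noteq> w p - 3" "w (p - 1) \<noteq> w (p + 1)" "w p \<noteq> w (p + 1) + 3"
    using affine_neq[OF x, of p "p + 1"] affine_neq[OF w, of "p - 1" "p - 3"] affine_neq[OF w, of "p - 1" "p + 1"]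
      affine_neq[OF w, of p "p + 1 + 3"] by (simp_all only: affine_shift3[OF w]) simp_all
  note l = lift_arith[OF ne sum d]
  have l': "min (x p) (x (p+1)) \<le> max (w (p-1)) (max (w (p+1)) (w p - 3))"
    "max (x p) (x (p+1)) \<ge> min (w (p-1) + 3) (min (w (p+1) + 3) (w p))"
    "x (p-1) \<le> max (w (p-1)) (max (w (p+1) - 3) (w p - 3))"
    "max (x p) (x (p+1)) \<le> max (w (p-1)) (max (w (p+1)) (w p))"
    "x (p-1) \<ge> min (w (p-1)) (min (w (p+1)) (w p))"
    "min (x p) (x (p+1)) \<ge> min (w (p-1) + 3) (min (w (p+1)) (w p))"
    using bw by (intro l; simp)+
  show ?thesis
  proof (cases "x p > x (p + 1)")
    case True
    have "below (x \<circ> ?s) (w \<circ> ?s)"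
      unfolding below_window[OF affine_comp[OF x as] affine_comp[OF w as], of "p - 1"] o_apply idx s
      using l' True by (simp add: min_def max_def)
    with True show ?thesis by simp
  next
    case False
    have "below x (w \<circ> ?s)"
      unfolding below_window[OF x affine_comp[OF w as], of "p - 1"] o_apply idx s
      using l' False by (simp add: min_def max_def)
    with False show ?thesis by simp
  qed
qed

section \<open>The length: independence of the window and growth under reflections\<close>

definition window_inv :: "int \<Rightarrow> int \<Rightarrow> int \<Rightarrow> int" where
  "window_inv a b c = \<bar>(b - a) div 3\<bar> + \<bar>(c - a) div 3\<bar> + \<bar>(c - b) div 3\<bar>"

lemma div3_flip: "\<not> 3 dvd x - y \<Longrightarrow> (y - x) div 3 = - ((x - y) div (3::int)) - 1"
  by presburger

lemma abs_div3_flip: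
  assumes "\<not> 3 dvd x - y" shows "\<bar>(x + 3 - y) div 3\<bar> = \<bar>(y - x) div (3::int)\<bar>"
proof -
  have "(x + 3 - y) div 3 = (x - y) div 3 + 1" by presburger
  then show ?thesis unfolding div3_flip[OF assms] by simp
qed

text \<open>If 3 does not divide a number, negating it before division by 3 gives one less than the
  negative of the quotient. The shift of the moved entry by 3 compensates exactly this.\<close>

lemma window_inv_rotate:
  assumes "\<not> 3 dvd a - b" "\<not> 3 dvd a - c"
  shows "window_inv b c (a + 3) = window_inv a b c"
  unfolding window_inv_def abs_div3_flip[OF assms(1)] abs_div3_flip[OF assms(2)] by simp

lemma window_inv_shift: "window_inv (a + k) (b + k) (c + k) = window_inv a b c"
  unfolding window_inv_def by simp

lemma inversions_window:
  assumes "affine z"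
  shows "inversions z = window_inv (z t) (z (t + 1)) (z (t + 2))"
proof -
  have nd: "\<not> 3 dvd z i - z j" if "\<not> 3 dvd i - j" for i j
    using that affine_dvd[OF assms] by simp
  have 1: "inversions z = window_inv (z 1) (z 2) (z 3)"
    unfolding inversions_def window_inv_def ..
  have "(4::int) = 1 + 3" "(5::int) = 2 + 3" by simp_all
  then have e: "z 4 = z 1 + 3" "z 5 = z 2 + 3" using affine_shift3(1)[OF assms] by metis+
  have 2: "window_inv (z 2) (z 3) (z 4) = inversions z"
    unfolding 1 e by (rule window_inv_rotate) (intro nd, simp)+
  have 3: "window_inv (z 3) (z 4) (z 5) = inversions z"
    unfolding 2[symmetric] e(2) by (rule window_inv_rotate) (intro nd, simp)+
  have "\<exists>k. t = 1 + 3 * k \<or> t = 2 + 3 * k \<or> t = 3 + 3 * k" by presburger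
  then obtain k where k: "t = 1 + 3 * k \<or> t = 2 + 3 * k \<or> t = 3 + 3 * k" ..
  have sh: "window_inv (z (i + 3 * k)) (z (i + 3 * k + 1)) (z (i + 3 * k + 2)) =
      window_inv (z i) (z (i + 1)) (z (i + 2))" for i
  proof -
    have "i + 3 * k + 1 = i + 1 + 3 * k" "i + 3 * k + 2 = i + 2 + 3 * k" by simp_all
    then show ?thesis by (simp only: affine_shift[OF assms] window_inv_shift)
  qed
  from k show ?thesis
  proof (elim disjE)
    assume t: "t = 1 + 3 * k"
    show ?thesis unfolding t sh using 1 by simp
  next
    assume t: "t = 2 + 3 * k"
    show ?thesis unfolding t sh using 2 by simp
  next
    assume t: "t = 3 + 3 * k"
    show ?thesis unfolding t sh using 3 by simp
  qed
qed

lemma window_inv_swap: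
  assumes "b < a" "\<not> 3 dvd a - b"
  shows "window_inv b a c = window_inv a b c - 1"
proof -
  have "(a - b) div 3 \<ge> 0" using assms(1) by simp
  then have "\<bar>(a - b) div 3\<bar> = \<bar>(b - a) div 3\<bar> - 1" unfolding div3_flip[OF assms(2)] by linarith
  then show ?thesis unfolding window_inv_def by simp
qed

text \<open>In the window starting at \<open>p\<close>, the pair at \<open>p\<close> and
  \<open>p + 1\<close> loses one, and the other two contributions are exchanged.\<close>

lemma inversions_swap_simple:
  assumes "affine z" "z (p + 1) < z p"
  shows "inversions (z \<circ> swap p (p + 1)) = inversions z - 1"
proof -
  have nd: "\<not> 3 dvd p - (p + 1)" by simp
  have s: "swap p (p + 1) p = p + 1" "swap p (p + 1) (p + 1) = p" "swap p (p + 1) (p + 2) = p + 2"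
    by (simp_all add: swap_def)
  have "\<not> 3 dvd z p - z (p + 1)" unfolding affine_dvd[OF assms(1)] by simp
  from window_inv_swap[OF assms(2) this] show ?thesis
    unfolding inversions_window[OF assms(1), of p]
      inversions_window[OF affine_comp[OF assms(1) affine_swap[OF nd]], of p] o_apply s .
qed

abbreviation residues6 :: "(int \<times> int \<times> int) set" where
  "residues6 \<equiv> {(0, 1, 2), (0, 2, 1), (1, 0, 2), (1, 2, 0), (2, 0, 1), (2, 1, 0)}"

lemma div3_diff: "(3 * x + k - (3 * y + l)) div 3 = x - y + (k - l) div (3::int)"
proof -
  have "3 * x + k - (3 * y + l) = (k - l) + 3 * (x - y)" by simp
  then show ?thesis by simp
qed

lemma window_inv_3:
  "window_inv (3 * a + r) (3 * b + s) (3 * c + u) =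
    \<bar>b - a + (s - r) div 3\<bar> + \<bar>c - a + (u - r) div 3\<bar> + \<bar>c - b + (u - s) div 3\<bar>"
  unfolding window_inv_def div3_diff ..

lemma affine_window:
  assumes "affine z"
  obtains a b c r s u where "z t = 3 * a + r" "z (t + 1) = 3 * b + s" "z (t + 2) = 3 * c + u"
    "(r, s, u) \<in> residues6"
proof -
  obtain a b c where abc: "(z t, z (t + 1), z (t + 2)) \<in> {(3*a, 3*b+1, 3*c+2), (3*a, 3*b+2, 3*c+1),
    (3*a+1, 3*b, 3*c+2), (3*a+1, 3*b+2, 3*c), (3*a+2, 3*b, 3*c+1), (3*a+2, 3*b+1, 3*c)}"
    using affine_residues[OF assms] .
  then have "(z t - 3 * a, z (t + 1) - 3 * b, z (t + 2) - 3 * c)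
    \<in> residues6"
    by (elim insertE emptyE; simp only: prod.inject; simp)
  then show ?thesis
    by (intro that[of a "z t - 3 * a" b "z (t + 1) - 3 * b" c "z (t + 2) - 3 * c"]) simp_all
qed

lemma div3_nums: "(1 - 0) div 3 = (0::int)" "(2 - 0) div 3 = (0::int)" "(2 - 1) div 3 = (0::int)"
  "(0 - 1) div 3 = (-1::int)" "(0 - 2) div 3 = (-1::int)" "(1 - 2) div 3 = (-1::int)"
  "(0 - 0) div 3 = (0::int)" "(1 - 1) div 3 = (0::int)" "(2 - 2) div 3 = (0::int)"
  by simp_all

lemma up_arith:
  fixes a b c m r s u :: int
  assumes "(r, s, u) \<in> residues6" "m \<ge> 0"
  shows "3 * a + r < 3 * b + s + 3 * m \<Longrightarrow> window_inv (3 * a + r) (3 * b + s) (3 * c + u)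
      < window_inv (3 * (b + m) + s) (3 * (a - m) + r) (3 * c + u)"
    "3 * a + r < 3 * c + u + 3 * m \<Longrightarrow> window_inv (3 * a + r) (3 * b + s) (3 * c + u)
      < window_inv (3 * (c + m) + u) (3 * b + s) (3 * (a - m) + r)"
  using assms unfolding window_inv_3
  by (elim insertE emptyE; simp only: prod.inject; elim conjE; hypsubst; unfold div3_nums; linarith)+

text \<open>In the window starting at \<open>c\<close>, the position \<open>d\<close> is one of the
  two others shifted by \<open>3 * m\<close> with \<open>m \<ge> 0\<close>. The comparison is then
  linear in the quotients for each of the six residue patterns.\<close>

lemma inversions_swap_up:
  assumes z: "affine z" and cd: "c < d" "\<not> 3 dvd c - d" and up: "z c < z d"
  shows "inversions z < inversions (z \<circ> swap c d)"
proof -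
  obtain a b e r s u where w: "z c = 3 * a + r" "z (c + 1) = 3 * b + s" "z (c + 2) = 3 * e + u"
    and rsu: "(r, s, u) \<in> residues6"
    using affine_window[OF z] .
  note iz = inversions_window[OF z, of c]
  note izs = inversions_window[OF affine_comp[OF z affine_swap[OF cd(2)]], of c]
  have "\<exists>m\<ge>0. d = c + 1 + 3 * m \<or> d = c + 2 + 3 * m" using cd by presburger
  then obtain m where m: "m \<ge> 0" "d = c + 1 + 3 * m \<or> d = c + 2 + 3 * m" by blast
  from m(2) show ?thesis
  proof
    assume d: "d = c + 1 + 3 * m"
    have n: "\<not> 3 dvd c + 1 - c" "3 dvd c + 1 - (c + 1 + 3 * m)" "\<not> 3 dvd c + 2 - c"
      "\<not> 3 dvd c + 2 - (c + 1 + 3 * m)" by presburger+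
    have e: "swap c d c = c + 1 + 3 * m" "swap c d (c + 1) = c + 3 * (- m)" "swap c d (c + 2) = c + 2"
      unfolding swap_def d using n by simp_all
    have "z d = 3 * b + s + 3 * m" unfolding d affine_shift[OF z] w ..
    with up have "3 * a + r < 3 * b + s + 3 * m" by (simp add: w)
    from up_arith(1)[OF rsu m(1) this, of e] show ?thesis
      unfolding iz izs o_apply e affine_shift[OF z] w by (simp add: algebra_simps)
  next
    assume d: "d = c + 2 + 3 * m"
    have n: "\<not> 3 dvd c + 2 - c" "3 dvd c + 2 - (c + 2 + 3 * m)" "\<not> 3 dvd c + 1 - c"
      "\<not> 3 dvd c + 1 - (c + 2 + 3 * m)" by presburger+
    have e: "swap c d c = c + 2 + 3 * m" "swap c d (c + 1) = c + 1" "swap c d (c + 2) = c + 3 * (- m)"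
      unfolding swap_def d using n by simp_all
    have "z d = 3 * e + u + 3 * m" unfolding d affine_shift[OF z] w ..
    with up have "3 * a + r < 3 * e + u + 3 * m" by (simp add: w)
    from up_arith(2)[OF rsu m(1) this, of b] show ?thesis
      unfolding iz izs o_apply e affine_shift[OF z] w by (simp add: algebra_simps)
  qed
qed

lemma inversions_nonneg: "inversions z \<ge> 0"
  by (simp add: inversions_def)

text \<open>The three increments over one period are positive and add up to 3, so each is 1; the sum
  of the window fixes the remaining constant.\<close>

lemma no_descent_id:
  assumes z: "affine z" and sum: "z 1 + z 2 + z 3 = 6" and nd: "\<And>p. \<not> z (p + 1) < z p"
  shows "z = id"
proof
  fix p :: int
  have "z 1 \<noteq> z 2" "z 2 \<noteq> z 3" "z 3 \<noteq> z (1 + 3)"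
    by (intro affine_neq[OF z], simp)+
  moreover have "z (1 + 1) \<ge> z 1" "z (2 + 1) \<ge> z 2" "z (3 + 1) \<ge> z 3" using nd not_less by blast+
  moreover have "z (1 + 3) = z 1 + 3" by (rule affine_shift3[OF z])
  ultimately have v: "z 1 = 1" "z 2 = 2" "z 3 = 3" using sum by simp_all
  have "\<exists>k. p = 1 + 3 * k \<or> p = 2 + 3 * k \<or> p = 3 + 3 * k" by presburger
  then obtain k where "p = 1 + 3 * k \<or> p = 2 + 3 * k \<or> p = 3 + 3 * k" ..
  then show "z p = id p"
    by (elim disjE; hypsubst) (simp_all only: affine_shift[OF z] v id_apply)
qed

lemma below_id:
  assumes "below x id" shows "x = id"
proof
  fix i
  obtain j where "j \<le> i" "x i \<le> id j" using belowD(1)[OF assms] .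
  moreover obtain k where "i \<le> k" "id k \<le> x i" using belowD(2)[OF assms] .
  ultimately show "x i = id i" by simp
qed

lemma swap_commute: "\<not> 3 dvd c - d \<Longrightarrow> swap c d = swap d c"
proof
  fix p :: int assume "\<not> 3 dvd c - d"
  then have "\<not> (3 dvd p - c \<and> 3 dvd p - d)" using dvd_diff[of 3 "p - d" "p - c"] by auto
  then show "swap c d p = swap d c p" unfolding swap_def by auto
qed

section \<open>The affine Weyl group as a group of affine permutations\<close>

context A2_plane
begin

text \<open>The coordinates of \<open>v\<close> with respect to the weights of the vector representation of \<open>SL\<^sub>3\<close>, extended
  to all integers by \<open>coord v (p + 3) = coord v p - 1\<close>. Reflections, and hence all of \<open>W\<close>, permute them.\<close>

definition coord :: "'v \<Rightarrow> int \<Rightarrow> real" where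
  "coord v p = (if (p - 1) mod 3 = 0 then (2 * (\<alpha>\<^sub>1 \<bullet> v) + \<alpha>\<^sub>2 \<bullet> v) / 3
     else if (p - 1) mod 3 = 1 then (\<alpha>\<^sub>2 \<bullet> v - \<alpha>\<^sub>1 \<bullet> v) / 3
     else - (\<alpha>\<^sub>1 \<bullet> v + 2 * (\<alpha>\<^sub>2 \<bullet> v)) / 3) - of_int ((p - 1) div 3)"

lemma coord_shift: "coord v (p + 3 * k) = coord v p - of_int k"
proof -
  have m: "(p + 3 * k - 1) mod 3 = (p - 1) mod 3" by presburger
  have d: "(p + 3 * k - 1) div 3 = (p - 1) div 3 + k" by presburger
  show ?thesis unfolding coord_def m d of_int_add by (simp only: diff_diff_eq)
qed

lemma coord_123:
  "coord v 1 = (2 * (\<alpha>\<^sub>1 \<bullet> v) + \<alpha>\<^sub>2 \<bullet> v) / 3" "coord v 2 = (\<alpha>\<^sub>2 \<bullet> v - \<alpha>\<^sub>1 \<bullet> v) / 3"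
  "coord v 3 = - (\<alpha>\<^sub>1 \<bullet> v + 2 * (\<alpha>\<^sub>2 \<bullet> v)) / 3"
  by (simp_all add: coord_def)

lemma coord_roots:
  "\<alpha>\<^sub>1 \<bullet> v = coord v 1 - coord v 2" "\<alpha>\<^sub>2 \<bullet> v = coord v 2 - coord v 3"
  "highest_root \<bullet> v = coord v 1 - coord v 3" "coord v 1 + coord v 2 + coord v 3 = 0"
  unfolding coord_123 highest_root_def by (simp_all add: inner_add_left field_simps)

text \<open>The vector \<open>\<beta>\<close> is orthogonal to \<open>\<alpha>\<^sub>1\<close>. A
  nonzero \<open>u\<close> would complete three pairwise orthogonal nonzero vectors in a
  plane.\<close>

lemma eq_zero_if_orthogonal:
  assumes "\<alpha>\<^sub>1 \<bullet> u = 0" "\<alpha>\<^sub>2 \<bullet> u = 0" shows "u = 0"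
proof (rule ccontr)
  assume u: "u \<noteq> 0"
  define \<beta> where "\<beta> = \<alpha>\<^sub>1 + 2 *\<^sub>R \<alpha>\<^sub>2"
  have o: "\<alpha>\<^sub>1 \<bullet> \<beta> = 0" "\<beta> \<bullet> u = 0"
    using assms norm_\<alpha>\<^sub>1 inner_\<alpha>\<^sub>1_\<alpha>\<^sub>2 by (simp_all add: \<beta>_def inner_add_left inner_add_right)
  have nz: "\<alpha>\<^sub>1 \<noteq> 0" using norm_\<alpha>\<^sub>1 by auto
  have "\<beta> \<bullet> \<alpha>\<^sub>2 = 3" using norm_\<alpha>\<^sub>2 inner_\<alpha>\<^sub>1_\<alpha>\<^sub>2 by (simp add: \<beta>_def inner_add_left)
  then have bz: "\<beta> \<noteq> 0" by auto
  have ne: "\<alpha>\<^sub>1 \<noteq> \<beta>" "\<alpha>\<^sub>1 \<noteq> u" "\<beta> \<noteq> u"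
    using o assms nz bz u by auto
  have "pairwise orthogonal {\<alpha>\<^sub>1, \<beta>, u}"
    using o assms by (auto simp: pairwise_def orthogonal_def inner_commute)
  then have "independent {\<alpha>\<^sub>1, \<beta>, u}"
    using nz bz u by (intro pairwise_orthogonal_independent) auto
  then have "card {\<alpha>\<^sub>1, \<beta>, u} \<le> DIM('v)" by (rule independent_bound[THEN conjunct2])
  then show False using ne dim_plane by simp
qed

lemma coord_inject:
  assumes "\<And>p. coord v p = coord v' p" shows "v = v'"
proof -
  have "\<alpha>\<^sub>1 \<bullet> (v - v') = 0" "\<alpha>\<^sub>2 \<bullet> (v - v') = 0"
    by (simp_all add: inner_diff_right coord_roots assms)
  from eq_zero_if_orthogonal[OF this] show ?thesis by simp
qed

lemma inner_roots: "\<alpha>\<^sub>2 \<bullet> \<alpha>\<^sub>1 = -1"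
  using inner_\<alpha>\<^sub>1_\<alpha>\<^sub>2 by (simp add: inner_commute)

text \<open>Each positive root is a difference of the coordinates \<open>c\<close> and
  \<open>d\<close>. The reflection at level \<open>k\<close> exchanges them up to the summand
  \<open>k\<close>, which the rule \<open>coord v (p + 3) = coord v p - 1\<close> turns into the
  shift of \<open>d\<close> by \<open>- 3 * k\<close>.\<close>

lemma coord_refl:
  assumes "(\<alpha>, c, d) \<in> {(\<alpha>\<^sub>1, 1, 2), (\<alpha>\<^sub>2, 2, 3), (highest_root, 1, 3)}"
  shows "coord (refl \<alpha> k v) p = coord v (swap c (d - 3 * k) p)"
proof -
  have sh: "coord v (p - 3 * k) = coord v p + of_int k" "coord v (p + 3 * k) = coord v p - of_int k" for p
    using coord_shift[of v p "- k"] coord_shift[of v p k] by simp_all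
  note ir = norm_\<alpha>\<^sub>1 norm_\<alpha>\<^sub>2 inner_\<alpha>\<^sub>1_\<alpha>\<^sub>2 inner_roots
  have main: "\<forall>i\<in>{1, 2, 3}. coord (refl \<alpha> k v) i = coord v (swap c (d - 3 * k) i)"
    using assms
  proof (elim insertE emptyE)
    assume a: "(\<alpha>, c, d) = (\<alpha>\<^sub>1, 1, 2)"
    have A: "\<alpha>\<^sub>1 \<bullet> refl \<alpha>\<^sub>1 k v = 2 * of_int k - \<alpha>\<^sub>1 \<bullet> v" "\<alpha>\<^sub>2 \<bullet> refl \<alpha>\<^sub>1 k v = \<alpha>\<^sub>2 \<bullet> v + \<alpha>\<^sub>1 \<bullet> v - of_int k"
      unfolding refl_def inner_diff_right inner_scaleR_right ir by simp_all
    have n: "\<not> 3 dvd 3 - (2 - 3 * k)" by presburger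
    have s: "swap 1 (2 - 3 * k) 1 = 2 - 3 * k" "swap 1 (2 - 3 * k) 2 = 1 + 3 * k"
      "swap 1 (2 - 3 * k) 3 = 3"
      using n by (simp_all add: swap_def)
    have "\<alpha> = \<alpha>\<^sub>1" "c = 1" "d = 2" using a by simp_all
    then show ?thesis
      by (simp only: ball_simps s sh coord_123 A) (simp add: field_simps)
  next
    assume a: "(\<alpha>, c, d) = (\<alpha>\<^sub>2, 2, 3)"
    have A: "\<alpha>\<^sub>1 \<bullet> refl \<alpha>\<^sub>2 k v = \<alpha>\<^sub>1 \<bullet> v + \<alpha>\<^sub>2 \<bullet> v - of_int k" "\<alpha>\<^sub>2 \<bullet> refl \<alpha>\<^sub>2 k v = 2 * of_int k - \<alpha>\<^sub>2 \<bullet> v"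
      unfolding refl_def inner_diff_right inner_scaleR_right ir by simp_all
    have n: "\<not> 3 dvd 1 - (3 - 3 * k)" by presburger
    have s: "swap 2 (3 - 3 * k) 2 = 3 - 3 * k" "swap 2 (3 - 3 * k) 3 = 2 + 3 * k"
      "swap 2 (3 - 3 * k) 1 = 1"
      using n by (simp_all add: swap_def)
    have "\<alpha> = \<alpha>\<^sub>2" "c = 2" "d = 3" using a by simp_all
    then show ?thesis
      by (simp only: ball_simps s sh coord_123 A) (simp add: field_simps)
  next
    assume a: "(\<alpha>, c, d) = (highest_root, 1, 3)"
    have A: "\<alpha>\<^sub>1 \<bullet> refl highest_root k v = of_int k - \<alpha>\<^sub>2 \<bullet> v" "\<alpha>\<^sub>2 \<bullet> refl highest_root k v = of_int k - \<alpha>\<^sub>1 \<bullet> v"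
      unfolding refl_def highest_root_def inner_diff_right inner_scaleR_right inner_add_left inner_add_right ir by simp_all
    have n: "\<not> 3 dvd 2 - (3 - 3 * k)" by presburger
    have s: "swap 1 (3 - 3 * k) 1 = 3 - 3 * k" "swap 1 (3 - 3 * k) 3 = 1 + 3 * k"
      "swap 1 (3 - 3 * k) 2 = 2"
      using n by (simp_all add: swap_def)
    have "\<alpha> = highest_root" "c = 1" "d = 3" using a by simp_all
    then show ?thesis
      by (simp only: ball_simps s sh coord_123 A) (simp add: field_simps)
  qed
  have "\<exists>j. p = 1 + 3 * j \<or> p = 2 + 3 * j \<or> p = 3 + 3 * j" by presburger
  then obtain j where "p = 1 + 3 * j \<or> p = 2 + 3 * j \<or> p = 3 + 3 * j" ..
  then show ?thesis using main
    by (elim disjE; hypsubst) (simp_all only: swap_shift coord_shift ball_simps)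
qed

lemma refl_uminus: "refl (- \<alpha>) k = refl \<alpha> (- k)"
  by (rule ext) (simp add: refl_def algebra_simps)

lemma reflection_swap:
  assumes "r \<in> reflections"
  shows "\<exists>c d. \<not> 3 dvd c - d \<and> (\<forall>v p. coord (r v) p = coord v (swap c d p))"
proof -
  obtain \<alpha> k where r: "r = refl \<alpha> k" "\<alpha> \<in> roots" using assms unfolding reflections_def by blast
  then obtain \<beta> j where rb: "r = refl \<beta> j" "\<beta> \<in> pos_roots"
    unfolding roots_def using refl_uminus by blast
  then obtain c d :: int where cd: "(\<beta>, c, d) \<in> {(\<alpha>\<^sub>1, 1, 2), (\<alpha>\<^sub>2, 2, 3), (highest_root, 1, 3::int)}"
    unfolding pos_roots_def by blast
  have "\<not> 3 dvd c - (d - 3 * j)" using cd by (elim insertE emptyE; simp only: prod.inject; presburger)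
  then show ?thesis using coord_refl[OF cd] rb(1) by (intro exI[of _ c] exI[of _ "d - 3 * j"]) simp
qed

lemma swap_reflection:
  assumes "\<not> 3 dvd c - d"
  shows "\<exists>r\<in>reflections. \<forall>v p. coord (r v) p = coord v (swap c d p)"
proof -
  have ex: "\<exists>r\<in>reflections. \<forall>v p. coord (r v) p = coord v (swap c' (d' - 3 * k) p)"
    if t: "(\<alpha>, c', d') \<in> {(\<alpha>\<^sub>1, 1, 2), (\<alpha>\<^sub>2, 2, 3), (highest_root, 1, 3)}" for \<alpha> and c' d' k :: int
  proof (rule bexI[of _ "refl \<alpha> k"])
    have "\<alpha> \<in> roots" using t unfolding roots_def pos_roots_def by auto
    then show "refl \<alpha> k \<in> reflections" unfolding reflections_def by blast
    show "\<forall>v p. coord (refl \<alpha> k v) p = coord v (swap c' (d' - 3 * k) p)"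
      by (intro allI coord_refl[OF t])
  qed
  then have ex': "\<exists>r\<in>reflections. \<forall>v p. coord (r v) p = coord v (swap c' (d' - 3 * k) p)"
    if "(c', d') = (1, 2) \<or> (c', d') = (2, 3) \<or> (c', d') = (1, 3)" for c' d' k :: int
    using that ex[of \<alpha>\<^sub>1 1 2 k] ex[of \<alpha>\<^sub>2 2 3 k] ex[of highest_root 1 3 k] by (elim disjE) simp_all
  define i j where "i = (c - 1) div 3" and "j = (d - 1) div 3"
  define c' d' where "c' = c - 3 * i" and "d' = d - 3 * j"
  have c: "c = c' + 3 * i" and d: "d = d' + 3 * j" by (simp_all add: c'_def d'_def)
  have c'1: "c' = 1 \<or> c' = 2 \<or> c' = 3" unfolding c'_def i_def by presburger
  have d'1: "d' = 1 \<or> d' = 2 \<or> d' = 3" unfolding d'_def j_def by presburger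
  have ne: "c' \<noteq> d'"
  proof
    assume "c' = d'"
    then have "c - d = 3 * (i - j)" unfolding c d by simp
    then show False using assms by simp
  qed
  have e: "d' - 3 * (i - j) + 3 * i = d" "c' - 3 * (j - i) + 3 * j = c" unfolding c d by simp_all
  have s1: "swap c d = swap c' (d' - 3 * (i - j))"
    using swap_shift_args[of c' i "d' - 3 * (i - j)"] unfolding e(1) c[symmetric] .
  have "swap d c = swap d' (c' - 3 * (j - i))"
    using swap_shift_args[of d' j "c' - 3 * (j - i)"] unfolding e(2) d[symmetric] .
  then have s2: "swap c d = swap d' (c' - 3 * (j - i))" using swap_commute[OF assms] by simp
  have "((c', d') = (1, 2) \<or> (c', d') = (2, 3) \<or> (c', d') = (1, 3)) \<or>
      ((d', c') = (1, 2) \<or> (d', c') = (2, 3) \<or> (d', c') = (1, 3))"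
    using c'1 d'1 ne by auto
  then show ?thesis
  proof
    assume "(c', d') = (1, 2) \<or> (c', d') = (2, 3) \<or> (c', d') = (1, 3)"
    from ex'[OF this, of "i - j"] show ?thesis unfolding s1 .
  next
    assume "(d', c') = (1, 2) \<or> (d', c') = (2, 3) \<or> (d', c') = (1, 3)"
    from ex'[OF this, of "j - i"] show ?thesis unfolding s2 .
  qed
qed

lemma coord_simple: "coord (simple i v) p = coord v (swap (row i) (row i + 1) p)"
proof -
  have z: "i = 0 \<longleftrightarrow> i = 3"
  proof -
    have "(0::3) = 3" by simp
    then show ?thesis by (simp only:)
  qed
  \<comment> \<open>The affine simple reflection has level 1: it exchanges 1 with 0, equivalently 4
    with 3.\<close>
  have "swap 1 (3 - 3 * 1) = swap (3::int) 4"
    using swap_shift_args[of 1 1 "0"] swap_commute[of 4 3] by simp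
  then have h: "coord (refl highest_root 1 v) p = coord v (swap 3 4 p)"
    using coord_refl[of highest_root 1 3 1 v p] by simp
  show ?thesis
    using exhaust3[of i] h coord_refl[of \<alpha>\<^sub>1 1 2 0 v p] coord_refl[of \<alpha>\<^sub>2 2 3 0 v p]
    unfolding simple_def z by (elim disjE) simp_all
qed

lemma simple_reflection: "simple i \<in> reflections"
  unfolding simple_def reflections_def roots_def pos_roots_def by auto

definition rep :: "('v \<Rightarrow> 'v) \<Rightarrow> (int \<Rightarrow> int) \<Rightarrow> bool" where
  "rep w z \<longleftrightarrow> affine z \<and> (\<forall>v p. coord (w v) p = coord v (z p))"

lemma rep_id: "rep id id"
  by (simp add: rep_def affine_id)

lemma rep_comp:
  assumes "rep w z" "\<not> 3 dvd c - d" "\<And>v p. coord (r v) p = coord v (swap c d p)"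
  shows "rep (r \<circ> w) (z \<circ> swap c d)"
  unfolding rep_def
proof (intro conjI allI)
  show "affine (z \<circ> swap c d)"
    using assms(1) affine_swap[OF assms(2)] by (intro affine_comp) (simp_all add: rep_def)
  fix v p show "coord ((r \<circ> w) v) p = coord v ((z \<circ> swap c d) p)"
    unfolding o_apply assms(3) using assms(1) unfolding rep_def by blast
qed

lemma rep_simple: "rep w z \<Longrightarrow> rep (simple i \<circ> w) (z \<circ> swap (row i) (row i + 1))"
  by (rule rep_comp) (simp_all add: coord_simple)

text \<open>The centre of \<open>A\<^sub>0\<close>. Its coordinates at different integers are
  different, so its image determines the permutation.\<close>

definition base :: 'v where "base = (1 / 3) *\<^sub>R (\<alpha>\<^sub>1 + \<alpha>\<^sub>2)"

lemma coord_base: "coord base p = (2 - of_int p) / 3"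
proof -
  have b: "\<alpha>\<^sub>1 \<bullet> base = 1 / 3" "\<alpha>\<^sub>2 \<bullet> base = 1 / 3"
    using norm_\<alpha>\<^sub>1 norm_\<alpha>\<^sub>2 inner_\<alpha>\<^sub>1_\<alpha>\<^sub>2 inner_roots by (simp_all add: base_def inner_add_right)
  have "\<exists>j. p = 1 + 3 * j \<or> p = 2 + 3 * j \<or> p = 3 + 3 * j" by presburger
  then obtain j where "p = 1 + 3 * j \<or> p = 2 + 3 * j \<or> p = 3 + 3 * j" ..
  then show ?thesis
    by (elim disjE; hypsubst) (simp_all only: coord_shift coord_123 b, simp_all add: field_simps)
qed

lemma rep_unique: "rep w z \<Longrightarrow> rep w z' \<Longrightarrow> z = z'"
proof
  fix p assume "rep w z" "rep w z'"
  then have "coord base (z p) = coord base (z' p)" unfolding rep_def by metis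
  then show "z p = z' p" unfolding coord_base by simp
qed

lemma rep_inject: "rep w z \<Longrightarrow> rep w' z \<Longrightarrow> w = w'"
proof
  fix v assume "rep w z" "rep w' z"
  then show "w v = w' v" unfolding rep_def by (intro coord_inject) metis
qed

lemma rep_sum: "rep w z \<Longrightarrow> z 1 + z 2 + z 3 = 6"
proof -
  assume r: "rep w z"
  have e: "coord (w base) i = (2 - of_int (z i)) / 3" for i
    using r coord_base unfolding rep_def by metis
  have "coord (w base) 1 + coord (w base) 2 + coord (w base) 3 = 0" by (rule coord_roots)
  then have "of_int (z 1) + of_int (z 2) + of_int (z 3) = (6::real)" unfolding e by (simp add: field_simps)
  then show ?thesis by linarith
qed

lemma rep_affine: "rep w z \<Longrightarrow> affine z"
  by (simp add: rep_def)

lemma W_rep: "w \<in> W \<Longrightarrow> \<exists>z. rep w z"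
proof (induction rule: W.induct)
  case W_id
  then show ?case using rep_id by blast
next
  case (W_step w r)
  then obtain z where z: "rep w z" by blast
  from reflection_swap[OF W_step.hyps(2)] obtain c d where
    cd: "\<not> 3 dvd c - d" "\<forall>v p. coord (r v) p = coord v (swap c d p)" by (elim exE conjE)
  have "rep (r \<circ> w) (z \<circ> swap c d)" by (rule rep_comp[OF z cd(1)]) (rule cd(2)[rule_format])
  then show ?case by (rule exI[of "rep (r \<circ> w)"])
qed

text \<open>Since \<open>w\<close> acts on the argument, \<open>win\<close> reverses the order of factors: it is the window of \<open>w\<^sup>-\<^sup>1\<close>.\<close>

definition win :: "('v \<Rightarrow> 'v) \<Rightarrow> int \<Rightarrow> int" where
  "win w = (THE z. rep w z)"

lemma win_eq: "rep w z \<Longrightarrow> win w = z"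
  unfolding win_def using rep_unique by blast

lemma rep_win: "w \<in> W \<Longrightarrow> rep w (win w)"
  using W_rep win_eq by fastforce

lemma word_Cons: "word (i # is) = simple i \<circ> word is"
  by (simp add: word_def)

lemma word_Nil: "word [] = id"
  by (simp only: word_def foldr.simps id_apply)

lemma word_W: "word is \<in> W"
proof (induction "is")
  case Nil
  show ?case unfolding word_Nil by (rule W_id)
next
  case (Cons i "is")
  then show ?case unfolding word_Cons using simple_reflection by (intro W_step)
qed

lemma rep_word: "rep (word is) (win (word is))"
  by (rule rep_win[OF word_W])

lemma inversions_simple_le:
  assumes "affine z" shows "inversions (z \<circ> swap p (p + 1)) \<le> inversions z + 1"
proof (cases "z (p + 1) < z p")
  case True
  then show ?thesis using inversions_swap_simple[OF assms True] by simp
next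
  case False
  let ?s = "swap p (p + 1)"
  have nd: "\<not> 3 dvd p - (p + 1)" by simp
  have "z (p + 1) \<noteq> z p" by (intro affine_neq[OF assms]) simp
  with False have "z p < z (p + 1)" by simp
  moreover have "?s p = p + 1" "?s (p + 1) = p" by (simp_all add: swap_def)
  ultimately have d: "(z \<circ> ?s) (p + 1) < (z \<circ> ?s) p" by simp
  have "z \<circ> ?s \<circ> ?s = z" using swap_swap[OF nd] by (simp add: fun_eq_iff)
  with inversions_swap_simple[OF affine_comp[OF assms affine_swap[OF nd]] d] show ?thesis
    by (simp only:)
qed

lemma inversions_word: "inversions (win (word is)) \<le> int (length is)"
proof (induction "is")
  case Nil
  show ?case unfolding word_Nil win_eq[OF rep_id] by (simp add: inversions_def)
next
  case (Cons i "is")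
  have e: "win (word (i # is)) = win (word is) \<circ> swap (row i) (row i + 1)"
    unfolding word_Cons by (rule win_eq[OF rep_simple[OF rep_word]])
  show ?case unfolding e
    using Cons inversions_simple_le[OF rep_affine[OF rep_word], of "is" "row i"] by (simp only: length_Cons)
qed

lemma descent_row:
  assumes "affine z" "z (p + 1) < z p"
  shows "\<exists>i. z (row i + 1) < z (row i)"
proof (rule exI[of _ "of_int p"])
  let ?k = "(p - 1) div 3"
  have p: "p = row (of_int p) + 3 * ?k" by (simp add: row_of_int)
  then have "p + 1 = row (of_int p) + 1 + 3 * ?k" by simp
  then show "z (row (of_int p) + 1) < z (row (of_int p))"
    using assms(2) affine_shift[OF assms(1)] p by (metis add_less_cancel_right)
qed

text \<open>Sorting by adjacent transpositions: each descent removed costs one letter and one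
  inversion, and the sorted permutation is the identity. With \<open>inversions_word\<close> this
  identifies \<open>len\<close> with \<open>inversions\<close>.\<close>

lemma rep_word_exists:
  assumes "affine z" "z 1 + z 2 + z 3 = 6"
  shows "\<exists>is. int (length is) = inversions z \<and> rep (word is) z"
  using assms
proof (induction "nat (inversions z)" arbitrary: z rule: less_induct)
  case less
  show ?case
  proof (cases "\<exists>p. z (p + 1) < z p")
    case False
    then have "z = id" by (intro no_descent_id less.prems) auto
    then show ?thesis using rep_id by (intro exI[of _ "[]"]) (simp add: inversions_def word_Nil)
  next
    case True
    then obtain i where i: "z (row i + 1) < z (row i)" using descent_row[OF less.prems(1)] by blast
    let ?s = "swap (row i) (row i + 1)"
    have nd: "\<not> 3 dvd row i - (row i + 1)" by simp
    have inv: "inversions (z \<circ> ?s) = inversions z - 1"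
      by (rule inversions_swap_simple[OF less.prems(1) i])
    have aff: "affine (z \<circ> ?s)" by (rule affine_comp[OF less.prems(1) affine_swap[OF nd]])
    have sum: "(z \<circ> ?s) 1 + (z \<circ> ?s) 2 + (z \<circ> ?s) 3 = 6"
    proof -
      have e: "z 4 = z 1 + 3" "z 0 = z 3 - 3"
        using affine_shift3[OF less.prems(1), of 1] affine_shift3(2)[OF less.prems(1), of 3] by simp_all
      have "swap 3 4 1 = (0::int)" "swap 3 4 3 = (4::int)" "swap 3 4 2 = (2::int)"
        "swap 1 2 1 = (2::int)" "swap 1 2 2 = (1::int)" "swap 1 2 3 = (3::int)"
        "swap 2 3 1 = (1::int)" "swap 2 3 2 = (3::int)" "swap 2 3 3 = (2::int)"
        by (simp_all add: swap_def)
      then show ?thesis using exhaust3[of i] less.prems(2) e by auto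
    qed
    have "nat (inversions (z \<circ> ?s)) < nat (inversions z)" using inv inversions_nonneg[of "z \<circ> ?s"] by simp
    from less.hyps[OF this aff sum] obtain "is" where
      js: "int (length is) = inversions (z \<circ> ?s)" "rep (word is) (z \<circ> ?s)" by blast
    have "z \<circ> ?s \<circ> ?s = z" using swap_swap[OF nd] by (simp add: fun_eq_iff)
    then have "rep (word (i # is)) z" using rep_simple[OF js(2), of i] by (simp add: word_Cons)
    then show ?thesis using js(1) inv by (intro exI[of _ "i # is"]) simp
  qed
qed

lemma W_word:
  assumes "w \<in> W" shows "\<exists>is. int (length is) = inversions (win w) \<and> word is = w"
proof -
  have r: "rep w (win w)" by (rule rep_win[OF assms])
  obtain "is" where "int (length is) = inversions (win w)" "rep (word is) (win w)"
    using rep_word_exists[OF rep_affine[OF r] rep_sum[OF r]] by blast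
  then show ?thesis using rep_inject[OF _ r] by blast
qed

lemma len_inversions:
  assumes "w \<in> W" shows "int (len w) = inversions (win w)"
proof -
  obtain js where js: "int (length js) = inversions (win w)" "word js = w"
    using W_word[OF assms] by blast
  have "len w = length js"
    unfolding len_def
  proof (rule Least_equality)
    show "\<exists>is. length is = length js \<and> word is = w" using js(2) by blast
    fix n assume "\<exists>is. length is = n \<and> word is = w"
    then obtain "is" where "length is = n" "word is = w" by blast
    then show "length js \<le> n" using inversions_word[of "is"] js(1) by simp
  qed
  then show ?thesis using js(1) by simp
qed

end

text \<open>The conjugation formula for reflections; it converts a reflection acting on positions
  into one acting on values.\<close>

lemma affine_swap_conj:
  assumes "affine s"
  shows "s (swap c d p) = swap (s c) (s d) (s p)"
proof -
  have sh: "s (x + 3 * k) = s x + 3 * k" for x k by (rule affine_shift[OF assms])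
  consider k where "p = c + 3 * k" | k where "\<not> 3 dvd p - c" "p = d + 3 * k" | "\<not> 3 dvd p - c" "\<not> 3 dvd p - d"
  proof (cases "3 dvd p - c")
    case True
    then obtain k where "p - c = 3 * k" ..
    then have "p = c + 3 * k" by simp
    then show ?thesis by (rule that(1))
  next
    case f: False
    show ?thesis
    proof (cases "3 dvd p - d")
      case True
      then obtain k where "p - d = 3 * k" ..
      then have "p = d + 3 * k" by simp
      with f show ?thesis by (rule that(2))
    next
      case False
      with f show ?thesis by (rule that(3))
    qed
  qed
  then show ?thesis
  proof cases
    case (1 k)
    have "s (swap c d p) = s (d + 3 * k)" unfolding 1 swap_shift by (simp add: swap_def)
    also have "\<dots> = swap (s c) (s d) (s p)" unfolding 1 sh swap_shift by (simp add: swap_def)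
    finally show ?thesis .
  next
    case (2 k)
    have n: "\<not> 3 dvd s p - s c" unfolding affine_dvd[OF assms] by (rule 2)
    have "swap c d p = c + 3 * k" using 2 by (simp add: swap_def)
    then have "s (swap c d p) = s c + 3 * k" by (simp only: sh)
    moreover have "s p = s d + 3 * k" unfolding 2(2) by (rule sh)
    ultimately show ?thesis using n by (simp add: swap_def)
  next
    case 3
    then have "\<not> 3 dvd s p - s c" "\<not> 3 dvd s p - s d" unfolding affine_dvd[OF assms] .
    with 3 show ?thesis by (simp add: swap_def)
  qed
qed

context A2_plane
begin

lemma win_comp:
  assumes "w \<in> W" "\<not> 3 dvd c - d" "\<forall>v p. coord (r v) p = coord v (swap c d p)"
  shows "win (r \<circ> w) = win w \<circ> swap c d"
  by (rule win_eq, rule rep_comp[OF rep_win[OF assms(1)] assms(2)]) (rule assms(3)[rule_format])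

lemma win_affine: "w \<in> W \<Longrightarrow> affine (win w)"
  by (rule rep_affine[OF rep_win])

lemma win_inject:
  assumes "u \<in> W" "v \<in> W" "win u = win v" shows "u = v"
proof (rule rep_inject)
  show "rep u (win u)" by (rule rep_win[OF assms(1)])
  show "rep v (win u)" unfolding assms(3) by (rule rep_win[OF assms(2)])
qed

lemma win_simple: "w \<in> W \<Longrightarrow> win (simple i \<circ> w) = win w \<circ> swap (row i) (row i + 1)"
  by (rule win_eq[OF rep_simple[OF rep_win]])

lemma simple_W: "w \<in> W \<Longrightarrow> simple i \<circ> w \<in> W"
  by (rule W_step[OF _ simple_reflection])

lemma window_sum:
  assumes "w \<in> W" shows "win w t + win w (t + 1) + win w (t + 2) = 3 * t + 3"
proof -
  have s: "win w 1 + win w 2 + win w 3 = 6" by (rule rep_sum[OF rep_win[OF assms]])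
  note sh = affine_shift[OF win_affine[OF assms]]
  have "\<exists>k. t = 1 + 3 * k \<or> t = 2 + 3 * k \<or> t = 3 + 3 * k" by presburger
  then obtain k where t: "t = 1 + 3 * k \<or> t = 2 + 3 * k \<or> t = 3 + 3 * k" ..
  have 1: "win w (1 + 3 * k) = win w 1 + 3 * k" "win w (2 + 3 * k) = win w 2 + 3 * k"
    "win w (3 + 3 * k) = win w 3 + 3 * k" "win w (4 + 3 * k) = win w 1 + 3 + 3 * k"
    "win w (5 + 3 * k) = win w 2 + 3 + 3 * k"
    using sh[of 1 k] sh[of 2 k] sh[of 3 k] sh[of 1 "k + 1"] sh[of 2 "k + 1"] by (simp_all add: algebra_simps)
  from t show ?thesis
    by (elim disjE; hypsubst) (use 1 s in \<open>simp_all add: algebra_simps\<close>)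
qed

lemma reflection_of_swap:
  assumes "u \<in> W" "\<not> 3 dvd c - d"
  obtains r where "r \<in> reflections" "r \<circ> u \<in> W" "win (r \<circ> u) = win u \<circ> swap c d"
proof -
  from swap_reflection[OF assms(2)] obtain r where
    r: "r \<in> reflections" "\<forall>v p. coord (r v) p = coord v (swap c d p)" ..
  show ?thesis by (rule that[OF r(1) W_step[OF assms(1) r(1)] win_comp[OF assms r(2)]])
qed

section \<open>Equivalence of the Bruhat order by chains of reflections with
  \<open>below\<close>\<close>

lemma up_step:
  assumes "u \<in> W" "v \<in> W" "c < d" "\<not> 3 dvd c - d" "win u c < win u d" "win v = win u \<circ> swap c d"
  shows "bruhat_le u v"
proof -
  obtain r where r: "r \<in> reflections" "r \<circ> u \<in> W" "win (r \<circ> u) = win u \<circ> swap c d"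
    using reflection_of_swap[OF assms(1,4)] .
  have "v = r \<circ> u" using win_inject[OF assms(2) r(2)] r(3) assms(6) by (simp only:)
  moreover have "int (len u) < int (len v)"
    unfolding len_inversions[OF assms(1)] len_inversions[OF assms(2)] assms(6)
    by (rule inversions_swap_up[OF win_affine[OF assms(1)] assms(3-5)])
  ultimately show ?thesis unfolding bruhat_le_def using r(1) assms(1) by (intro r_into_rtranclp) auto
qed

text \<open>The length decides the direction: if the larger value already stood on the left, undoing
  the swap would go up by \<open>inversions_swap_up\<close>, against the growth of
  \<open>len\<close>.\<close>

lemma bruhat_step:
  assumes "u \<in> W" "r \<in> reflections" "len u < len (r \<circ> u)"
  obtains c d where "c < d" "\<not> 3 dvd c - d" "win u c < win u d" "win (r \<circ> u) = win u \<circ> swap c d"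
    "r \<circ> u \<in> W"
proof -
  obtain c' d' where cd': "\<not> 3 dvd c' - d'" "\<forall>v p. coord (r v) p = coord v (swap c' d' p)"
    using reflection_swap[OF assms(2)] by (elim exE conjE)
  have rW: "r \<circ> u \<in> W" by (rule W_step[OF assms(1,2)])
  define c d where "c = min c' d'" and "d = max c' d'"
  have "c' \<noteq> d'" using cd'(1) by auto
  then have lt: "c < d" unfolding c_def d_def by simp
  have nd: "\<not> 3 dvd c - d" using cd'(1) unfolding c_def d_def min_def max_def
    by (cases "c' \<le> d'") (simp_all add: dvd_diff_commute)
  have "swap c d = swap c' d'"
    using swap_commute[OF cd'(1)] unfolding c_def d_def min_def max_def by (cases "c' \<le> d'") simp_all
  then have w: "win (r \<circ> u) = win u \<circ> swap c d" using win_comp[OF assms(1) cd'] by simp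
  have "win u c < win u d"
  proof (rule ccontr)
    assume "\<not> win u c < win u d"
    moreover have "win u c \<noteq> win u d" using lt by (intro affine_neq[OF win_affine[OF assms(1)]]) simp
    ultimately have "win u d < win u c" by simp
    moreover have "swap c d c = d" "swap c d d = c" using nd by (simp_all add: swap_def dvd_diff_commute)
    ultimately have "(win u \<circ> swap c d) c < (win u \<circ> swap c d) d" by simp
    from inversions_swap_up[OF affine_comp[OF win_affine[OF assms(1)] affine_swap[OF nd]] lt nd this]
    have "inversions (win (r \<circ> u)) < inversions (win u \<circ> swap c d \<circ> swap c d)" unfolding w .
    moreover have "win u \<circ> swap c d \<circ> swap c d = win u" using swap_swap[OF nd] by (simp add: fun_eq_iff)
    ultimately have "inversions (win (r \<circ> u)) < inversions (win u)" by (simp only:)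
    then show False
      using assms(3) unfolding len_inversions[OF assms(1), symmetric] len_inversions[OF rW, symmetric] by simp
  qed
  then show ?thesis using lt nd w rW by (intro that)
qed

lemma bruhat_imp_below:
  assumes "bruhat_le u v" "u \<in> W"
  shows "v \<in> W \<and> below (win u) (win v) \<and> len u \<le> len v"
  using assms(1) unfolding bruhat_le_def
proof (induction rule: rtranclp_induct)
  case base
  show ?case using assms(2) below_refl by simp
next
  case (step v w)
  then obtain r where r: "v \<in> W" "r \<in> reflections" "w = r \<circ> v" "len v < len w" by blast
  from r(4) have "len v < len (r \<circ> v)" unfolding r(3) .
  then obtain c d where cd: "c < d" "\<not> 3 dvd c - d" "win v c < win v d" "win (r \<circ> v) = win v \<circ> swap c d"
    "r \<circ> v \<in> W" by (rule bruhat_step[OF r(1,2)])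
  have "below (win v) (win w)"
    unfolding r(3) cd(4) by (rule below_swap_up[OF win_affine[OF r(1)] cd(1-3)])
  then have "below (win u) (win w)" using step.IH below_trans by blast
  moreover have "w \<in> W" unfolding r(3) by (rule cd(5))
  ultimately show ?case using step.IH r(4) by simp
qed

lemma bruhat_trans: "bruhat_le u v \<Longrightarrow> bruhat_le v w \<Longrightarrow> bruhat_le u w"
  unfolding bruhat_le_def by (rule rtranclp_trans)

lemma bruhat_refl: "bruhat_le u u"
  unfolding bruhat_le_def by simp

text \<open>Induction along a chain. If the last reflection is the simple one, then
  \<open>simple i \<circ> b\<close> is the new end point. Otherwise the simple reflection preserves
  the order of \<open>c\<close> and \<open>d\<close> and carries the step from \<open>b\<close> to
  \<open>w\<close> over to \<open>simple i \<circ> b\<close> and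
  \<open>simple i \<circ> w\<close>.\<close>

lemma bruhat_lift:
  assumes "bruhat_le a b" "a \<in> W"
  shows "bruhat_le (simple i \<circ> a) b \<or> bruhat_le (simple i \<circ> a) (simple i \<circ> b)"
  using assms(1) unfolding bruhat_le_def
proof (induction rule: rtranclp_induct)
  case base
  show ?case by simp
next
  case (step b w)
  let ?R = "\<lambda>u v. u \<in> W \<and> (\<exists>r\<in>reflections. v = r \<circ> u) \<and> len u < len v"
  from step.IH show ?case
  proof
    assume "?R\<^sup>*\<^sup>* (simple i \<circ> a) b"
    then have "?R\<^sup>*\<^sup>* (simple i \<circ> a) w"
      by (rule rtranclp.rtrancl_into_rtrancl) (rule step.hyps(2))
    then show ?thesis by (rule disjI1)
  next
    assume IH: "?R\<^sup>*\<^sup>* (simple i \<circ> a) (simple i \<circ> b)"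
    obtain r where r: "b \<in> W" "r \<in> reflections" "w = r \<circ> b" "len b < len w" using step.hyps(2) by blast
    from r(4) have "len b < len (r \<circ> b)" unfolding r(3) .
    then obtain c d where cd: "c < d" "\<not> 3 dvd c - d" "win b c < win b d" "win (r \<circ> b) = win b \<circ> swap c d"
      "r \<circ> b \<in> W" by (rule bruhat_step[OF r(1,2)])
    let ?p = "row i"
    let ?s = "swap ?p (?p + 1)"
    have nd: "\<not> 3 dvd ?p - (?p + 1)" by simp
    show ?thesis
    proof (cases "3 dvd c - ?p \<and> d = c + 1")
      case True
      then obtain k where k: "c - ?p = 3 * k" by (elim conjE dvdE)
      then have ck: "c = ?p + 3 * k" by simp
      then have dk: "d = ?p + 1 + 3 * k" using True by simp
      have "swap c d = ?s" unfolding ck dk by (rule swap_shift_args)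
      then have "win w = win (simple i \<circ> b)" unfolding r(3) cd(4) win_simple[OF r(1)] by simp
      then have "w = simple i \<circ> b" using cd(5) simple_W[OF r(1)] unfolding r(3) by (intro win_inject)
      show ?thesis unfolding \<open>w = simple i \<circ> b\<close> using IH by (rule disjI1)
    next
      case False
      have lt: "?s c < ?s d" using swap_mono[OF cd(1) False] .
      have nds: "\<not> 3 dvd ?s c - ?s d" unfolding affine_dvd[OF affine_swap[OF nd]] by (rule cd(2))
      have wW: "w \<in> W" unfolding r(3) by (rule cd(5))
      have "win w = win b \<circ> swap c d" unfolding r(3) by (rule cd(4))
      then have "win (simple i \<circ> w) = win b \<circ> swap c d \<circ> ?s" unfolding win_simple[OF wW] by (rule arg_cong)
      also have "\<dots> = win b \<circ> ?s \<circ> swap (?s c) (?s d)"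
      proof
        fix p
        have "?s (swap (?s c) (?s d) p) = swap (?s (?s c)) (?s (?s d)) (?s p)"
          by (rule affine_swap_conj[OF affine_swap[OF nd]])
        then show "(win b \<circ> swap c d \<circ> ?s) p = (win b \<circ> ?s \<circ> swap (?s c) (?s d)) p"
          unfolding o_apply by (simp only: swap_swap[OF nd])
      qed
      finally have e: "win (simple i \<circ> w) = win (simple i \<circ> b) \<circ> swap (?s c) (?s d)"
        unfolding win_simple[OF r(1)] .
      have "win (simple i \<circ> b) (?s c) < win (simple i \<circ> b) (?s d)"
        unfolding win_simple[OF r(1)] o_apply swap_swap[OF nd] by (rule cd(3))
      from up_step[OF simple_W[OF r(1)] simple_W[OF wW] lt nds this e]
      have "?R\<^sup>*\<^sup>* (simple i \<circ> b) (simple i \<circ> w)" unfolding bruhat_le_def .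
      from rtranclp_trans[OF IH this] show ?thesis by (rule disjI2)
    qed
  qed
qed

text \<open>Induction on the length of \<open>v\<close>. At a descent of \<open>v\<close>,
  \<open>below_lift\<close> passes to a shorter upper bound, removing a descent of \<open>u\<close>
  there if it has one, and \<open>bruhat_lift\<close> brings the result back.\<close>

lemma below_imp_bruhat:
  assumes "u \<in> W" "v \<in> W" "below (win u) (win v)"
  shows "bruhat_le u v"
  using assms
proof (induction "len v" arbitrary: u v rule: less_induct)
  case less
  note affu = win_affine[OF less.prems(1)] and affv = win_affine[OF less.prems(2)]
  show ?case
  proof (cases "\<exists>p. win v (p + 1) < win v p")
    case False
    have vid: "win v = id"
      using False by (intro no_descent_id[OF affv rep_sum[OF rep_win[OF less.prems(2)]]]) blast
    then have "win u = id" using less.prems(3) by (intro below_id) simp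
    then have "u = v" using vid by (intro win_inject less.prems) simp
    then show ?thesis using bruhat_refl by simp
  next
    case True
    then obtain i where i: "win v (row i + 1) < win v (row i)" using descent_row[OF affv] by blast
    let ?p = "row i"
    let ?s = "swap ?p (?p + 1)"
    have nd: "\<not> 3 dvd ?p - (?p + 1)" by simp
    let ?v = "simple i \<circ> v"
    have vW: "?v \<in> W" by (rule simple_W[OF less.prems(2)])
    have wv: "win ?v = win v \<circ> ?s" by (rule win_simple[OF less.prems(2)])
    have "int (len ?v) = int (len v) - 1"
      unfolding len_inversions[OF vW] len_inversions[OF less.prems(2)] wv by (rule inversions_swap_simple[OF affv i])
    then have l: "len ?v < len v" by simp
    have ss: "z \<circ> ?s \<circ> ?s = z" for z :: "int \<Rightarrow> int" using swap_swap[OF nd] by (simp add: fun_eq_iff)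
    have s1: "?s ?p = ?p + 1" "?s (?p + 1) = ?p" by (simp_all add: swap_def)
    have vv: "bruhat_le ?v v"
    proof (rule up_step[OF vW less.prems(2)])
      show "?p < ?p + 1" "\<not> 3 dvd ?p - (?p + 1)" by simp_all
      show "win ?v ?p < win ?v (?p + 1)" unfolding wv o_apply s1 by (rule i)
      show "win v = win ?v \<circ> ?s" unfolding wv ss ..
    qed
    have e1: "?p - 1 + 1 = ?p" and e2: "?p - 1 + 2 = ?p + 1" by simp_all
    have "win u (?p - 1) + win u (?p - 1 + 1) + win u (?p - 1 + 2) = win v (?p - 1) + win v (?p - 1 + 1) + win v (?p - 1 + 2)"
      unfolding window_sum[OF less.prems(1)] window_sum[OF less.prems(2)] ..
    then have sum: "win u (?p - 1) + win u ?p + win u (?p + 1) = win v (?p - 1) + win v ?p + win v (?p + 1)"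
      by (simp only: e1 e2)
    note bl = below_lift[OF affu affv sum less.prems(3) i]
    show ?thesis
    proof (cases "win u ?p > win u (?p + 1)")
      case True
      let ?u = "simple i \<circ> u"
      have uW: "?u \<in> W" by (rule simple_W[OF less.prems(1)])
      have wu: "win ?u = win u \<circ> ?s" by (rule win_simple[OF less.prems(1)])
      have "below (win ?u) (win ?v)" using bl True unfolding wu wv by simp
      from less.hyps[OF l uW vW this] have "bruhat_le ?u ?v" .
      from bruhat_lift[OF this uW, of i]
      have "bruhat_le (simple i \<circ> ?u) ?v \<or> bruhat_le (simple i \<circ> ?u) (simple i \<circ> ?v)" .
      moreover have "simple i \<circ> ?u = u"
        by (rule win_inject[OF simple_W[OF uW] less.prems(1)]) (simp only: win_simple[OF uW] wu ss)
      moreover have "simple i \<circ> ?v = v"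
        by (rule win_inject[OF simple_W[OF vW] less.prems(2)]) (simp only: win_simple[OF vW] wv ss)
      ultimately have "bruhat_le u ?v \<or> bruhat_le u v" by (simp only:)
      then show ?thesis using vv bruhat_trans by blast
    next
      case False
      have "below (win u) (win ?v)" using bl False unfolding wv by simp
      from less.hyps[OF l less.prems(1) vW this] vv show ?thesis by (rule bruhat_trans)
    qed
  qed
qed

end

section \<open>Counting reflections\<close>

text \<open>In a box \<open>[l, h] \<times> [l', h']\<close>, the number of \<open>m\<close> for which the pair \<open>(b + 3 m, a - 3 m)\<close>, obtained from
  \<open>(a, b)\<close> by a reflection, lies in it. It may be negative, which only weakens the lower bounds.\<close>

definition room :: "int \<Rightarrow> int \<Rightarrow> int \<Rightarrow> int \<Rightarrow> int \<Rightarrow> int \<Rightarrow> int" where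
  "room l h l' h' a b = min ((h - b) div 3) ((a - l') div 3) + min ((b - l) div 3) ((h' - a) div 3) + 1"

text \<open>Of the reflections \<open>m \<ge> n\<close> which move the pair \<open>(a, b)\<close> up, at most the first one stays in the box.\<close>

definition tight :: "int \<Rightarrow> int \<Rightarrow> int \<Rightarrow> int \<Rightarrow> int \<Rightarrow> bool" where
  "tight n h l' a b \<longleftrightarrow> (let m = max n ((a - b) div 3 + 1) + 1 in b + 3 * m > h \<or> a - 3 * m < l')"

section \<open>Linear inequalities between box counts, tightness and lengths\<close>

lemma shift3: "3 * x + k + 3 * m = 3 * (x + m) + k" "3 * x + k - 3 * m = 3 * (x - m) + (k::int)"
  by simp_all

text \<open>After splitting off the residues modulo \<open>3\<close>, all inequalities between window entries and their
  quotients become linear with coefficients \<open>0\<close> and \<open>\<plusminus>1\<close>.\<close>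

declare [[smt_timeout = 120]]

lemma residues12 [consumes 2, case_names 1 2 3 4 5 6 7 8 9 10 11 12]:
  fixes p q r s u :: int
  assumes "(p, q) \<in> {(1, 2), (2, 1)}" "(r, s, u) \<in> residues6"
    and "P 1 2 0 1 2" "P 1 2 0 2 1" "P 1 2 1 0 2" "P 1 2 1 2 0" "P 1 2 2 0 1" "P 1 2 2 1 0"
    and "P 2 1 0 1 2" "P 2 1 0 2 1" "P 2 1 1 0 2" "P 2 1 1 2 0" "P 2 1 2 0 1" "P 2 1 2 1 0"
  shows "P p q r s u"
  using assms by auto

lemma min_div3: "min (x div 3) (y div 3) = (if x \<le> y then x div 3 else y div (3::int))"
  by (auto simp: min_def zdiv_mono1)

text \<open>As the sums agree, comparing \<open>A - y\<close> with \<open>x - C\<close> amounts to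
  comparing \<open>z\<close> with \<open>B\<close>, and one inequality resolves both minima.\<close>

lemma room_dec:
  assumes "x + y + z = A + B + C"
  shows "room C A C A x y = (if z \<le> B then (A - x) div 3 + (A - y) div 3 + 1 else (x - C) div 3 + (y - C) div 3 + 1)"
  using assms unfolding room_def min_div3 by (smt (z3))

lemma le3: "3 * x + r \<le> 3 * y + s \<longleftrightarrow> x \<le> y + (s - r) div (3::int)"
proof -
  have e: "3 * y + s - r = (s - r) + 3 * y" by simp
  have "3 * x + r \<le> 3 * y + s \<longleftrightarrow> x \<le> (3 * y + s - r) div 3" by linarith
  then show ?thesis unfolding e by simp
qed

lemma less3: "3 * x + r < 3 * y + s \<longleftrightarrow> x + 1 + (r - s) div 3 \<le> (y::int)"
proof -
  have "(s - r) div 3 = - ((r - s + 2) div 3)" by linarith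
  then show ?thesis unfolding not_le[symmetric] le3 by linarith
qed

lemma window_inv_dec: "c < b \<Longrightarrow> b < a \<Longrightarrow> window_inv a b c = - ((b - a) div 3) - ((c - a) div 3) - ((c - b) div 3)"
  unfolding window_inv_def by (simp add: div_neg_pos_less0)

text \<open>Deodhar's inequality for a decreasing window. The first entry of \<open>w\<close> is
  normalised to residue 0; \<open>p\<close> and \<open>q\<close> are the residues of the others, and
  \<open>r\<close>, \<open>s\<close>, \<open>u\<close> those of \<open>x\<close>.\<close>

lemma dec_room:
  fixes a b c x y z :: int
  assumes res: "(p, q) \<in> {(1, 2), (2, 1::int)}" "(r, s, u) \<in> residues6"
    and dec: "3 * c + q < 3 * b + p" "3 * b + p < 3 * a + 0"
    and box: "3 * c + q \<le> 3 * x + r" "3 * x + r \<le> 3 * a + 0"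
    "3 * c + q \<le> 3 * y + s" "3 * y + s \<le> 3 * a + 0"
    "3 * c + q \<le> 3 * z + u" "3 * z + u \<le> 3 * a + 0"
    and sum: "3 * x + r + (3 * y + s) + (3 * z + u) = 3 * a + 0 + (3 * b + p) + (3 * c + q)"
  shows "window_inv (3 * a + 0) (3 * b + p) (3 * c + q)
    \<le> room (3 * c + q) (3 * a + 0) (3 * c + q) (3 * a + 0) (3 * x + r) (3 * y + s)
     + room (3 * c + q) (3 * a + 0) (3 * c + q) (3 * a + 0) (3 * x + r) (3 * z + u)
     + room (3 * c + q) (3 * a + 0) (3 * c + q) (3 * a + 0) (3 * y + s) (3 * z + u)"
proof -
  have 2: "3 * x + r + (3 * z + u) + (3 * y + s) = 3 * a + 0 + (3 * b + p) + (3 * c + q)"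
    "3 * y + s + (3 * z + u) + (3 * x + r) = 3 * a + 0 + (3 * b + p) + (3 * c + q)" using sum by simp_all
  have s: "x + y + z = a + b + c" using sum res by auto
  show ?thesis using s dec box
    unfolding window_inv_dec[OF dec] room_dec[OF sum] room_dec[OF 2(1)] room_dec[OF 2(2)] div3_diff shift3 le3 less3
    by - ((atomize (full), rule residues12[OF res]); unfold div3_nums; smt (z3))
qed

text \<open>The residue \<open>p\<close> of the middle entry separates the two constants: 6 for
  \<open>p = 2\<close>, and 5 for \<open>p = 1\<close>, which is the case forced by Type 2 through
  \<open>type_2_gap\<close>.\<close>

lemma dec_tight:
  fixes a b c x y z :: int
  assumes res: "(p, q) \<in> {(1, 2), (2, 1::int)}" "(r, s, u) \<in> residues6"
    and dec: "3 * c + q < 3 * b + p" "3 * b + p < 3 * a + 0"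
    and box: "3 * c + q \<le> 3 * x + r" "3 * x + r \<le> 3 * a + 0"
    "3 * c + q \<le> 3 * y + s" "3 * y + s \<le> 3 * a + 0"
    "3 * c + q \<le> 3 * z + u" "3 * z + u \<le> 3 * a + 0"
    and sum: "3 * x + r + (3 * y + s) + (3 * z + u) = 3 * a + 0 + (3 * b + p) + (3 * c + q)"
    and tight: "tight 0 (3 * a + 0) (3 * c + q) (3 * x + r) (3 * y + s)" "tight 1 (3 * a + 0) (3 * c + q) (3 * y + s) (3 * x + r)"
    "tight 0 (3 * a + 0) (3 * c + q) (3 * x + r) (3 * z + u)" "tight 1 (3 * a + 0) (3 * c + q) (3 * z + u) (3 * x + r)"
    "tight 0 (3 * a + 0) (3 * c + q) (3 * y + s) (3 * z + u)" "tight 1 (3 * a + 0) (3 * c + q) (3 * z + u) (3 * y + s)"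
  shows "window_inv (3 * a + 0) (3 * b + p) (3 * c + q) - window_inv (3 * x + r) (3 * y + s) (3 * z + u) \<le> 4 + p"
proof -
  have s: "x + y + z = a + b + c" using sum res by auto
  show ?thesis using s dec box tight
    unfolding window_inv_dec[OF dec] window_inv_3 tight_def Let_def div3_diff shift3 le3 less3
    by - ((atomize (full), rule residues12[OF res]); unfold div3_nums; smt (z3))
qed

lemma window_inv_inc: "a < b \<Longrightarrow> b < c \<Longrightarrow> window_inv a b c = (b - a) div 3 + (c - a) div 3 + (c - b) div 3"
  unfolding window_inv_def by (simp add: pos_imp_zdiv_nonneg_iff)

lemma inc_room:
  fixes a b c x y z :: int
  assumes res: "(p, q) \<in> {(1, 2), (2, 1::int)}" "(r, s, u) \<in> residues6"
    and inc: "3 * a + 0 < 3 * b + p" "3 * b + p < 3 * c + q" "3 * (a + 1) + 0 < 3 * c + q"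
    and box: "3 * a + 0 \<le> 3 * x + r" "3 * x + r \<le> 3 * (c - 1) + q"
    "min (3 * b + p) (3 * (a + 1) + 0) \<le> 3 * y + s" "3 * y + s \<le> max (3 * b + p) (3 * (c - 1) + q)"
    "3 * (a + 1) + 0 \<le> 3 * z + u" "3 * z + u \<le> 3 * c + q"
    and sum: "3 * x + r + (3 * y + s) + (3 * z + u) = 3 * a + 0 + (3 * b + p) + (3 * c + q)"
  shows "window_inv (3 * a + 0) (3 * b + p) (3 * c + q)
    \<le> room (3 * a + 0) (3 * (c - 1) + q) (min (3 * b + p) (3 * (a + 1) + 0)) (max (3 * b + p) (3 * (c - 1) + q)) (3 * x + r) (3 * y + s)
     + room (3 * a + 0) (3 * (c - 1) + q) (3 * (a + 1) + 0) (3 * c + q) (3 * x + r) (3 * z + u)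
     + room (min (3 * b + p) (3 * (a + 1) + 0)) (max (3 * b + p) (3 * (c - 1) + q)) (3 * (a + 1) + 0) (3 * c + q) (3 * y + s) (3 * z + u)"
proof -
  have s: "x + y + z = a + b + c" using sum res by auto
  \<comment> \<open>The interval for the middle entry depends on whether the middle entry of
    \<open>w\<close> is within 3 of its neighbours; the four cases resolve its \<open>min\<close>
    and \<open>max\<close>.\<close>
  consider "3 * b + p \<le> 3 * (a + 1) + 0" "3 * (c - 1) + q \<le> 3 * b + p"
    | "3 * b + p \<le> 3 * (a + 1) + 0" "3 * b + p \<le> 3 * (c - 1) + q"
    | "3 * (a + 1) + 0 \<le> 3 * b + p" "3 * (c - 1) + q \<le> 3 * b + p"
    | "3 * (a + 1) + 0 \<le> 3 * b + p" "3 * b + p \<le> 3 * (c - 1) + q" by linarith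
  then show ?thesis
  proof cases
    case h: 1
    show ?thesis using s inc box h
      unfolding min_absorb1[OF h(1)] max_absorb1[OF h(2)] window_inv_inc[OF inc(1,2)] room_def min_div3 div3_diff shift3 le3 less3
      by - ((atomize (full), rule residues12[OF res]); unfold div3_nums; smt (z3))
  next
    case h: 2
    show ?thesis using s inc box h
      unfolding min_absorb1[OF h(1)] max_absorb2[OF h(2)] window_inv_inc[OF inc(1,2)] room_def min_div3 div3_diff shift3 le3 less3
      by - ((atomize (full), rule residues12[OF res]); unfold div3_nums; smt (z3))
  next
    case h: 3
    show ?thesis using s inc box h
      unfolding min_absorb2[OF h(1)] max_absorb1[OF h(2)] window_inv_inc[OF inc(1,2)] room_def min_div3 div3_diff shift3 le3 less3
      by - ((atomize (full), rule residues12[OF res]); unfold div3_nums; smt (z3))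
  next
    case h: 4
    show ?thesis using s inc box h
      unfolding min_absorb2[OF h(1)] max_absorb2[OF h(2)] window_inv_inc[OF inc(1,2)] room_def min_div3 div3_diff shift3 le3 less3
      by - ((atomize (full), rule residues12[OF res]); unfold div3_nums; smt (z3))
  qed
qed

lemma inc_tight:
  fixes a b c x y z :: int
  assumes res: "(p, q) \<in> {(1, 2), (2, 1::int)}" "(r, s, u) \<in> residues6"
    and inc: "3 * a + 0 < 3 * b + p" "3 * b + p < 3 * c + q" "3 * (a + 1) + 0 < 3 * c + q"
    and box: "3 * a + 0 \<le> 3 * x + r" "3 * x + r \<le> 3 * (c - 1) + q"
    "min (3 * b + p) (3 * (a + 1) + 0) \<le> 3 * y + s" "3 * y + s \<le> max (3 * b + p) (3 * (c - 1) + q)"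
    "3 * (a + 1) + 0 \<le> 3 * z + u" "3 * z + u \<le> 3 * c + q"
    and sum: "3 * x + r + (3 * y + s) + (3 * z + u) = 3 * a + 0 + (3 * b + p) + (3 * c + q)"
    and tight: "tight 0 (3 * (c - 1) + q) (min (3 * b + p) (3 * (a + 1) + 0)) (3 * x + r) (3 * y + s)" "tight 1 (max (3 * b + p) (3 * (c - 1) + q)) (3 * a + 0) (3 * y + s) (3 * x + r)"
    "tight 0 (3 * (c - 1) + q) (3 * (a + 1) + 0) (3 * x + r) (3 * z + u)" "tight 1 (3 * c + q) (3 * a + 0) (3 * z + u) (3 * x + r)"
    "tight 0 (max (3 * b + p) (3 * (c - 1) + q)) (3 * (a + 1) + 0) (3 * y + s) (3 * z + u)" "tight 1 (3 * c + q) (min (3 * b + p) (3 * (a + 1) + 0)) (3 * z + u) (3 * y + s)"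
  shows "window_inv (3 * a + 0) (3 * b + p) (3 * c + q) - window_inv (3 * x + r) (3 * y + s) (3 * z + u) \<le> 6"
proof -
  have s: "x + y + z = a + b + c" using sum res by auto
  consider "3 * b + p \<le> 3 * (a + 1) + 0" "3 * (c - 1) + q \<le> 3 * b + p"
    | "3 * b + p \<le> 3 * (a + 1) + 0" "3 * b + p \<le> 3 * (c - 1) + q"
    | "3 * (a + 1) + 0 \<le> 3 * b + p" "3 * (c - 1) + q \<le> 3 * b + p"
    | "3 * (a + 1) + 0 \<le> 3 * b + p" "3 * b + p \<le> 3 * (c - 1) + q" by linarith
  then show ?thesis
  proof cases
    case h: 1
    show ?thesis using s inc box tight h
      unfolding min_absorb1[OF h(1)] max_absorb1[OF h(2)] window_inv_inc[OF inc(1,2)] window_inv_3 tight_def Let_def div3_diff shift3 le3 less3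
      by - ((atomize (full), rule residues12[OF res]); unfold div3_nums; smt (z3))
  next
    case h: 2
    show ?thesis using s inc box tight h
      unfolding min_absorb1[OF h(1)] max_absorb2[OF h(2)] window_inv_inc[OF inc(1,2)] window_inv_3 tight_def Let_def div3_diff shift3 le3 less3
      by - ((atomize (full), rule residues12[OF res]); unfold div3_nums; smt (z3))
  next
    case h: 3
    show ?thesis using s inc box tight h
      unfolding min_absorb2[OF h(1)] max_absorb1[OF h(2)] window_inv_inc[OF inc(1,2)] window_inv_3 tight_def Let_def div3_diff shift3 le3 less3
      by - ((atomize (full), rule residues12[OF res]); unfold div3_nums; smt (z3))
  next
    case h: 4
    show ?thesis using s inc box tight h
      unfolding min_absorb2[OF h(1)] max_absorb2[OF h(2)] window_inv_inc[OF inc(1,2)] window_inv_3 tight_def Let_def div3_diff shift3 le3 less3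
      by - ((atomize (full), rule residues12[OF res]); unfold div3_nums; smt (z3))
  qed
qed

text \<open>In the exceptional configurations, where \<open>x\<close> lies one length deeper, there is one reflection too
  many (\<open>odd_room\<close>), so that they are excluded by the dimension instead.\<close>

lemma odd_tight:
  fixes a b c x y z :: int
  assumes res: "(p, q) \<in> {(1, 2), (2, 1::int)}" "(r, s, u) \<in> residues6"
    and inc: "3 * (a + 1) + 0 < 3 * b + p" "3 * b + p < 3 * (c - 1) + q"
    and box: "3 * a + 0 \<le> 3 * x + r" "3 * x + r \<le> 3 * (c - 1) + q"
    "3 * (a + 1) + 0 \<le> 3 * y + s" "3 * y + s \<le> 3 * (c - 1) + q"
    "3 * (a + 1) + 0 \<le> 3 * z + u" "3 * z + u \<le> 3 * c + q"
    and sum: "3 * x + r + (3 * y + s) + (3 * z + u) = 3 * a + 0 + (3 * b + p) + (3 * c + q)"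
    and tight: "tight 0 (3 * (c - 1) + q) (3 * (a + 1) + 0) (3 * x + r) (3 * y + s)" "tight 1 (3 * (c - 1) + q) (3 * a + 0) (3 * y + s) (3 * x + r)"
    "tight 0 (3 * (c - 1) + q) (3 * (a + 1) + 0) (3 * x + r) (3 * z + u)" "tight 1 (3 * c + q) (3 * a + 0) (3 * z + u) (3 * x + r)"
    "tight 0 (3 * (c - 1) + q) (3 * (a + 1) + 0) (3 * y + s) (3 * z + u)" "tight 1 (3 * c + q) (3 * (a + 1) + 0) (3 * z + u) (3 * y + s)"
  shows "window_inv (3 * a + 0) (3 * b + p) (3 * c + q) - window_inv (3 * x + r) (3 * y + s) (3 * z + u) \<le> 6 - p \<or>
    (p, q) = (2, 1) \<and> b = a + 1 \<and> (x, r) = (a + 1, 0) \<and>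
      ((y, s, z, u) = (a + 2, 1, c - 2, 2) \<or> (y, s, z, u) = (c - 2, 1, a + 2, 2)) \<or>
    (p, q) = (2, 1) \<and> c = b + 2 \<and> (z, u) = (c - 1, 1) \<and>
      ((x, r, y, s) = (a + 1, 2, b - 0, 0) \<or> (x, r, y, s) = (b - 1, 2, a + 2, 0))"
proof -
  have s: "x + y + z = a + b + c" using sum res by auto
  show ?thesis using s inc box tight
    unfolding window_inv_3 tight_def Let_def prod.inject div3_diff shift3 le3 less3
    by - ((atomize (full), rule residues12[OF res]); unfold div3_nums; smt (z3))
qed

text \<open>Reflections are kept as functions, so that different pairs describing the same one are
  counted once. Those moving \<open>x\<close> down are included.\<close>

definition reflections_below :: "(int \<Rightarrow> int) \<Rightarrow> (int \<Rightarrow> int) \<Rightarrow> (int \<Rightarrow> int) set" where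
  "reflections_below x w = {s. \<exists>c d. \<not> 3 dvd c - d \<and> s = swap c d \<and> below (x \<circ> s) w}"

text \<open>Two reflections in parallel hyperplanes, both moving \<open>x\<close> up and staying below \<open>w\<close>: their roots are
  \<open>\<beta>\<close> and \<open>\<beta> + k \<delta>\<close>. Such a string produces a tangent vector of imaginary weight \<open>k \<delta>\<close>.\<close>

definition repeated_root :: "(int \<Rightarrow> int) \<Rightarrow> (int \<Rightarrow> int) \<Rightarrow> bool" where
  "repeated_root x w \<longleftrightarrow> (\<exists>c d k. c < d \<and> 1 \<le> k \<and> \<not> 3 dvd c - d \<and> x c < x d \<and>
     below (x \<circ> swap c (d + 3 * k)) w)"

definition boxed where
  "boxed w t l\<^sub>0 h\<^sub>0 l\<^sub>1 h\<^sub>1 l\<^sub>2 h\<^sub>2 \<longleftrightarrow> (\<forall>y. affine y \<longrightarrow> (below y w \<longleftrightarrow>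
     (l\<^sub>0 \<le> y t \<and> y t \<le> h\<^sub>0) \<and> (l\<^sub>1 \<le> y (t + 1) \<and> y (t + 1) \<le> h\<^sub>1) \<and> (l\<^sub>2 \<le> y (t + 2) \<and> y (t + 2) \<le> h\<^sub>2)))"

lemma boxed_dec:
  assumes "affine w" "w (t + 2) < w (t + 1)" "w (t + 1) < w t"
  shows "boxed w t (w (t + 2)) (w t) (w (t + 2)) (w t) (w (t + 2)) (w t)"
proof -
  have m: "max (w t) (max (w (t+1) - 3) (w (t+2) - 3)) = w t" "max (w t) (max (w (t+1)) (w (t+2) - 3)) = w t"
    "max (w t) (max (w (t+1)) (w (t+2))) = w t" "min (w t) (min (w (t+1)) (w (t+2))) = w (t+2)"
    "min (w t + 3) (min (w (t+1)) (w (t+2))) = w (t+2)" "min (w t + 3) (min (w (t+1) + 3) (w (t+2))) = w (t+2)"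
    using assms(2,3) by (simp_all add: min_def max_def)
  show ?thesis unfolding boxed_def
  proof (intro allI impI)
    fix y :: "int \<Rightarrow> int" assume "affine y"
    then show "below y w \<longleftrightarrow> (w (t + 2) \<le> y t \<and> y t \<le> w t) \<and> (w (t + 2) \<le> y (t + 1) \<and> y (t + 1) \<le> w t) \<and>
        (w (t + 2) \<le> y (t + 2) \<and> y (t + 2) \<le> w t)"
      unfolding below_window[OF \<open>affine y\<close> assms(1), of t] m by blast
  qed
qed

lemma boxed_inc:
  assumes "affine w" "w t < w (t + 1)" "w (t + 1) < w (t + 2)" "w t + 3 < w (t + 2)"
  shows "boxed w t (w t) (w (t + 2) - 3) (min (w (t + 1)) (w t + 3)) (max (w (t + 1)) (w (t + 2) - 3))
    (w t + 3) (w (t + 2))"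
proof -
  have m: "max (w t) (max (w (t+1) - 3) (w (t+2) - 3)) = w (t + 2) - 3"
    "max (w t) (max (w (t+1)) (w (t+2) - 3)) = max (w (t + 1)) (w (t + 2) - 3)"
    "max (w t) (max (w (t+1)) (w (t+2))) = w (t+2)" "min (w t) (min (w (t+1)) (w (t+2))) = w t"
    "min (w t + 3) (min (w (t+1)) (w (t+2))) = min (w (t + 1)) (w t + 3)"
    "min (w t + 3) (min (w (t+1) + 3) (w (t+2))) = w t + 3"
    using assms(2-4) by (simp_all add: min_def max_def)
  show ?thesis unfolding boxed_def
  proof (intro allI impI)
    fix y :: "int \<Rightarrow> int" assume "affine y"
    then show "below y w \<longleftrightarrow> (w t \<le> y t \<and> y t \<le> w (t + 2) - 3) \<and>
        (min (w (t + 1)) (w t + 3) \<le> y (t + 1) \<and> y (t + 1) \<le> max (w (t + 1)) (w (t + 2) - 3)) \<and>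
        (w t + 3 \<le> y (t + 2) \<and> y (t + 2) \<le> w (t + 2))"
      unfolding below_window[OF \<open>affine y\<close> assms(1), of t] m by blast
  qed
qed

lemma swap_values:
  assumes "\<not> 3 dvd c - d"
  shows "swap c (d + 3 * m) c = d + 3 * m" "swap c (d + 3 * m) d = c - 3 * m"
    "\<not> 3 dvd p - c \<Longrightarrow> \<not> 3 dvd p - d \<Longrightarrow> swap c (d + 3 * m) p = p"
    "\<not> 3 dvd c - (d + 3 * m)"
proof -
  have e: "p - (d + 3 * m) = (p - d) - 3 * m" for p by simp
  have d: "3 dvd p - (d + 3 * m) \<longleftrightarrow> 3 dvd p - d" for p unfolding e by (simp add: dvd_diff_left_iff)
  have n: "\<not> 3 dvd d - c" using assms by presburger
  show "swap c (d + 3 * m) c = d + 3 * m" "swap c (d + 3 * m) d = c - 3 * m"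
    "\<not> 3 dvd c - (d + 3 * m)"
    using assms n d[of c] d[of d] unfolding swap_def by simp_all
  show "\<not> 3 dvd p - c \<Longrightarrow> \<not> 3 dvd p - d \<Longrightarrow> swap c (d + 3 * m) p = p"
    unfolding swap_def d by simp
qed

text \<open>The reflections exchanging the classes of \<open>c\<close> and \<open>d\<close> are
  \<open>swap c (d + 3 * m)\<close>, distinct for distinct \<open>m\<close>. They put
  \<open>x d + 3 * m\<close> at \<open>c\<close> and \<open>x c - 3 * m\<close> at \<open>d\<close>;
  the four bounds cut out an interval of \<open>m\<close> counted by \<open>room\<close>.\<close>

lemma room_pair:
  assumes "affine x" "\<not> 3 dvd c - d"
    and low: "\<And>m. l \<le> x d + 3 * m \<and> x d + 3 * m \<le> h \<and> l' \<le> x c - 3 * m \<and> x c - 3 * m \<le> h'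
      \<Longrightarrow> below (x \<circ> swap c (d + 3 * m)) w"
  shows "\<exists>F. finite F \<and> F \<subseteq> reflections_below x w \<and> (\<forall>s\<in>F. \<exists>m. s = swap c (d + 3 * m)) \<and>
    room l h l' h' (x c) (x d) \<le> int (card F)"
proof -
  define lo where "lo = max (- ((x d - l) div 3)) (- ((h' - x c) div 3))"
  define hi where "hi = min ((h - x d) div 3) ((x c - l') div 3)"
  let ?f = "\<lambda>m. swap c (d + 3 * m)"
  have in_f: "?f m \<in> reflections_below x w" if "m \<in> {lo..hi}" for m
  proof -
    have "below (x \<circ> swap c (d + 3 * m)) w"
    proof (rule low)
      have m: "- ((x d - l) div 3) \<le> m" "- ((h' - x c) div 3) \<le> m" "m \<le> (h - x d) div 3" "m \<le> (x c - l') div 3"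
        using that unfolding atLeastAtMost_iff lo_def hi_def max.bounded_iff min.bounded_iff by blast+
      show "l \<le> x d + 3 * m \<and> x d + 3 * m \<le> h \<and> l' \<le> x c - 3 * m \<and> x c - 3 * m \<le> h'"
      proof (intro conjI)
        show "l \<le> x d + 3 * m" using m(1) by linarith
        show "x d + 3 * m \<le> h" using m(3) by linarith
        show "l' \<le> x c - 3 * m" using m(4) by linarith
        show "x c - 3 * m \<le> h'" using m(2) by linarith
      qed
    qed
    with swap_values(4)[OF assms(2)] show ?thesis unfolding reflections_below_def mem_Collect_eq
      by (intro exI[of _ c] exI[of _ "d + 3 * m"] conjI refl)
  qed
  have "inj_on ?f {lo..hi}"
  proof (rule inj_onI)
    fix m n assume "?f m = ?f n"
    then have "?f m c = ?f n c" by simp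
    then show "m = n" unfolding swap_values(1)[OF assms(2)] by simp
  qed
  then have "card (?f ` {lo..hi}) = nat (hi - lo + 1)" by (simp only: card_image card_atLeastAtMost_int)
  moreover have "room l h l' h' (x c) (x d) = hi - lo + 1"
    unfolding room_def lo_def hi_def minus_min_eq_max[symmetric] diff_minus_eq_add ..
  ultimately have "room l h l' h' (x c) (x d) \<le> int (card (?f ` {lo..hi}))" by linarith
  moreover have "?f ` {lo..hi} \<subseteq> reflections_below x w" using in_f by (rule image_subsetI)
  moreover have "\<forall>s\<in>?f ` {lo..hi}. \<exists>m. s = ?f m" by (rule ballI, erule imageE, erule exI)
  ultimately show ?thesis by (intro exI[of _ "?f ` {lo..hi}"] conjI) simp_all
qed

text \<open>From \<open>m = n\<close> on the positions satisfy \<open>c < d + 3 * m\<close>. At the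
  first such \<open>m\<close> for which the values also increase, the reflection moves up; if the
  next one stayed in the box, the two directions would form a repeated root with
  \<open>k = 1\<close>.\<close>

lemma tight_pair:
  assumes "affine x" "\<not> 3 dvd c - d" "\<not> repeated_root x w" "c < d + 3 * n" "l \<le> x c" "x d \<le> h'"
    and low: "\<And>m. l \<le> x d + 3 * m \<and> x d + 3 * m \<le> h \<and> l' \<le> x c - 3 * m \<and> x c - 3 * m \<le> h'
      \<Longrightarrow> below (x \<circ> swap c (d + 3 * m)) w"
  shows "tight n h l' (x c) (x d)"
proof -
  define m where "m = max n ((x c - x d) div 3 + 1)"
  have m1: "n \<le> m" and m2: "(x c - x d) div 3 + 1 \<le> m" unfolding m_def by (rule max.cobounded1, rule max.cobounded2)
  have m: "c < d + 3 * m" using assms(4) m1 by linarith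
  have up: "x c < x d + 3 * m" using m2 by linarith
  then have "x c < x (d + 3 * m)" unfolding affine_shift[OF assms(1)] .
  then have "\<not> below (x \<circ> swap c (d + 3 * m + 3 * 1)) w"
    using assms(3) m swap_values(4)[OF assms(2)] unfolding repeated_root_def by (intro notI) (elim notE, intro exI[of _ c] exI[of _ "d + 3 * m"] exI[of _ 1] conjI; simp)
  then have "\<not> below (x \<circ> swap c (d + 3 * (m + 1))) w" by (simp add: algebra_simps)
  then have "\<not> (l \<le> x d + 3 * (m + 1) \<and> x d + 3 * (m + 1) \<le> h \<and> l' \<le> x c - 3 * (m + 1) \<and> x c - 3 * (m + 1) \<le> h')"
    using low by blast
  moreover have "l \<le> x d + 3 * (m + 1)" using up assms(5) unfolding distrib_left by linarith
  moreover have "x c - 3 * (m + 1) \<le> h'" using up assms(6) unfolding distrib_left by linarith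
  ultimately have "x d + 3 * (m + 1) > h \<or> x c - 3 * (m + 1) < l'" by linarith
  then show ?thesis unfolding tight_def Let_def m_def .
qed

lemma boxed_swap:
  assumes b: "boxed w t l\<^sub>0 h\<^sub>0 l\<^sub>1 h\<^sub>1 l\<^sub>2 h\<^sub>2" and x: "affine x" and le: "below x w"
  shows "l\<^sub>0 \<le> x (t + 1) + 3 * m \<and> x (t + 1) + 3 * m \<le> h\<^sub>0 \<and> l\<^sub>1 \<le> x t - 3 * m \<and> x t - 3 * m \<le> h\<^sub>1 \<Longrightarrow>
      below (x \<circ> swap t (t + 1 + 3 * m)) w"
    "l\<^sub>0 \<le> x (t + 2) + 3 * m \<and> x (t + 2) + 3 * m \<le> h\<^sub>0 \<and> l\<^sub>2 \<le> x t - 3 * m \<and> x t - 3 * m \<le> h\<^sub>2 \<Longrightarrow>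
      below (x \<circ> swap t (t + 2 + 3 * m)) w"
    "l\<^sub>1 \<le> x (t + 2) + 3 * m \<and> x (t + 2) + 3 * m \<le> h\<^sub>1 \<and> l\<^sub>2 \<le> x (t + 1) - 3 * m \<and> x (t + 1) - 3 * m \<le> h\<^sub>2 \<Longrightarrow>
      below (x \<circ> swap (t + 1) (t + 2 + 3 * m)) w"
    "l\<^sub>1 \<le> x t + 3 * m \<and> x t + 3 * m \<le> h\<^sub>1 \<and> l\<^sub>0 \<le> x (t + 1) - 3 * m \<and> x (t + 1) - 3 * m \<le> h\<^sub>0 \<Longrightarrow>
      below (x \<circ> swap (t + 1) (t + 3 * m)) w"
    "l\<^sub>2 \<le> x t + 3 * m \<and> x t + 3 * m \<le> h\<^sub>2 \<and> l\<^sub>0 \<le> x (t + 2) - 3 * m \<and> x (t + 2) - 3 * m \<le> h\<^sub>0 \<Longrightarrow>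
      below (x \<circ> swap (t + 2) (t + 3 * m)) w"
    "l\<^sub>2 \<le> x (t + 1) + 3 * m \<and> x (t + 1) + 3 * m \<le> h\<^sub>2 \<and> l\<^sub>1 \<le> x (t + 2) - 3 * m \<and> x (t + 2) - 3 * m \<le> h\<^sub>1 \<Longrightarrow>
      below (x \<circ> swap (t + 2) (t + 1 + 3 * m)) w"
proof -
  have box: "(l\<^sub>0 \<le> x t \<and> x t \<le> h\<^sub>0) \<and> (l\<^sub>1 \<le> x (t + 1) \<and> x (t + 1) \<le> h\<^sub>1) \<and> (l\<^sub>2 \<le> x (t + 2) \<and> x (t + 2) \<le> h\<^sub>2)"
    using b x le unfolding boxed_def by blast
  have sh: "x (p + 3 * m) = x p + 3 * m" "x (p - 3 * m) = x p - 3 * m" for p m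
    using affine_shift[OF x, of p m] affine_shift[OF x, of p "- m"] by simp_all
  have nd: "\<not> 3 dvd t - (t + 1)" "\<not> 3 dvd t - (t + 2)" "\<not> 3 dvd t + 1 - (t + 2)"
    "\<not> 3 dvd t + 1 - t" "\<not> 3 dvd t + 2 - t" "\<not> 3 dvd t + 2 - (t + 1)" by simp_all
  have iff: "below (x \<circ> swap c (d + 3 * m)) w \<longleftrightarrow>
     (l\<^sub>0 \<le> (x \<circ> swap c (d + 3 * m)) t \<and> (x \<circ> swap c (d + 3 * m)) t \<le> h\<^sub>0) \<and>
     (l\<^sub>1 \<le> (x \<circ> swap c (d + 3 * m)) (t + 1) \<and> (x \<circ> swap c (d + 3 * m)) (t + 1) \<le> h\<^sub>1) \<and>
     (l\<^sub>2 \<le> (x \<circ> swap c (d + 3 * m)) (t + 2) \<and> (x \<circ> swap c (d + 3 * m)) (t + 2) \<le> h\<^sub>2)"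
    if "\<not> 3 dvd c - d" for c d m
    using b[unfolded boxed_def, THEN spec, THEN mp] affine_comp[OF x affine_swap[OF swap_values(4)[OF that]]] .
  note vals = swap_values(1,2)[OF nd(1)] swap_values(3)[OF nd(1) nd(5,6)]
    swap_values(1,2)[OF nd(2)] swap_values(3)[OF nd(2) nd(4,3)]
    swap_values(1,2)[OF nd(3)] swap_values(3)[OF nd(3) nd(1,2)]
    swap_values(1,2)[OF nd(4)] swap_values(3)[OF nd(4) nd(6,5)]
    swap_values(1,2)[OF nd(5)] swap_values(3)[OF nd(5) nd(3,4)]
    swap_values(1,2)[OF nd(6)] swap_values(3)[OF nd(6) nd(2,1)]
  show "l\<^sub>0 \<le> x (t + 1) + 3 * m \<and> x (t + 1) + 3 * m \<le> h\<^sub>0 \<and> l\<^sub>1 \<le> x t - 3 * m \<and> x t - 3 * m \<le> h\<^sub>1 \<Longrightarrow>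
      below (x \<circ> swap t (t + 1 + 3 * m)) w"
    unfolding iff[OF nd(1)] o_apply vals sh using box by blast
  show "l\<^sub>0 \<le> x (t + 2) + 3 * m \<and> x (t + 2) + 3 * m \<le> h\<^sub>0 \<and> l\<^sub>2 \<le> x t - 3 * m \<and> x t - 3 * m \<le> h\<^sub>2 \<Longrightarrow>
      below (x \<circ> swap t (t + 2 + 3 * m)) w"
    unfolding iff[OF nd(2)] o_apply vals sh using box by blast
  show "l\<^sub>1 \<le> x (t + 2) + 3 * m \<and> x (t + 2) + 3 * m \<le> h\<^sub>1 \<and> l\<^sub>2 \<le> x (t + 1) - 3 * m \<and> x (t + 1) - 3 * m \<le> h\<^sub>2 \<Longrightarrow>
      below (x \<circ> swap (t + 1) (t + 2 + 3 * m)) w"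
    unfolding iff[OF nd(3)] o_apply vals sh using box by blast
  show "l\<^sub>1 \<le> x t + 3 * m \<and> x t + 3 * m \<le> h\<^sub>1 \<and> l\<^sub>0 \<le> x (t + 1) - 3 * m \<and> x (t + 1) - 3 * m \<le> h\<^sub>0 \<Longrightarrow>
      below (x \<circ> swap (t + 1) (t + 3 * m)) w"
    unfolding iff[OF nd(4)] o_apply vals sh using box by blast
  show "l\<^sub>2 \<le> x t + 3 * m \<and> x t + 3 * m \<le> h\<^sub>2 \<and> l\<^sub>0 \<le> x (t + 2) - 3 * m \<and> x (t + 2) - 3 * m \<le> h\<^sub>0 \<Longrightarrow>
      below (x \<circ> swap (t + 2) (t + 3 * m)) w"
    unfolding iff[OF nd(5)] o_apply vals sh using box by blast
  show "l\<^sub>2 \<le> x (t + 1) + 3 * m \<and> x (t + 1) + 3 * m \<le> h\<^sub>2 \<and> l\<^sub>1 \<le> x (t + 2) - 3 * m \<and> x (t + 2) - 3 * m \<le> h\<^sub>1 \<Longrightarrow>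
      below (x \<circ> swap (t + 2) (t + 1 + 3 * m)) w"
    unfolding iff[OF nd(6)] o_apply vals sh using box by blast
qed

text \<open>The three families are disjoint, since they send \<open>t\<close> to the classes of
  \<open>t + 1\<close>, \<open>t + 2\<close> and \<open>t\<close> modulo 3 respectively.\<close>

lemma boxed_room:
  assumes b: "boxed w t l\<^sub>0 h\<^sub>0 l\<^sub>1 h\<^sub>1 l\<^sub>2 h\<^sub>2" and x: "affine x" and le: "below x w"
  shows "\<exists>F. finite F \<and> F \<subseteq> reflections_below x w \<and>
    room l\<^sub>0 h\<^sub>0 l\<^sub>1 h\<^sub>1 (x t) (x (t + 1)) + room l\<^sub>0 h\<^sub>0 l\<^sub>2 h\<^sub>2 (x t) (x (t + 2))
      + room l\<^sub>1 h\<^sub>1 l\<^sub>2 h\<^sub>2 (x (t + 1)) (x (t + 2)) \<le> int (card F)"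
proof -
  have nd: "\<not> 3 dvd t - (t + 1)" "\<not> 3 dvd t - (t + 2)" "\<not> 3 dvd t + 1 - (t + 2)" by simp_all
  obtain F where F: "finite F" "F \<subseteq> reflections_below x w" "\<forall>s\<in>F. \<exists>m. s = swap t (t + 1 + 3 * m)"
    "room l\<^sub>0 h\<^sub>0 l\<^sub>1 h\<^sub>1 (x t) (x (t + 1)) \<le> int (card F)"
    by (rule exE[OF room_pair[OF x nd(1)]], rule boxed_swap(1)[OF b x le]) (assumption, elim conjE, rule that)
  obtain G where G: "finite G" "G \<subseteq> reflections_below x w" "\<forall>s\<in>G. \<exists>m. s = swap t (t + 2 + 3 * m)"
    "room l\<^sub>0 h\<^sub>0 l\<^sub>2 h\<^sub>2 (x t) (x (t + 2)) \<le> int (card G)"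
    by (rule exE[OF room_pair[OF x nd(2)]], rule boxed_swap(2)[OF b x le]) (assumption, elim conjE, rule that)
  obtain H where H: "finite H" "H \<subseteq> reflections_below x w" "\<forall>s\<in>H. \<exists>m. s = swap (t + 1) (t + 2 + 3 * m)"
    "room l\<^sub>1 h\<^sub>1 l\<^sub>2 h\<^sub>2 (x (t + 1)) (x (t + 2)) \<le> int (card H)"
    by (rule exE[OF room_pair[OF x nd(3)]], rule boxed_swap(3)[OF b x le]) (assumption, elim conjE, rule that)
  have 1: "s t mod 3 = (t + 1) mod 3" if "s \<in> F" for s
    using F(3) that swap_values(1)[OF nd(1)] by fastforce
  have 2: "s t mod 3 = (t + 2) mod 3" if "s \<in> G" for s
    using G(3) that swap_values(1)[OF nd(2)] by fastforce
  have 3: "s t = t" if "s \<in> H" for s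
    using H(3) that swap_values(3)[OF nd(3), of t] by fastforce
  have m: "(t + 1) mod 3 \<noteq> (t + 2) mod 3" "t mod 3 \<noteq> (t + 1) mod 3" "t mod 3 \<noteq> (t + 2) mod 3" by presburger+
  have "F \<inter> G = {}"
  proof (intro equals0I, elim IntE)
    fix s assume "s \<in> F" "s \<in> G"
    from 1[OF this(1)] 2[OF this(2)] show False using m(1) by simp
  qed
  moreover have "(F \<union> G) \<inter> H = {}"
  proof (intro equals0I, elim IntE UnE)
    fix s assume "s \<in> H" "s \<in> F"
    from 3[OF this(1)] 1[OF this(2)] show False using m(2) by simp
  next
    fix s assume "s \<in> H" "s \<in> G"
    from 3[OF this(1)] 2[OF this(2)] show False using m(3) by simp
  qed
  ultimately have "card (F \<union> G \<union> H) = card F + card G + card H"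
    using F(1) G(1) H(1) by (simp add: card_Un_disjoint)
  then show ?thesis using F(1,2,4) G(1,2,4) H(1,2,4) by (intro exI[of _ "F \<union> G \<union> H"]) auto
qed

text \<open>The six statements are the six parallel classes, one for each ordered pair of window
  positions. The index is 0 when the first position precedes the second, and 1 otherwise.\<close>

lemma boxed_tight:
  assumes b: "boxed w t l\<^sub>0 h\<^sub>0 l\<^sub>1 h\<^sub>1 l\<^sub>2 h\<^sub>2" and x: "affine x" and le: "below x w"
    and nr: "\<not> repeated_root x w"
  shows "tight 0 h\<^sub>0 l\<^sub>1 (x t) (x (t + 1))" "tight 1 h\<^sub>1 l\<^sub>0 (x (t + 1)) (x t)"
    "tight 0 h\<^sub>0 l\<^sub>2 (x t) (x (t + 2))" "tight 1 h\<^sub>2 l\<^sub>0 (x (t + 2)) (x t)"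
    "tight 0 h\<^sub>1 l\<^sub>2 (x (t + 1)) (x (t + 2))" "tight 1 h\<^sub>2 l\<^sub>1 (x (t + 2)) (x (t + 1))"
proof -
  have box: "l\<^sub>0 \<le> x t" "x t \<le> h\<^sub>0" "l\<^sub>1 \<le> x (t + 1)" "x (t + 1) \<le> h\<^sub>1" "l\<^sub>2 \<le> x (t + 2)" "x (t + 2) \<le> h\<^sub>2"
    using b x le unfolding boxed_def by blast+
  note bs = boxed_swap[OF b x le]
  show "tight 0 h\<^sub>0 l\<^sub>1 (x t) (x (t + 1))" by (rule tight_pair[OF x _ nr _ box(1,4) bs(1)]) simp_all
  show "tight 1 h\<^sub>1 l\<^sub>0 (x (t + 1)) (x t)" by (rule tight_pair[OF x _ nr _ box(3,2) bs(4)]) simp_all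
  show "tight 0 h\<^sub>0 l\<^sub>2 (x t) (x (t + 2))" by (rule tight_pair[OF x _ nr _ box(1,6) bs(2)]) simp_all
  show "tight 1 h\<^sub>2 l\<^sub>0 (x (t + 2)) (x t)" by (rule tight_pair[OF x _ nr _ box(5,2) bs(5)]) simp_all
  show "tight 0 h\<^sub>1 l\<^sub>2 (x (t + 1)) (x (t + 2))" by (rule tight_pair[OF x _ nr _ box(3,6) bs(3)]) simp_all
  show "tight 1 h\<^sub>2 l\<^sub>1 (x (t + 2)) (x (t + 1))" by (rule tight_pair[OF x _ nr _ box(5,4) bs(6)]) simp_all
qed

lemma room_shift: "room (l + k) (h + k) (l' + k) (h' + k) (a + k) (b + k) = room l h l' h' a b"
  unfolding room_def by simp

lemma tight_shift: "tight n (h + k) (l' + k) (a + k) (b + k) = tight n h l' a b"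
proof -
  have "h + k < b + k + 3 * m \<longleftrightarrow> h < b + 3 * m" "a + k - 3 * m < l' + k \<longleftrightarrow> a - 3 * m < l'" for m
    by linarith+
  moreover have "a + k - (b + k) = a - b" by simp
  ultimately show ?thesis unfolding tight_def Let_def by (simp only:)
qed

lemma window_coords:
  fixes x w :: "int \<Rightarrow> int"
  assumes x: "affine x" and w: "affine w"
  shows "\<exists>k a b c p q x' y' z' r s u. (p, q) \<in> {(1, 2), (2, 1)} \<and> (r, s, u) \<in> residues6 \<and>
    w t = 3 * a + 0 + k \<and> w (t + 1) = 3 * b + p + k \<and> w (t + 2) = 3 * c + q + k \<and>
    x t = 3 * x' + r + k \<and> x (t + 1) = 3 * y' + s + k \<and> x (t + 2) = 3 * z' + u + k"
proof -
  have sub: "affine (\<lambda>i. z i - k)" if "affine z" for z :: "int \<Rightarrow> int" and k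
    unfolding affine_def using affine_shift3(1)[OF that] affine_dvd[OF that] by simp
  \<comment> \<open>Subtracting \<open>w t\<close> from both windows gives the first entry of
    \<open>w\<close> residue 0.\<close>
  obtain a b c r s u where 1: "w t - w t = 3 * a + r" "w (t + 1) - w t = 3 * b + s" "w (t + 2) - w t = 3 * c + u"
    "(r, s, u) \<in> residues6" using affine_window[OF sub[OF w]] .
  have "r = 0 \<or> r = 1 \<or> r = 2" using 1(4) by auto
  then have "r = 0" using 1(1) by presburger
  then have su: "(s, u) \<in> {(1, 2), (2, 1)}" using 1(4) by auto
  obtain x' y' z' r' s' u' where 2: "x t - w t = 3 * x' + r'" "x (t + 1) - w t = 3 * y' + s'" "x (t + 2) - w t = 3 * z' + u'"
    "(r', s', u') \<in> residues6" using affine_window[OF sub[OF x]] .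
  have "w t = 3 * 0 + 0 + w t" "w (t + 1) = 3 * b + s + w t" "w (t + 2) = 3 * c + u + w t"
    "x t = 3 * x' + r' + w t" "x (t + 1) = 3 * y' + s' + w t" "x (t + 2) = 3 * z' + u' + w t"
    using 1 2 by simp_all
  with su 2(4) show ?thesis by (intro exI conjI)
qed

text \<open>The count is bounded through a finite subfamily, which keeps \<open>card\<close>
  meaningful without a finiteness statement about \<open>reflections_below x w\<close>.\<close>

definition many_reflections :: "(int \<Rightarrow> int) \<Rightarrow> (int \<Rightarrow> int) \<Rightarrow> int \<Rightarrow> bool" where
  "many_reflections x w n \<longleftrightarrow> (\<exists>F. finite F \<and> F \<subseteq> reflections_below x w \<and> n \<le> int (card F))"

lemma many_reflections_room:
  assumes "boxed w t l\<^sub>0 h\<^sub>0 l\<^sub>1 h\<^sub>1 l\<^sub>2 h\<^sub>2" "affine x" "below x w"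
  shows "many_reflections x w (room l\<^sub>0 h\<^sub>0 l\<^sub>1 h\<^sub>1 (x t) (x (t + 1)) + room l\<^sub>0 h\<^sub>0 l\<^sub>2 h\<^sub>2 (x t) (x (t + 2))
      + room l\<^sub>1 h\<^sub>1 l\<^sub>2 h\<^sub>2 (x (t + 1)) (x (t + 2)))"
  unfolding many_reflections_def by (rule boxed_room[OF assms])

lemma many_reflections_mono: "many_reflections x w n \<Longrightarrow> m \<le> n \<Longrightarrow> many_reflections x w m"
  unfolding many_reflections_def by (elim exE conjE) (intro exI conjI, assumption, assumption, linarith)

lemma boxed_le:
  assumes "boxed w t l\<^sub>0 h\<^sub>0 l\<^sub>1 h\<^sub>1 l\<^sub>2 h\<^sub>2" "affine x" "below x w"
  shows "l\<^sub>0 \<le> x t" "x t \<le> h\<^sub>0" "l\<^sub>1 \<le> x (t + 1)" "x (t + 1) \<le> h\<^sub>1" "l\<^sub>2 \<le> x (t + 2)" "x (t + 2) \<le> h\<^sub>2"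
  using assms unfolding boxed_def by blast+

text \<open>In the four families left over by \<open>odd_tight\<close> everything is explicit, the
  length of \<open>w\<close> being \<open>2 * c - 2 * a - 1\<close>. The assumption
  \<open>far\<close> selects the members more than 4 below \<open>w\<close>, where the count exceeds
  the length.\<close>

lemma odd_room:
  fixes a b c x' y' z' r s u :: int
  assumes ord: "a + 1 \<le> b" "b + 2 \<le> c"
    and cases: "b = a + 1 \<and> (x', r) = (a + 1, 0) \<and>
      ((y', s, z', u) = (a + 2, 1, c - 2, 2) \<or> (y', s, z', u) = (c - 2, 1, a + 2, 2)) \<or>
    c = b + 2 \<and> (z', u) = (c - 1, 1) \<and>
      ((x', r, y', s) = (a + 1, 2, b - 0, 0) \<or> (x', r, y', s) = (b - 1, 2, a + 2, 0))"
    and far: "\<not> window_inv (3 * a + 0) (3 * b + 2) (3 * c + 1) - window_inv (3 * x' + r) (3 * y' + s) (3 * z' + u) \<le> 4"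
  shows "window_inv (3 * a + 0) (3 * b + 2) (3 * c + 1) + 1
    \<le> room (3 * a + 0) (3 * (c - 1) + 1) (3 * (a + 1) + 0) (3 * (c - 1) + 1) (3 * x' + r) (3 * y' + s)
      + room (3 * a + 0) (3 * (c - 1) + 1) (3 * (a + 1) + 0) (3 * c + 1) (3 * x' + r) (3 * z' + u)
      + room (3 * (a + 1) + 0) (3 * (c - 1) + 1) (3 * (a + 1) + 0) (3 * c + 1) (3 * y' + s) (3 * z' + u)"
proof -
  have c: "window_inv (3 * a + 0) (3 * b + 2) (3 * c + 1) = 2 * c - 2 * a - 1"
    using ord unfolding window_inv_3 by simp
  consider "b = a + 1" "x' = a + 1" "r = 0" "y' = a + 2" "s = 1" "z' = c - 2" "u = 2"
    | "b = a + 1" "x' = a + 1" "r = 0" "y' = c - 2" "s = 1" "z' = a + 2" "u = 2"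
    | "c = b + 2" "z' = c - 1" "u = 1" "x' = a + 1" "r = 2" "y' = b" "s = 0"
    | "c = b + 2" "z' = c - 1" "u = 1" "x' = b - 1" "r = 2" "y' = a + 2" "s = 0"
    using cases unfolding prod.inject diff_0_right by argo
  then show ?thesis
  proof cases
    case 1
    then show ?thesis using ord far unfolding c unfolding window_inv_3 1 room_def div3_diff div3_nums by (smt (z3))
  next
    case 2
    then show ?thesis using ord far unfolding c unfolding window_inv_3 2 room_def div3_diff div3_nums by (smt (z3))
  next
    case 3
    then show ?thesis using ord far unfolding c unfolding window_inv_3 3 room_def div3_diff div3_nums by (smt (z3))
  next
    case 4
    then show ?thesis using ord far unfolding c unfolding window_inv_3 4 room_def div3_diff div3_nums by (smt (z3))
  qed
qed

context
  fixes x w :: "int \<Rightarrow> int" and t :: int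
  assumes x: "affine x" and w: "affine w" and le: "below x w"
    and sum: "x t + x (t + 1) + x (t + 2) = w t + w (t + 1) + w (t + 2)"
begin

lemma dec_reflections:
  assumes dec: "w (t + 2) < w (t + 1)" "w (t + 1) < w t"
  shows "many_reflections x w (inversions w)"
    and "\<not> repeated_root x w \<Longrightarrow> inversions w - inversions x \<le> 6"
    and "\<not> repeated_root x w \<Longrightarrow> (w t - w (t + 1)) mod 3 = 2 \<Longrightarrow> inversions w - inversions x \<le> 5"
proof -
  obtain k a b c p q x' y' z' r s u where pq: "(p, q) \<in> {(1, 2), (2, 1)}" and rsu: "(r, s, u) \<in> residues6"
    and e: "w t = 3 * a + 0 + k" "w (t + 1) = 3 * b + p + k" "w (t + 2) = 3 * c + q + k"
      "x t = 3 * x' + r + k" "x (t + 1) = 3 * y' + s + k" "x (t + 2) = 3 * z' + u + k"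
    using window_coords[OF x w, of t] by (elim exE conjE)
  note b = boxed_dec[OF w dec]
  note box = boxed_le[OF b x le, unfolded e add_le_cancel_right]
  have d: "3 * c + q < 3 * b + p" "3 * b + p < 3 * a + 0" using dec unfolding e by simp_all
  have s: "3 * x' + r + (3 * y' + s) + (3 * z' + u) = 3 * a + 0 + (3 * b + p) + (3 * c + q)"
    using sum unfolding e by linarith
  have iw: "inversions w = window_inv (3 * a + 0) (3 * b + p) (3 * c + q)"
    unfolding inversions_window[OF w, of t] e window_inv_shift ..
  have ix: "inversions x = window_inv (3 * x' + r) (3 * y' + s) (3 * z' + u)"
    unfolding inversions_window[OF x, of t] e window_inv_shift ..
  show "many_reflections x w (inversions w)"
    unfolding iw
    by (rule many_reflections_mono[OF many_reflections_room[OF b x le, unfolded e room_shift]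
      dec_room[OF pq rsu d box s]])
  assume nr: "\<not> repeated_root x w"
  note bt = boxed_tight[OF b x le nr, unfolded e tight_shift]
  have bound: "inversions w - inversions x \<le> 4 + p"
    unfolding iw ix by (rule dec_tight[OF pq rsu d box s bt])
  show "inversions w - inversions x \<le> 6" using bound pq by auto
  assume g: "(w t - w (t + 1)) mod 3 = 2"
  have "p = 1"
  proof (rule ccontr)
    assume "p \<noteq> 1"
    then have "p = 2" using pq by auto
    then have "w t - w (t + 1) = 3 * (a - b - 1) + 1" unfolding e by simp
    with g show False by presburger
  qed
  with bound show "inversions w - inversions x \<le> 5" by simp
qed

lemma inc_reflections:
  assumes inc: "w t < w (t + 1)" "w (t + 1) < w (t + 2)" "w t + 3 < w (t + 2)"
  shows "many_reflections x w (inversions w)"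
    and "\<not> repeated_root x w \<Longrightarrow> inversions w - inversions x \<le> 6"
proof -
  obtain k a b c p q x' y' z' r s u where pq: "(p, q) \<in> {(1, 2), (2, 1)}" and rsu: "(r, s, u) \<in> residues6"
    and e: "w t = 3 * a + 0 + k" "w (t + 1) = 3 * b + p + k" "w (t + 2) = 3 * c + q + k"
      "x t = 3 * x' + r + k" "x (t + 1) = 3 * y' + s + k" "x (t + 2) = 3 * z' + u + k"
    using window_coords[OF x w, of t] by (elim exE conjE)
  have e3: "3 * a + 0 + k + 3 = 3 * (a + 1) + 0 + k" "3 * c + q + k - 3 = 3 * (c - 1) + q + k" by simp_all
  note e' = e e3 min_add_distrib_left[symmetric] max_add_distrib_left[symmetric]
  note b = boxed_inc[OF w inc]
  note box = boxed_le[OF b x le, unfolded e' add_le_cancel_right]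
  have d: "3 * a + 0 < 3 * b + p" "3 * b + p < 3 * c + q" "3 * (a + 1) + 0 < 3 * c + q"
    using inc unfolding e by simp_all
  have s: "3 * x' + r + (3 * y' + s) + (3 * z' + u) = 3 * a + 0 + (3 * b + p) + (3 * c + q)"
    using sum unfolding e by linarith
  have iw: "inversions w = window_inv (3 * a + 0) (3 * b + p) (3 * c + q)"
    unfolding inversions_window[OF w, of t] e window_inv_shift ..
  have ix: "inversions x = window_inv (3 * x' + r) (3 * y' + s) (3 * z' + u)"
    unfolding inversions_window[OF x, of t] e window_inv_shift ..
  show "many_reflections x w (inversions w)"
    unfolding iw
    by (rule many_reflections_mono[OF many_reflections_room[OF b x le, unfolded e' room_shift]
      inc_room[OF pq rsu d box s]])
  assume nr: "\<not> repeated_root x w"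
  note bt = boxed_tight[OF b x le nr, unfolded e' tight_shift]
  show "inversions w - inversions x \<le> 6"
    unfolding iw ix by (rule inc_tight[OF pq rsu d box s bt])
qed

lemma odd_reflections:
  assumes inc: "w t + 3 < w (t + 1)" "w (t + 1) + 3 < w (t + 2)" and nr: "\<not> repeated_root x w"
  shows "(w (t + 1) - w t) mod 3 = 1 \<Longrightarrow> inversions w - inversions x \<le> 5"
    and "(w (t + 1) - w t) mod 3 = 2 \<Longrightarrow>
      inversions w - inversions x \<le> 4 \<or> many_reflections x w (inversions w + 1)"
proof -
  obtain k a b c p q x' y' z' r s u where pq: "(p, q) \<in> {(1, 2), (2, 1)}" and rsu: "(r, s, u) \<in> residues6"
    and e: "w t = 3 * a + 0 + k" "w (t + 1) = 3 * b + p + k" "w (t + 2) = 3 * c + q + k"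
      "x t = 3 * x' + r + k" "x (t + 1) = 3 * y' + s + k" "x (t + 2) = 3 * z' + u + k"
    using window_coords[OF x w, of t] by (elim exE conjE)
  have e3: "3 * a + 0 + k + 3 = 3 * (a + 1) + 0 + k" "3 * c + q + k - 3 = 3 * (c - 1) + q + k" by simp_all
  have mm: "min (w (t + 1)) (w t + 3) = w t + 3" "max (w (t + 1)) (w (t + 2) - 3) = w (t + 2) - 3"
    by (rule min_absorb2, use inc(1) in linarith, rule max_absorb2, use inc(2) in linarith)
  have b: "boxed w t (w t) (w (t + 2) - 3) (w t + 3) (w (t + 2) - 3) (w t + 3) (w (t + 2))"
    using boxed_inc[OF w, of t] inc unfolding mm by simp
  note box = boxed_le[OF b x le, unfolded e e3 add_le_cancel_right]
  have d: "3 * (a + 1) + 0 < 3 * b + p" "3 * b + p < 3 * (c - 1) + q"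
    using inc unfolding e by simp_all
  have s: "3 * x' + r + (3 * y' + s) + (3 * z' + u) = 3 * a + 0 + (3 * b + p) + (3 * c + q)"
    using sum unfolding e by linarith
  have iw: "inversions w = window_inv (3 * a + 0) (3 * b + p) (3 * c + q)"
    unfolding inversions_window[OF w, of t] e window_inv_shift ..
  have ix: "inversions x = window_inv (3 * x' + r) (3 * y' + s) (3 * z' + u)"
    unfolding inversions_window[OF x, of t] e window_inv_shift ..
  note bt = boxed_tight[OF b x le nr, unfolded e e3 tight_shift]
  note odd = odd_tight[OF pq rsu d box s bt, folded iw ix]
  have g: "(w (t + 1) - w t) mod 3 = p"
  proof -
    have "w (t + 1) - w t = p + 3 * (b - a)" unfolding e by simp
    then have "(w (t + 1) - w t) mod 3 = p mod 3" by (simp only: mod_mult_self2)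
    also have "\<dots> = p" using pq by (elim insertE emptyE; simp only: prod.inject; elim conjE; simp)
    finally show ?thesis .
  qed
  show "(w (t + 1) - w t) mod 3 = 1 \<Longrightarrow> inversions w - inversions x \<le> 5"
  proof -
    assume "(w (t + 1) - w t) mod 3 = 1"
    then have "p = 1" unfolding g .
    then have "(p, q) \<noteq> (2, 1)" by simp
    then have "inversions w - inversions x \<le> 6 - p" using odd by (simp only: simp_thms)
    then show ?thesis unfolding \<open>p = 1\<close> by linarith
  qed
  show "(w (t + 1) - w t) mod 3 = 2 \<Longrightarrow>
      inversions w - inversions x \<le> 4 \<or> many_reflections x w (inversions w + 1)"
  proof -
    assume "(w (t + 1) - w t) mod 3 = 2"
    then have p2: "p = 2" unfolding g .
    then have q1: "q = 1" using pq p2 by auto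
    note room = many_reflections_room[OF b x le, unfolded e e3 room_shift]
    have ord: "a + 1 \<le> b" "b + 2 \<le> c" using d unfolding le3 less3 p2 q1 by simp_all
    have "inversions w + 1
      \<le> room (3 * a + 0) (3 * (c - 1) + q) (3 * (a + 1) + 0) (3 * (c - 1) + q) (3 * x' + r) (3 * y' + s)
        + room (3 * a + 0) (3 * (c - 1) + q) (3 * (a + 1) + 0) (3 * c + q) (3 * x' + r) (3 * z' + u)
        + room (3 * (a + 1) + 0) (3 * (c - 1) + q) (3 * (a + 1) + 0) (3 * c + q) (3 * y' + s) (3 * z' + u)"
      if "\<not> inversions w - inversions x \<le> 4"
      unfolding iw p2 q1
    proof (rule odd_room[OF ord])
      have "\<not> inversions w - inversions x \<le> 6 - 2" using that by simp
      with odd[unfolded p2 q1] show "b = a + 1 \<and> (x', r) = (a + 1, 0) \<and>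
        ((y', s, z', u) = (a + 2, 1, c - 2, 2) \<or> (y', s, z', u) = (c - 2, 1, a + 2, 2)) \<or>
      c = b + 2 \<and> (z', u) = (c - 1, 1) \<and>
        ((x', r, y', s) = (a + 1, 2, b - 0, 0) \<or> (x', r, y', s) = (b - 1, 2, a + 2, 0))"
        by (simp only: simp_thms)
      show "\<not> window_inv (3 * a + 0) (3 * b + 2) (3 * c + 1) - window_inv (3 * x' + r) (3 * y' + s) (3 * z' + u) \<le> 4"
        using that unfolding iw ix p2 q1 .
    qed
    then show ?thesis
      using many_reflections_mono[OF room] by blast
  qed
qed

end

text \<open>Start from a descent at \<open>p\<close>. A second descent next to it gives a decreasing
  window. Otherwise the window starting at \<open>p + 1\<close> increases, and its last entry
  \<open>w p + 3\<close> exceeds the first by more than 3 because of the descent.\<close>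

lemma normal_form:
  assumes "affine w" "w 1 + w 2 + w 3 = 6" "w \<noteq> id"
  obtains t where "w (t + 2) < w (t + 1)" "w (t + 1) < w t"
    | t where "w t < w (t + 1)" "w (t + 1) < w (t + 2)" "w t + 3 < w (t + 2)"
proof -
  obtain p where p: "w (p + 1) < w p" using no_descent_id[OF assms(1,2)] assms(3) by blast
  have n: "w (p + 1) \<noteq> w (p + 2)" "w (p - 1) \<noteq> w p" by (intro affine_neq[OF assms(1)], simp)+
  have e: "p + 1 + 2 = p + 3" "p + 1 + 1 = p + 2" "p + 2 = p - 1 + 3" "p - 1 + 2 = p + 1" "p - 1 + 1 = p" by simp_all
  have s: "w (p + 3) = w p + 3" "w (p - 1 + 3) = w (p - 1) + 3" by (rule affine_shift3[OF assms(1)])+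
  show ?thesis
  proof (cases "w (p + 2) < w (p + 1)")
    case True
    then show ?thesis using p by (rule that(1))
  next
    case f: False
    show ?thesis
    proof (cases "w p < w (p - 1)")
      case True
      show ?thesis by (rule that(1)[of "p - 1"]; unfold e; (rule p True))
    next
      case False
      show ?thesis
      proof (rule that(2)[of "p + 1"]; unfold e(1,2))
        show "w (p + 1) < w (p + 2)" using f n by simp
        show "w (p + 2) < w (p + 3)" using False n(2) s unfolding e(3) by simp
        show "w (p + 1) + 3 < w (p + 3)" using p s by simp
      qed
    qed
  qed
qed

section \<open>Tangent spaces of Schubert varieties\<close>

lemma ent_sum: "finite A \<Longrightarrow> ent (sum f A) p q = (\<Sum>E\<in>A. ent (f E) p q)"
  by (induction rule: finite_induct) (simp_all add: ent_add)

lemma conj_sum: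
  "finite A \<Longrightarrow> a ** (\<Sum>E\<in>A. lscale (c E) E) ** b = (\<Sum>E\<in>A. lscale (c E) (a ** E ** b))"
proof (induction rule: finite_induct)
  case empty
  show ?case by (simp add: matrix_matrix_mult_def vec_eq_iff)
next
  case (insert E A)
  have "a ** (\<Sum>E\<in>insert E A. lscale (c E) E) ** b
      = a ** lscale (c E) E ** b + a ** (\<Sum>E\<in>A. lscale (c E) E) ** b"
    unfolding sum.insert[OF insert.hyps] matrix_add_ldistrib matrix_add_rdistrib ..
  also have "\<dots> = (\<Sum>E\<in>insert E A. lscale (c E) (a ** E ** b))"
    unfolding sum.insert[OF insert.hyps] mult_lscale_right mult_lscale_left insert.IH ..
  finally show ?case .
qed

text \<open>Upper triangular matrices are the directions along the Borel subgroup, so this is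
  independence in the tangent space of the flag variety.\<close>

definition independent_mod_upper :: "loop_matrix set \<Rightarrow> bool" where
  "independent_mod_upper A \<longleftrightarrow> (\<forall>c. upper (\<Sum>E\<in>A. lscale (c E) E) \<longrightarrow> (\<forall>E\<in>A. c E = 0))"

text \<open>Conjugation by a Borel element preserves upper triangularity, so independence modulo
  upper triangular matrices survives a change of representative of the point; \<open>low\<close>
  then selects the tangent vectors.\<close>

lemma card_tangent_le:
  assumes A: "finite A" "independent_mod_upper A"
    and b: "b \<in> Borel" "a \<in> Borel" "a ** b = mat 1" "b ** a = mat 1"
    and T: "\<And>E. E \<in> A \<Longrightarrow> low (a ** E ** b) \<in> loop_space.span Bs"
    and Bs: "finite Bs"
  shows "card A \<le> card Bs"
proof -
  let ?V = "\<lambda>E. low (a ** E ** b)"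
  have key: "\<forall>E\<in>A. c E = 0" if z: "(\<Sum>E\<in>A. lscale (c E) (?V E)) = 0" for c
  proof -
    let ?S = "\<Sum>E\<in>A. lscale (c E) E"
    have e: "a ** ?S ** b = (\<Sum>E\<in>A. lscale (c E) (a ** E ** b))" by (rule conj_sum[OF A(1)])
    have "upper (a ** ?S ** b)"
      unfolding upper_def
    proof (intro allI impI)
      fix p q :: int assume pq: "q < p"
      have "ent (a ** ?S ** b) p q = ent (\<Sum>E\<in>A. lscale (c E) (?V E)) p q"
        unfolding e ent_sum[OF A(1)] ent_lscale ent_low using pq by simp
      then show "ent (a ** ?S ** b) p q = 0" unfolding z by simp
    qed
    moreover have ub: "upper b" "upper a" using b(1,2) unfolding Borel_iff by simp_all
    ultimately have "upper (b ** (a ** ?S ** b) ** a)" using upper_mult[OF upper_mult[OF ub(1)] ub(2)] by blast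
    moreover have "b ** (a ** ?S ** b) ** a = (b ** a) ** ?S ** (b ** a)" by (simp only: matrix_mul_assoc)
    ultimately have "upper ?S" unfolding b(4) by simp
    then show ?thesis using A(2) unfolding independent_mod_upper_def by (elim allE impE)
  qed
  have inj: "inj_on ?V A"
  proof (rule inj_onI, rule ccontr)
    fix E F assume EF: "E \<in> A" "F \<in> A" "?V E = ?V F" "E \<noteq> F"
    define c :: "loop_matrix \<Rightarrow> complex" where "c = (\<lambda>G. if G = E then 1 else if G = F then -1 else 0)"
    have "(\<Sum>G\<in>A. lscale (c G) (?V G)) = (\<Sum>G\<in>{E, F}. lscale (c G) (?V G))"
      using EF A(1) by (intro sum.mono_neutral_right) (auto simp: c_def)
    also have "\<dots> = lscale 1 (?V E) + lscale (-1) (?V F)" using EF(4) by (simp add: c_def)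
    also have "\<dots> = 0" unfolding EF(3) loop_space.scale_minus_left by (rule right_minus)
    finally have "c E = 0" using key EF(1) by blast
    then show False by (simp add: c_def)
  qed
  have "loop_space.independent (?V ` A)"
  proof (rule loop_space.independent_if_scalars_zero)
    show "finite (?V ` A)" using A(1) by simp
    fix f v assume z: "(\<Sum>x\<in>?V ` A. lscale (f x) x) = 0" and v: "v \<in> ?V ` A"
    have "(\<Sum>E\<in>A. lscale (f (?V E)) (?V E)) = 0" using z by (subst (asm) sum.reindex[OF inj]) simp
    from key[OF this] v show "f v = 0" by blast
  qed
  moreover have "?V ` A \<subseteq> loop_space.span Bs" using T by blast
  ultimately have "card (?V ` A) \<le> card Bs"
    using loop_space.independent_span_bound[OF Bs] by blast
  then show ?thesis by (simp only: card_image[OF inj])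
qed

lemma unit_mat_shift: "unit_mat (c + 3 * k) (d + 3 * k) = unit_mat c d"
proof (rule ent_eqI)
  fix p q :: int
  have "3 dvd p - (c + 3 * k) \<longleftrightarrow> 3 dvd p - c" by presburger
  moreover have "q - (d + 3 * k) = p - (c + 3 * k) \<longleftrightarrow> q - d = p - c" by simp
  ultimately show "ent (unit_mat (c + 3 * k) (d + 3 * k)) p q = ent (unit_mat c d) p q"
    unfolding ent_unit_mat by simp
qed

lemma unit_mat_eqD:
  assumes "ent (unit_mat c d) c' d' \<noteq> 0"
  shows "\<exists>k. c' = c + 3 * k \<and> d' = d + 3 * k"
proof -
  have "3 dvd c' - c" "d' - d = c' - c" using assms unfolding ent_unit_mat by (simp_all split: if_splits)
  then obtain k where "c' - c = 3 * k" by (elim dvdE)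
  with \<open>d' - d = c' - c\<close> show ?thesis by (intro exI[of _ k]) simp
qed

text \<open>The root vectors of the negative real roots.\<close>

definition lower_units :: "loop_matrix set" where
  "lower_units = {unit_mat c d | c d. d < c \<and> \<not> 3 dvd c - d}"

lemma lower_units_coefficient:
  assumes A: "finite A" "A \<subseteq> lower_units" and E: "unit_mat c d \<in> A"
  shows "ent (\<Sum>E\<in>A. lscale (f E) E) c d = f (unit_mat c d)"
proof -
  have "ent (\<Sum>E\<in>A. lscale (f E) E) c d = (\<Sum>E\<in>A. f E * ent E c d)"
    unfolding ent_sum[OF A(1)] ent_lscale ..
  also have "\<dots> = (\<Sum>E\<in>{unit_mat c d}. f E * ent E c d)"
  proof (rule sum.mono_neutral_right[OF A(1)])
    show "{unit_mat c d} \<subseteq> A" using E by simp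
    show "\<forall>F\<in>A - {unit_mat c d}. f F * ent F c d = 0"
    proof
      fix F assume F: "F \<in> A - {unit_mat c d}"
      then have "F \<in> lower_units" using A(2) by (elim DiffE) (rule subsetD)
      then obtain c' d' where F': "F = unit_mat c' d'" unfolding lower_units_def mem_Collect_eq by (elim exE conjE)
      have "ent F c d = 0"
      proof (rule ccontr)
        assume "ent F c d \<noteq> 0"
        then obtain k where "c = c' + 3 * k \<and> d = d' + 3 * k" using unit_mat_eqD unfolding F' by (elim exE[OF unit_mat_eqD])
        then have "unit_mat c d = F" unfolding F' by (elim conjE, hypsubst) (rule unit_mat_shift)
        with F show False by simp
      qed
      then show "f F * ent F c d = 0" by simp
    qed
  qed
  also have "\<dots> = f (unit_mat c d)" by (simp add: ent_unit_mat)
  finally show ?thesis .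
qed

lemma lower_units_independent:
  assumes A: "finite A" "A \<subseteq> lower_units" shows "independent_mod_upper A"
  unfolding independent_mod_upper_def
proof (intro allI impI ballI)
  fix f E assume u: "upper (\<Sum>E\<in>A. lscale (f E) E)" and E: "E \<in> A"
  then have "E \<in> lower_units" using A(2) by (elim subsetD)
  then obtain c d where cd: "E = unit_mat c d" "d < c" unfolding lower_units_def mem_Collect_eq by (elim exE conjE)
  have "f E = ent (\<Sum>E\<in>A. lscale (f E) E) c d"
    using lower_units_coefficient[OF A] E unfolding cd(1) by simp
  also have "\<dots> = 0" using u cd(2) unfolding upper_def by blast
  finally show "f E = 0" .
qed

text \<open>The position \<open>(c + 3 * k, c)\<close> is on the diagonal modulo 3, where no real
  root vector has an entry.\<close>

lemma lower_units_insert_independent: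
  assumes A: "finite A" "A \<subseteq> lower_units" and k: "k > 0" and F: "ent F (c + 3 * k) c \<noteq> 0"
  shows "F \<notin> A" "independent_mod_upper (insert F A)"
proof -
  have z: "ent E (c + 3 * k) c = 0" if "E \<in> A" for E
  proof -
    have "E \<in> lower_units" using that A(2) by (elim subsetD)
    then obtain c' d' where cd: "E = unit_mat c' d'" "\<not> 3 dvd c' - d'"
      unfolding lower_units_def mem_Collect_eq by (elim exE conjE)
    show ?thesis
    proof (rule ccontr)
      assume "ent E (c + 3 * k) c \<noteq> 0"
      then obtain m where "c + 3 * k = c' + 3 * m \<and> c = d' + 3 * m"
        unfolding cd(1) by (elim exE[OF unit_mat_eqD])
      then have "c' - d' = 3 * k" by simp
      then show False using cd(2) by simp
    qed
  qed
  show n: "F \<notin> A" using z F by blast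
  show "independent_mod_upper (insert F A)"
    unfolding independent_mod_upper_def
  proof (intro allI impI)
    fix f assume u: "upper (\<Sum>E\<in>insert F A. lscale (f E) E)"
    have "ent (\<Sum>E\<in>insert F A. lscale (f E) E) (c + 3 * k) c = 0" using u k unfolding upper_def by simp
    then have "f F * ent F (c + 3 * k) c = 0"
      unfolding sum.insert[OF A(1) n] ent_add ent_sum[OF A(1)] ent_lscale using z by simp
    then have f0: "f F = 0" using F by simp
    then have "upper (\<Sum>E\<in>A. lscale (f E) E)"
      using u unfolding sum.insert[OF A(1) n] by simp
    then have "\<forall>E\<in>A. f E = 0"
      using lower_units_independent[OF A] unfolding independent_mod_upper_def by (elim allE impE)
    then show "\<forall>E\<in>insert F A. f E = 0" using f0 by simp
  qed
qed

lemma affine_surj: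
  assumes "affine z" shows "\<exists>r. q = z r"
proof -
  obtain a b c r s u where w: "z 0 = 3 * a + r" "z (0 + 1) = 3 * b + s" "z (0 + 2) = 3 * c + u"
    and rsu: "(r, s, u) \<in> residues6" using affine_window[OF assms] .
  have "q mod 3 = r \<or> q mod 3 = s \<or> q mod 3 = u" using rsu by (elim insertE emptyE; simp only: prod.inject; elim conjE; hypsubst; presburger)
  then have "3 dvd q - z 0 \<or> 3 dvd q - z 1 \<or> 3 dvd q - z 2"
    unfolding w[unfolded add_0] by presburger
  then obtain i k where "q - z i = 3 * k" by (elim disjE dvdE)
  then have "q = z (i + 3 * k)" unfolding affine_shift[OF assms] by simp
  then show ?thesis ..
qed

text \<open>Two lifts of one permutation differ by a diagonal matrix, of which only upper
  triangularity is recorded. Hence all words for an element define the same coset.\<close>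

lemma monomial_unique:
  assumes z: "affine z" and M: "monomial M z" "M \<in> KM_group" and N: "monomial N z" "N \<in> KM_group"
  shows "\<exists>b\<in>Borel. N = M ** b"
proof -
  obtain h where h: "M ** h = mat 1" "h \<in> KM_group" using KM_inverse[OF M(2)] .
  let ?b = "h ** N"
  have N': "M ** ?b = N" unfolding matrix_mul_assoc h(1) by simp
  have "upper ?b"
    unfolding upper_def
  proof (intro allI impI)
    fix p q :: int assume pq: "q < p"
    obtain r where r: "p = z r" using affine_surj[OF z] ..
    have "ent M r (z r) * ent ?b (z r) q = ent N r q" using ent_monomial_mult[OF M(1), of ?b r q] unfolding N' ..
    also have "\<dots> = 0" using N(1) pq r unfolding monomial_def by simp
    finally show "ent ?b p q = 0" using M(1) unfolding r monomial_def by simp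
  qed
  moreover have "?b \<in> KM_group" by (rule KM_mult[OF h(2) N(2)])
  ultimately have "?b \<in> Borel" unfolding Borel_iff KM_group_def by simp
  with N' show ?thesis by metis
qed

text \<open>Root groups are permuted by \<open>n\<close>, with a rescaling by the quotient of two of
  its entries. Periodicity of these entries makes \<open>y\<close> a single number.\<close>

lemma monomial_conj_emat:
  assumes z: "affine z" and n: "monomial n z" and cd: "\<not> 3 dvd c - d"
  shows "\<exists>y. n ** emat (z c) (z d) s = emat c d y ** n"
proof -
  define y where "y = s * ent n c (z c) / ent n d (z d)"
  have nz: "ent n d (z d) \<noteq> 0" and n0: "q \<noteq> z p \<Longrightarrow> ent n p q = 0" for p q using n unfolding monomial_def by blast+
  have per: "ent n (p + 3 * k) (z (p + 3 * k)) = ent n p (z p)" for p k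
    unfolding affine_shift[OF z] by (rule ent_period)
  have "n ** emat (z c) (z d) s = emat c d y ** n"
  proof (rule ent_eqI)
    fix p q
    obtain r where r: "q = z r" using affine_surj[OF z] ..
    have "(if 3 dvd z r - z d then s * ent n p (z r - z d + z c) else 0) = (if 3 dvd p - c then y * ent n (p - c + d) (z r) else 0)"
    proof (cases "\<exists>k. p = c + 3 * k \<and> r = d + 3 * k")
      case True
      then obtain k where k: "p = c + 3 * k" "r = d + 3 * k" by (elim exE conjE)
      have 1: "z r - z d + z c = z p" unfolding k affine_shift[OF z] by simp
      have 2: "p - c + d = r" unfolding k by simp
      have 3: "3 dvd z r - z d" unfolding k affine_shift[OF z] by simp
      have 4: "3 dvd p - c" unfolding k by simp
      show ?thesis unfolding 1 2 using 3 4 nz unfolding k per by (simp add: y_def)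
    next
      case False
      have "ent n p (z r - z d + z c) = 0" if "3 dvd z r - z d"
      proof -
        have "3 dvd r - d" using that unfolding affine_dvd[OF z] .
        then obtain k where "r - d = 3 * k" ..
        then have k: "r = d + 3 * k" by simp
        have e: "z r - z d + z c = z (c + 3 * k)" unfolding k affine_shift[OF z] by simp
        have "c + 3 * k \<noteq> p" using False k by blast
        then have "z (c + 3 * k) \<noteq> z p" by (rule affine_neq[OF z])
        then show ?thesis unfolding e by (rule n0)
      qed
      moreover have "ent n (p - c + d) (z r) = 0" if "3 dvd p - c"
      proof -
        from that obtain k where "p - c = 3 * k" ..
        then have k: "p = c + 3 * k" "p - c + d = d + 3 * k" by simp_all
        have "r \<noteq> d + 3 * k" using False k(1) by blast
        then have "z r \<noteq> z (d + 3 * k)" by (rule affine_neq[OF z])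
        then show ?thesis unfolding k(2) by (rule n0)
      qed
      ultimately show ?thesis by simp
    qed
    then show "ent (n ** emat (z c) (z d) s) p q = ent (emat c d y ** n) p q"
      unfolding ent_mult_emat ent_emat_mult r by (rule arg_cong)
  qed
  then show ?thesis ..
qed

text \<open>An SL(2) identity: for nonzero \<open>s\<close> a root element of one sign lies in the
  double coset of the reflection with respect to the opposite root group.\<close>

lemma emat_lower_decomposition:
  assumes "\<not> 3 dvd c - d" "s \<noteq> 0"
  shows "emat d c s = emat c d (inverse s) ** weyl_mat c d (- inverse s) ** emat c d (inverse s)"
proof -
  have 1: "emat c d (inverse s) ** emat c d (- inverse s) = mat 1" "emat c d (- inverse s) ** emat c d (inverse s) = mat 1"
    using emat_mult_neg[OF assms(1), of "inverse s"] emat_mult_neg[OF assms(1), of "- inverse s"] by simp_all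
  have "emat c d (inverse s) ** weyl_mat c d (- inverse s) ** emat c d (inverse s)
      = (emat c d (inverse s) ** emat c d (- inverse s)) ** emat d c (- inverse (- inverse s))
        ** (emat c d (- inverse s) ** emat c d (inverse s))"
    unfolding weyl_mat_def by (simp only: matrix_mul_assoc)
  also have "\<dots> = emat d c s" unfolding 1 using assms(2) by simp
  finally show ?thesis ..
qed

section \<open>Curves through the fixed points of Schubert varieties and their tangent
  vectors\<close>

context A2_plane
begin

lemma word_lift_monomial: "monomial (word_lift is) (win (word is)) \<and> word_lift is \<in> KM_group"
proof (induction "is")
  case Nil
  have "word_lift [] = mat 1" by (simp add: word_lift_def)
  then show ?case unfolding word_Nil win_eq[OF rep_id] using conjI[OF monomial_one KM_one] by (simp only:)
next
  case (Cons i "is")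
  have w: "word_lift (i # is) = simple_lift i ** word_lift is" by (simp add: word_lift_def)
  have e: "win (word (i # is)) = win (word is) \<circ> swap (row i) (row i + 1)"
    unfolding word_Cons by (rule win_simple[OF word_W])
  have m: "monomial (simple_lift i) (swap (row i) (row i + 1))" "simple_lift i \<in> KM_group"
    unfolding simple_lift_weyl using monomial_weyl_mat[OF row_ndvd(1)] weyl_mat_KM[OF row_ndvd(1)] by simp_all
  show ?case unfolding w e by (intro conjI monomial_mult[OF m(1) conjunct1[OF Cons]] KM_mult[OF m(2) conjunct2[OF Cons]])
qed

lemma W_flag_memI:
  assumes "y \<in> W" "monomial M (win y)" "M \<in> KM_group"
  shows "M \<in> W_flag y"
proof -
  obtain "is" where js: "word is = y" using W_word[OF assms(1)] by (elim exE conjE)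
  have "monomial (word_lift is) (win y)" "word_lift is \<in> KM_group"
    using word_lift_monomial[of "is"] unfolding js by simp_all
  then obtain b where "b \<in> Borel" "M = word_lift is ** b"
    using monomial_unique[OF win_affine[OF assms(1)] _ _ assms(2,3)] by blast
  then have "M \<in> flag (word_lift is)" unfolding flag_def by blast
  then show ?thesis unfolding W_flag_def using js by blast
qed

lemma schubert_memI:
  assumes "y \<in> W" "bruhat_le y w" "monomial M (win y)" "M \<in> KM_group" "b \<in> Borel" "b' \<in> Borel"
  shows "flag (b ** M ** b') \<in> schubert_variety w"
proof -
  have "flag (b ** M ** b') = flag (b ** M)" by (rule flag_mult[OF assms(6)])
  moreover have "flag (b ** M) \<in> schubert_cell y"
    unfolding schubert_cell_def mem_Collect_eq by (rule exI[of _ b], rule exI[of _ M]) (intro conjI refl assms(5) W_flag_memI[OF assms(1,3,4)])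
  ultimately show ?thesis unfolding schubert_variety_def using assms(1,2) by (simp only: Union_iff) blast
qed

text \<open>\<open>W_flag\<close> ranges over all words. By \<open>monomial_unique\<close> each can
  be exchanged for a reduced one, which bounds the number of parameters by
  \<open>len w\<close>.\<close>

lemma schubert_points:
  assumes "w \<in> W" "P \<in> schubert_variety w"
  shows "\<exists>b\<in>Borel. \<exists>is. length is \<le> len w \<and> P = flag (b ** word_lift is)"
proof -
  obtain y where y: "y \<in> W" "bruhat_le y w" "P \<in> schubert_cell y"
    using assms(2) unfolding schubert_variety_def by blast
  then obtain b n where bn: "b \<in> Borel" "n \<in> W_flag y" "P = flag (b ** n)"
    unfolding schubert_cell_def by blast
  obtain js c where js: "word js = y" "c \<in> Borel" "n = word_lift js ** c"
    using bn(2) unfolding W_flag_def flag_def by blast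
  obtain "is" where is': "int (length is) = inversions (win y)" "word is = y"
    using W_word[OF y(1)] by (elim exE conjE)
  have "monomial (word_lift is) (win y)" "word_lift is \<in> KM_group"
    "monomial (word_lift js) (win y)" "word_lift js \<in> KM_group"
    using word_lift_monomial[of "is"] word_lift_monomial[of js] unfolding is' js by simp_all
  then obtain c' where c': "c' \<in> Borel" "word_lift js = word_lift is ** c'"
    using monomial_unique[OF win_affine[OF y(1)]] by blast
  have "b ** n = b ** word_lift is ** (c' ** c)" unfolding js(3) c'(2) by (simp only: matrix_mul_assoc)
  then have "P = flag (b ** word_lift is)"
    unfolding bn(3) using flag_mult[OF Borel_mult[OF c'(1) js(2)]] by simp
  moreover have "length is \<le> len w"
    using is'(1) len_inversions[OF y(1)] bruhat_imp_below[OF y(2,1)] by linarith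
  ultimately show ?thesis using bn(1) by blast
qed

text \<open>For \<open>s = 0\<close> this is a point of the cell of \<open>x\<close>; for all other
  \<open>s\<close> it lies in the cell of the reflected element, which is still below
  \<open>w\<close>. The factor \<open>b\<close> makes room for the conjugation used at repeated
  roots.\<close>

lemma swap_up_curve:
  assumes x: "x \<in> W" and w: "w \<in> W" and n: "monomial n (win x)" "n \<in> KM_group"
    and cd: "c < d" "\<not> 3 dvd c - d" and up: "win x c < win x d"
    and le: "bruhat_le x w" "below (win x \<circ> swap c d) (win w)" and b: "b \<in> Borel"
  shows "flag (b ** (n ** emat (win x d) (win x c) s)) \<in> schubert_variety w"
proof (cases "s = 0")
  case True
  have "emat (win x d) (win x c) s = mat 1" unfolding emat_def True by (simp add: loop_space.scale_zero_left)
  then show ?thesis using schubert_memI[OF x le(1) n b Borel_one] by simp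
next
  case False
  let ?C = "win x c" and ?D = "win x d"
  note aff = win_affine[OF x]
  have nd: "\<not> 3 dvd ?C - ?D" unfolding affine_dvd[OF aff] by (rule cd(2))
  obtain y where y: "n ** emat ?C ?D (inverse s) = emat c d y ** n"
    using monomial_conj_emat[OF aff n(1) cd(2)] by blast
  let ?M = "n ** weyl_mat ?C ?D (- inverse s)"
  have "n ** emat ?D ?C s = (n ** emat ?C ?D (inverse s)) ** weyl_mat ?C ?D (- inverse s) ** emat ?C ?D (inverse s)"
    unfolding emat_lower_decomposition[OF nd False] by (simp only: matrix_mul_assoc)
  also have "\<dots> = emat c d y ** ?M ** emat ?C ?D (inverse s)" unfolding y by (simp only: matrix_mul_assoc)
  finally have e: "b ** (n ** emat ?D ?C s) = b ** emat c d y ** ?M ** emat ?C ?D (inverse s)"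
    by (simp only: matrix_mul_assoc)
  obtain r where r: "r \<in> reflections" "r \<circ> x \<in> W" "win (r \<circ> x) = win x \<circ> swap c d"
    using reflection_of_swap[OF x cd(2)] .
  have "swap ?C ?D \<circ> win x = win (r \<circ> x)"
    unfolding r(3) using affine_swap_conj[OF aff] by (simp add: fun_eq_iff)
  then have "monomial ?M (win (r \<circ> x))"
    using monomial_mult[OF n(1) monomial_weyl_mat[OF nd, of "- inverse s"]] False by simp
  moreover have "?M \<in> KM_group" by (rule KM_mult[OF n(2) weyl_mat_KM[OF nd]])
  moreover have "bruhat_le (r \<circ> x) w" by (rule below_imp_bruhat[OF r(2) w]) (use r(3) le(2) in simp)
  ultimately show ?thesis unfolding e
    by (intro schubert_memI[OF r(2)] Borel_mult b emat_Borel cd up nd)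
qed

text \<open>Moved to the left of \<open>n\<close>, the root element becomes
  \<open>emat c d y\<close>, which is in the Borel subgroup since \<open>c < d\<close>; the curve
  stays in the cell of \<open>x\<close>.\<close>

lemma swap_down_curve:
  assumes x: "x \<in> W" and n: "monomial n (win x)" "n \<in> KM_group"
    and cd: "c < d" "\<not> 3 dvd c - d" and le: "bruhat_le x w"
  shows "flag (n ** emat (win x c) (win x d) s) \<in> schubert_variety w"
proof -
  obtain y where y: "n ** emat (win x c) (win x d) s = emat c d y ** n ** mat 1"
    using monomial_conj_emat[OF win_affine[OF x] n(1) cd(2), of s] by auto
  show ?thesis unfolding y by (rule schubert_memI[OF x le n emat_Borel[OF cd] Borel_one])
qed

text \<open>\<open>smooth_point\<close> supplies some representative \<open>g = n ** b\<close> of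
  the point. Conjugating \<open>E\<close> turns curves at \<open>n\<close> into curves at
  \<open>g\<close> with the same image in the flag variety.\<close>

lemma conj_tangent:
  assumes g: "g = n ** b" and b: "b \<in> Borel" "a \<in> Borel" "a ** b = mat 1" "b ** a = mat 1"
    and E: "E ** E = 0" "\<And>s. mat 1 + lscale s E \<in> KM_group" "\<And>s. flag (n ** (mat 1 + lscale s E)) \<in> X"
  shows "low (a ** E ** b) \<in> tangent_space (chart X g) (mat 1)"
proof (rule curve_tangent)
  have "(a ** E ** b) ** (a ** E ** b) = a ** E ** (b ** a) ** E ** b" by (simp only: matrix_mul_assoc)
  also have "\<dots> = a ** (E ** E) ** b" unfolding b(4) by (simp add: matrix_mul_assoc)
  also have "\<dots> = 0" unfolding E(1) by (simp add: matrix_matrix_mult_def vec_eq_iff)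
  finally show "(a ** E ** b) ** (a ** E ** b) = 0" .
  fix s
  have e: "mat 1 + lscale s (a ** E ** b) = a ** (mat 1 + lscale s E) ** b"
    unfolding matrix_add_ldistrib matrix_add_rdistrib mult_lscale_right mult_lscale_left by (simp add: b(3))
  show "mat 1 + lscale s (a ** E ** b) \<in> KM_group"
    unfolding e by (intro KM_mult E(2) Borel_KM b)
  have "g ** (mat 1 + lscale s (a ** E ** b)) = n ** (b ** a) ** (mat 1 + lscale s E) ** b"
    unfolding g e by (simp only: matrix_mul_assoc)
  also have "\<dots> = (n ** (mat 1 + lscale s E)) ** b" unfolding b(4) by simp
  finally show "flag (g ** (mat 1 + lscale s (a ** E ** b))) \<in> X"
    using E(3) flag_mult[OF b(1)] by simp
qed

lemma emat_KM_mat: "\<not> 3 dvd c - d \<Longrightarrow> mat 1 + lscale s (unit_mat c d) \<in> KM_group"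
  unfolding emat_def[symmetric] by (rule emat_KM)

text \<open>The tangent direction that a reflection contributes: written in the values
  \<open>z c\<close> and \<open>z d\<close>, and oriented to be strictly lower whether the
  reflection moves up or down.\<close>

definition root_unit :: "(int \<Rightarrow> int) \<Rightarrow> int \<Rightarrow> int \<Rightarrow> loop_matrix" where
  "root_unit z c d = (if z c < z d then unit_mat (z d) (z c) else unit_mat (z c) (z d))"

lemma root_unit_lower:
  assumes "affine z" "\<not> 3 dvd c - d" shows "root_unit z c d \<in> lower_units"
proof -
  have 1: "\<not> 3 dvd z c - z d" "\<not> 3 dvd z d - z c"
    using assms(2) affine_dvd[OF assms(1)] dvd_diff_commute[of 3 c d] by simp_all
  then have "z c \<noteq> z d" by auto
  then consider "z c < z d" | "\<not> z c < z d" "z d < z c" by linarith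
  then show ?thesis
  proof cases
    case 1
    then show ?thesis using \<open>\<not> 3 dvd z d - z c\<close> unfolding root_unit_def lower_units_def mem_Collect_eq
      by (intro exI[of _ "z d"] exI[of _ "z c"]) simp
  next
    case 2
    then show ?thesis using \<open>\<not> 3 dvd z c - z d\<close> unfolding root_unit_def lower_units_def mem_Collect_eq
      by (intro exI[of _ "z c"] exI[of _ "z d"]) simp
  qed
qed

lemma root_unit_inject:
  assumes z: "affine z" and cd: "\<not> 3 dvd c - d" "\<not> 3 dvd c' - d'" and eq: "root_unit z c d = root_unit z c' d'"
  shows "swap c d = swap c' d'"
proof -
  define M m M' m' where "M = max (z c) (z d)" and "m = min (z c) (z d)"
    and "M' = max (z c') (z d')" and "m' = min (z c') (z d')"
  have 1: "root_unit z c d = unit_mat M m" "root_unit z c' d' = unit_mat M' m'"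
    unfolding root_unit_def M_def m_def M'_def m'_def by (simp_all add: max_def min_def)
  have "ent (unit_mat M' m') M m = 1" using eq unfolding 1 by (simp add: ent_unit_mat flip: eq[unfolded 1])
  then obtain k where k: "M = M' + 3 * k \<and> m = m' + 3 * k" using unit_mat_eqD[of M' m' M m] by auto
  have nd: "\<not> 3 dvd z c - z d" "\<not> 3 dvd z c' - z d'" using cd unfolding affine_dvd[OF z] .
  have "swap (z c) (z d) = swap M m" using swap_commute[OF nd(1)] unfolding M_def m_def by (simp add: max_def min_def)
  also have "\<dots> = swap M' m'" using k by (simp add: swap_shift_args)
  also have "\<dots> = swap (z c') (z d')" using swap_commute[OF nd(2)] unfolding M'_def m'_def by (simp add: max_def min_def)
  finally have s: "swap (z c) (z d) = swap (z c') (z d')" .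
  show ?thesis
  proof
    fix p
    have "z (swap c d p) = z (swap c' d' p)" unfolding affine_swap_conj[OF z] s ..
    then show "swap c d p = swap c' d' p" by (rule affine_inj[OF z])
  qed
qed

lemma smooth_point_bound:
  assumes x: "x \<in> W" and w: "w \<in> W" and le: "bruhat_le x w"
    and smooth: "smooth_point (schubert_variety w) (W_flag x)"
    and F: "finite F" "F \<subseteq> reflections_below (win x) (win w)"
  shows "card F + (if repeated_root (win x) (win w) then 1 else 0) \<le> len w"
proof -
  let ?X = "schubert_variety w"
  let ?z = "win x"
  note aff = win_affine[OF x]
  obtain g where g: "g \<in> KM_group" "W_flag x = flag g" "regular_at (chart ?X g) (mat 1)"
    using smooth unfolding smooth_point_def by blast
  obtain Bs where Bs: "finite Bs" "loop_space.span Bs = tangent_space (chart ?X g) (mat 1)"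
    "enat (card Bs) = local_dim (chart ?X g) (mat 1)"
    using g(3) unfolding regular_at_def by blast
  have dim: "card Bs \<le> len w"
  proof -
    have "enat (card Bs) \<le> enat (len w)" unfolding Bs(3)
      by (rule local_dim_chart_le[OF g(1)]) (rule schubert_points[OF w])
    then show ?thesis by simp
  qed
  have "g \<in> W_flag x" unfolding g(2) by (rule flag_mem)
  then obtain js b where js: "word js = x" "b \<in> Borel" "g = word_lift js ** b"
    unfolding W_flag_def flag_def by blast
  define n where "n = word_lift js"
  have n: "monomial n ?z" "n \<in> KM_group" using word_lift_monomial[of js] unfolding js(1) n_def by simp_all
  have gn: "g = n ** b" unfolding n_def by (rule js(3))
  obtain a where a: "b ** a = mat 1" "a ** b = mat 1" "a \<in> Borel" using Borel_inverse[OF js(2)] .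
  note tangent = conj_tangent[OF gn js(2) a(3,2,1), where X = "?X", folded Bs(2)]
  \<comment> \<open>Each reflection receives a pair of positions in increasing order, the form
    required by \<open>swap_up_curve\<close> and \<open>swap_down_curve\<close>.\<close>
  have "\<forall>s\<in>F. \<exists>c d. c < d \<and> \<not> 3 dvd c - d \<and> s = swap c d \<and> below (?z \<circ> s) (win w)"
  proof
    fix s assume "s \<in> F"
    then obtain c d where cd: "\<not> 3 dvd c - d" "s = swap c d" "below (?z \<circ> s) (win w)"
      using F(2) unfolding reflections_below_def by blast
    show "\<exists>c d. c < d \<and> \<not> 3 dvd c - d \<and> s = swap c d \<and> below (?z \<circ> s) (win w)"
    proof (cases "c < d")
      case True
      with cd show ?thesis by (intro exI conjI)
    next
      case False
      then have "d < c" using cd(1) by (cases "c = d") auto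
      moreover have "\<not> 3 dvd d - c" using cd(1) by (simp add: dvd_diff_commute)
      moreover have "s = swap d c" unfolding cd(2) by (rule swap_commute[OF cd(1)])
      ultimately show ?thesis using cd(3) by (intro exI conjI)
    qed
  qed
  then obtain C D where CD: "\<And>s. s \<in> F \<Longrightarrow> C s < D s \<and> \<not> 3 dvd C s - D s \<and> s = swap (C s) (D s) \<and> below (?z \<circ> s) (win w)"
    by metis
  let ?E = "\<lambda>s. root_unit ?z (C s) (D s)"
  have inj: "inj_on ?E F"
  proof (rule inj_onI)
    fix s t assume st: "s \<in> F" "t \<in> F" "?E s = ?E t"
    have "swap (C s) (D s) = swap (C t) (D t)"
      by (rule root_unit_inject[OF aff _ _ st(3)]) (use CD st in blast)+
    then show "s = t" using CD[OF st(1)] CD[OF st(2)] by metis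
  qed
  have low: "?E ` F \<subseteq> lower_units" using root_unit_lower[OF aff] CD by blast
  have tE: "low (a ** ?E s ** b) \<in> loop_space.span Bs" if "s \<in> F" for s
  proof -
    have cd: "C s < D s" "\<not> 3 dvd C s - D s" "below (?z \<circ> swap (C s) (D s)) (win w)" using CD[OF that] by auto
    have nd: "\<not> 3 dvd ?z (C s) - ?z (D s)" "\<not> 3 dvd ?z (D s) - ?z (C s)"
      unfolding affine_dvd[OF aff] using cd(2) by (simp_all add: dvd_diff_commute)
    show ?thesis
    proof (cases "?z (C s) < ?z (D s)")
      case True
      have e: "?E s = unit_mat (?z (D s)) (?z (C s))" using True by (simp add: root_unit_def)
      show ?thesis unfolding e
      proof (rule tangent)
        show "unit_mat (?z (D s)) (?z (C s)) ** unit_mat (?z (D s)) (?z (C s)) = 0" by (rule unit_mat_square[OF nd(2)])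
        show "mat 1 + lscale r (unit_mat (?z (D s)) (?z (C s))) \<in> KM_group" for r by (rule emat_KM_mat[OF nd(2)])
        show "flag (n ** (mat 1 + lscale r (unit_mat (?z (D s)) (?z (C s))))) \<in> ?X" for r
          using swap_up_curve[OF x w n cd(1,2) True le cd(3) Borel_one, of r] unfolding emat_def by simp
      qed
    next
      case False
      have e: "?E s = unit_mat (?z (C s)) (?z (D s))" using False by (simp add: root_unit_def)
      show ?thesis unfolding e
      proof (rule tangent)
        show "unit_mat (?z (C s)) (?z (D s)) ** unit_mat (?z (C s)) (?z (D s)) = 0" by (rule unit_mat_square[OF nd(1)])
        show "mat 1 + lscale r (unit_mat (?z (C s)) (?z (D s))) \<in> KM_group" for r by (rule emat_KM_mat[OF nd(1)])
        show "flag (n ** (mat 1 + lscale r (unit_mat (?z (C s)) (?z (D s))))) \<in> ?X" for r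
          using swap_down_curve[OF x n cd(1,2) le, of r] unfolding emat_def .
      qed
    qed
  qed
  have fin: "finite (?E ` F)" using F(1) by simp
  have card: "card (?E ` F) = card F" by (rule card_image[OF inj])
  show ?thesis
  proof (cases "repeated_root ?z (win w)")
    case False
    have "card (?E ` F) \<le> card Bs"
      by (rule card_tangent_le[OF fin lower_units_independent[OF fin low] js(2) a(3,2,1) _ Bs(1)]) (use tE in blast)
    then show ?thesis using False dim unfolding card by simp
  next
    case True
    then obtain c d k where cdk: "c < d" "1 \<le> k" "\<not> 3 dvd c - d" "?z c < ?z d" "below (?z \<circ> swap c (d + 3 * k)) (win w)"
      unfolding repeated_root_def by (elim exE conjE)
    let ?c = "?z c" and ?d = "?z d"
    have nd: "\<not> 3 dvd ?c - ?d" "\<not> 3 dvd ?d + 3 * k - ?c"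
    proof -
      show "\<not> 3 dvd ?c - ?d" unfolding affine_dvd[OF aff] by (rule cdk(3))
      then show "\<not> 3 dvd ?d + 3 * k - ?c" by presburger
    qed
    let ?h = "emat ?c ?d 1" and ?h' = "emat ?c ?d (- 1)" and ?U = "unit_mat (?d + 3 * k) ?c"
    \<comment> \<open>The root vector of \<open>\<beta> + k \<delta>\<close>, conjugated by the root group of \<open>-\<beta>\<close>, has the component \<open>(?c + 3 k, ?c)\<close>
      on the diagonal modulo \<open>3\<close>, which no real root vector has.\<close>
    define G where "G = ?h ** ?U ** ?h'"
    have hh: "?h' ** ?h = mat 1" "?h ** ?h' = mat 1"
      using emat_mult_neg[OF nd(1), of "- 1"] emat_mult_neg[OF nd(1), of 1] by simp_all
    obtain y where y: "n ** ?h = emat c d y ** n" using monomial_conj_emat[OF aff n(1) cdk(3)] by blast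
    have shift: "?z (d + 3 * k) = ?d + 3 * k" by (rule affine_shift[OF aff])
    have "low (a ** G ** b) \<in> loop_space.span Bs"
    proof (rule tangent)
      have "G ** G = ?h ** ?U ** (?h' ** ?h) ** ?U ** ?h'" unfolding G_def by (simp only: matrix_mul_assoc)
      also have "\<dots> = ?h ** (?U ** ?U) ** ?h'" unfolding hh by (simp add: matrix_mul_assoc)
      also have "\<dots> = 0" unfolding unit_mat_square[OF nd(2)] by (simp add: matrix_matrix_mult_def vec_eq_iff)
      finally show "G ** G = 0" .
      fix r
      have e: "mat 1 + lscale r G = ?h ** emat (?d + 3 * k) ?c r ** ?h'"
        unfolding G_def emat_def[of "?d + 3 * k"] matrix_add_ldistrib matrix_add_rdistrib mult_lscale_right mult_lscale_left
        by (simp add: hh)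
      show "mat 1 + lscale r G \<in> KM_group"
        unfolding e by (intro KM_mult emat_KM nd)
      \<comment> \<open>On the right \<open>?h'\<close> is absorbed by the Borel subgroup;
        \<open>?h\<close> crosses \<open>n\<close> and becomes \<open>emat c d y\<close> on the
        left. What remains is a curve covered by \<open>swap_up_curve\<close>.\<close>
      have "n ** (mat 1 + lscale r G) = (n ** ?h) ** emat (?d + 3 * k) ?c r ** ?h'"
        unfolding e by (simp only: matrix_mul_assoc)
      also have "\<dots> = (emat c d y ** (n ** emat (?d + 3 * k) ?c r)) ** ?h'"
        unfolding y by (simp only: matrix_mul_assoc)
      finally have "flag (n ** (mat 1 + lscale r G)) = flag (emat c d y ** (n ** emat (?d + 3 * k) ?c r))"
        using flag_mult[OF emat_Borel[OF cdk(4) nd(1)]] by simp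
      moreover have "flag (emat c d y ** (n ** emat (?z (d + 3 * k)) ?c r)) \<in> ?X"
      proof (rule swap_up_curve[OF x w n _ _ _ le cdk(5) emat_Borel[OF cdk(1,3)]])
        show "c < d + 3 * k" using cdk(1,2) by simp
        show "\<not> 3 dvd c - (d + 3 * k)" using cdk(3) by presburger
        show "?z c < ?z (d + 3 * k)" unfolding shift using cdk(2,4) by simp
      qed
      ultimately show "flag (n ** (mat 1 + lscale r G)) \<in> ?X" unfolding shift by simp
    qed
    moreover have "ent G (?c + 3 * k) ?c \<noteq> 0"
      using nd unfolding G_def ent_mult_emat ent_emat_mult ent_unit_mat by simp
    ultimately have "card (insert G (?E ` F)) \<le> card Bs"
      using lower_units_insert_independent(2)[OF fin low, of k G ?c] cdk(2) fin tE
      by (intro card_tangent_le[OF _ _ js(2) a(3,2,1) _ Bs(1)]) auto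
    moreover have "card (insert G (?E ` F)) = card F + 1"
      using lower_units_insert_independent(1)[OF fin low, of k G ?c] \<open>ent G (?c + 3 * k) ?c \<noteq> 0\<close> cdk(2) fin card by simp
    ultimately show ?thesis using True dim by simp
  qed
qed

end

section \<open>Chambers and types\<close>

text \<open>Here \<open>P\<close> and \<open>Q\<close> are the positions of consecutive values. If
  the residues step by 1, such values are inverted unless the smaller one is in the residue class of
  the largest window entry.\<close>

lemma descent_arith:
  fixes z :: "int \<Rightarrow> int"
  assumes z: "affine z" and PQ: "z Q = z P + 1"
  shows "z (t + 2) < z (t + 1) \<Longrightarrow> z (t + 1) < z t \<Longrightarrow> (z t - z (t + 1)) mod 3 = 1 \<Longrightarrow> \<not> 3 dvd z P - z t \<Longrightarrow> Q < P"
    and "z t + 3 < z (t + 1) \<Longrightarrow> z (t + 1) + 3 < z (t + 2) \<Longrightarrow> (z (t + 1) - z t) mod 3 = 1 \<Longrightarrow> \<not> 3 dvd z P - z (t + 2) \<Longrightarrow> Q < P"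
proof -
  have "\<exists>k. x = t + 3 * k \<or> x = t + 1 + 3 * k \<or> x = t + 2 + 3 * k" for x :: int by presburger
  then obtain k l where k: "P = t + 3 * k \<or> P = t + 1 + 3 * k \<or> P = t + 2 + 3 * k"
    and l: "Q = t + 3 * l \<or> Q = t + 1 + 3 * l \<or> Q = t + 2 + 3 * l" by metis
  note sh = affine_shift[OF z]
  have nd: "\<not> 3 dvd z (t + 2) - z t" "\<not> 3 dvd z (t + 2) - z (t + 1)" unfolding affine_dvd[OF z] by simp_all
  {
    assume a: "z (t + 2) < z (t + 1)" "z (t + 1) < z t" "(z t - z (t + 1)) mod 3 = 1" "\<not> 3 dvd z P - z t"
    show "Q < P"
      using k l a nd PQ by (elim disjE; hypsubst; unfold sh; presburger)
  next
    assume a: "z t + 3 < z (t + 1)" "z (t + 1) + 3 < z (t + 2)" "(z (t + 1) - z t) mod 3 = 1" "\<not> 3 dvd z P - z (t + 2)"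
    show "Q < P"
      using k l a nd PQ by (elim disjE; hypsubst; unfold sh; presburger)
  }
qed

context A2_plane
begin

text \<open>Right multiplication of \<open>w\<close> acts on the values of \<open>win w\<close>,
  exchanging \<open>row i\<close> and \<open>row i + 1\<close> and their translates. If the larger
  one stands on the left, the length drops.\<close>

lemma not_ascent:
  assumes w: "w \<in> W" and PQ: "win w P = row i" "win w Q = row i + 1" "Q < P"
  shows "\<not> bruhat_le w (w \<circ> simple i)"
proof
  assume "bruhat_le w (w \<circ> simple i)"
  from bruhat_imp_below[OF this w] have v: "w \<circ> simple i \<in> W" "len w \<le> len (w \<circ> simple i)" by simp_all
  let ?z = "win w"
  note aff = win_affine[OF w]
  have "\<not> 3 dvd ?z Q - ?z P" unfolding PQ by simp
  then have nd: "\<not> 3 dvd Q - P" unfolding affine_dvd[OF aff] .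
  let ?y = "?z \<circ> swap Q P"
  have "rep (w \<circ> simple i) ?y"
    unfolding rep_def
  proof (intro conjI allI)
    show "affine ?y" by (rule affine_comp[OF aff affine_swap[OF nd]])
    fix v p
    have "coord ((w \<circ> simple i) v) p = coord (simple i v) (?z p)"
      using rep_win[OF w] unfolding rep_def by simp
    also have "\<dots> = coord v (swap (row i) (row i + 1) (?z p))" by (rule coord_simple)
    also have "swap (row i) (row i + 1) = swap (row i + 1) (row i)" by (rule swap_commute) simp
    also have "swap (row i + 1) (row i) (?z p) = ?y p" unfolding o_apply affine_swap_conj[OF aff] PQ ..
    finally show "coord ((w \<circ> simple i) v) p = coord v (?y p)" .
  qed
  then have wy: "win (w \<circ> simple i) = ?y" by (rule win_eq)
  have s: "swap Q P Q = P" "swap Q P P = Q" using nd by (simp_all add: swap_def dvd_diff_commute)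
  have "?y Q < ?y P" unfolding o_apply s PQ by simp
  from inversions_swap_up[OF affine_comp[OF aff affine_swap[OF nd]] PQ(3) nd this]
  have "inversions ?y < inversions (?z \<circ> swap Q P \<circ> swap Q P)" .
  also have "?z \<circ> swap Q P \<circ> swap Q P = ?z" using swap_swap[OF nd] by (simp add: fun_eq_iff)
  finally show False
    using v(2) unfolding wy[symmetric] len_inversions[OF w, symmetric] len_inversions[OF v(1), symmetric] by simp
qed

lemma has_type_2_ascent:
  assumes "has_type w 2"
  shows "\<exists>i. i \<noteq> i\<^sub>0 \<and> bruhat_le w (w \<circ> simple i)"
proof (rule ccontr)
  assume n: "\<nexists>i. i \<noteq> i\<^sub>0 \<and> bruhat_le w (w \<circ> simple i)"
  have "{s \<in> range simple. bruhat_less w (w \<circ> s)} \<subseteq> {simple i\<^sub>0}"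
  proof
    fix s assume "s \<in> {s \<in> range simple. bruhat_less w (w \<circ> s)}"
    then obtain i where "s = simple i" "bruhat_le w (w \<circ> simple i)" unfolding bruhat_less_def by blast
    moreover from this n have "i = i\<^sub>0" by blast
    ultimately show "s \<in> {simple i\<^sub>0}" by simp
  qed
  then have "card {s \<in> range simple. bruhat_less w (w \<circ> s)} \<le> card {simple i\<^sub>0}" by (intro card_mono) simp_all
  then show False using assms unfolding has_type_def by simp
qed

text \<open>Of two ascents, one avoids any prescribed residue class. If the residues stepped by 1,
  all ascents would lie in the class of the largest window entry, by
  \<open>descent_arith\<close>.\<close>

lemma type_2_gap:
  assumes w: "w \<in> W" and "has_type w 2"
  shows "win w (t + 2) < win w (t + 1) \<Longrightarrow> win w (t + 1) < win w t \<Longrightarrow> (win w t - win w (t + 1)) mod 3 = 2"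
    and "win w t + 3 < win w (t + 1) \<Longrightarrow> win w (t + 1) + 3 < win w (t + 2) \<Longrightarrow> (win w (t + 1) - win w t) mod 3 = 2"
proof -
  note aff = win_affine[OF w]
  have ascent: "\<exists>P Q. win w Q = win w P + 1 \<and> \<not> 3 dvd win w P - p \<and> \<not> Q < P" for p
  proof -
    obtain i where i: "i \<noteq> of_int p" "bruhat_le w (w \<circ> simple i)" using has_type_2_ascent[OF assms(2)] by blast
    obtain P where P: "row i = win w P" using affine_surj[OF aff] ..
    obtain Q where Q: "row i + 1 = win w Q" using affine_surj[OF aff] ..
    have "\<not> Q < P" using not_ascent[OF w P[symmetric] Q[symmetric]] i(2) by blast
    moreover have "\<not> 3 dvd win w P - p"
      using i(1) of_int_eq_iff3[of "row i" p] unfolding P[symmetric] of_int_row by simp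
    ultimately show ?thesis using P Q by (intro exI[of _ P] exI[of _ Q]) simp
  qed
  have nd: "\<not> 3 dvd win w t - win w (t + 1)" unfolding affine_dvd[OF aff] by simp
  show "(win w t - win w (t + 1)) mod 3 = 2" if d: "win w (t + 2) < win w (t + 1)" "win w (t + 1) < win w t"
  proof (rule ccontr)
    assume "(win w t - win w (t + 1)) mod 3 \<noteq> 2"
    with nd have "(win w t - win w (t + 1)) mod 3 = 1" by presburger
    with ascent[of "win w t"] descent_arith(1)[OF aff _ d] show False by blast
  qed
  show "(win w (t + 1) - win w t) mod 3 = 2" if d: "win w t + 3 < win w (t + 1)" "win w (t + 1) + 3 < win w (t + 2)"
  proof (rule ccontr)
    assume "(win w (t + 1) - win w t) mod 3 \<noteq> 2"
    with nd have "(win w (t + 1) - win w t) mod 3 = 1" by presburger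
    with ascent[of "win w (t + 2)"] descent_arith(2)[OF aff _ d] show False by blast
  qed
qed

text \<open>The centre of the alcove suffices to find the chamber.\<close>

lemma base_A\<^sub>0: "base \<in> A\<^sub>0"
  using coord_roots(1-3)[of base] coord_base[of 1] coord_base[of 2] coord_base[of 3]
  unfolding A\<^sub>0_def by (simp add: inner_commute)

lemma roots_base:
  assumes "w \<in> W"
  shows "\<alpha>\<^sub>1 \<bullet> w base = of_int (win w 2 - win w 1) / 3" "\<alpha>\<^sub>2 \<bullet> w base = of_int (win w 3 - win w 2) / 3"
    "highest_root \<bullet> w base = of_int (win w 3 - win w 1) / 3"
proof -
  have c: "coord (w base) p = (2 - of_int (win w p)) / 3" for p
    using rep_win[OF assms] unfolding rep_def by (simp add: coord_base)
  show "\<alpha>\<^sub>1 \<bullet> w base = of_int (win w 2 - win w 1) / 3" "\<alpha>\<^sub>2 \<bullet> w base = of_int (win w 3 - win w 2) / 3"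
    "highest_root \<bullet> w base = of_int (win w 3 - win w 1) / 3"
    using coord_roots[of "w base"] c[of 1] c[of 2] c[of 3] by (simp_all add: field_simps)
qed

text \<open>At \<open>w base\<close> the chamber inequalities compare window entries. Chambers II,
  IV and VI give decreasing windows starting at 3, 1 and 2 respectively.\<close>

lemma even_window:
  assumes w: "w \<in> W" and "in_even_chamber w"
  shows "\<exists>t. win w (t + 2) < win w (t + 1) \<and> win w (t + 1) < win w t"
proof -
  have sh: "win w (1 + 3) = win w 1 + 3" "win w (2 + 3) = win w 2 + 3" by (rule affine_shift3[OF win_affine[OF w]])+
  have "w base \<in> chamber_II \<or> w base \<in> chamber_IV \<or> w base \<in> chamber_VI"
    using assms(2) base_A\<^sub>0 unfolding in_even_chamber_def by blast
  then consider "win w 2 < win w 1" "win w 1 + 3 < win w 3" | "win w 2 < win w 1" "win w 3 < win w 2"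
    | "win w 3 < win w 2" "win w 1 + 3 < win w 3"
    unfolding chamber_II_def chamber_IV_def chamber_VI_def mem_Collect_eq roots_base[OF w] by fastforce
  then show ?thesis
  proof cases
    case 1
    then show ?thesis using sh by (intro exI[of _ 3]) simp
  next
    case 2
    then show ?thesis by (intro exI[of _ 1]) simp
  next
    case 3
    then show ?thesis using sh by (intro exI[of _ 2]) simp
  qed
qed

text \<open>Chambers I, III and V give windows starting at 1, 2 and 3; the unit width of the strips
  becomes the gap of 3.\<close>

lemma odd_window:
  assumes w: "w \<in> W" and "in_odd_chamber w"
  shows "\<exists>t. win w t + 3 < win w (t + 1) \<and> win w (t + 1) + 3 < win w (t + 2)"
proof -
  have sh: "win w (1 + 3) = win w 1 + 3" "win w (2 + 3) = win w 2 + 3" by (rule affine_shift3[OF win_affine[OF w]])+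
  have "w base \<in> chamber_I \<or> w base \<in> chamber_III \<or> w base \<in> chamber_V"
    using assms(2) base_A\<^sub>0 unfolding in_odd_chamber_def by blast
  then consider "win w 1 + 3 < win w 2" "win w 2 + 3 < win w 3" | "win w 2 + 3 < win w 3" "win w 3 < win w 1"
    | "win w 1 + 3 < win w 2" "win w 3 < win w 1"
    unfolding chamber_I_def chamber_III_def chamber_V_def mem_Collect_eq roots_base[OF w] by fastforce
  then show ?thesis
  proof cases
    case 1
    then show ?thesis by (intro exI[of _ 1]) simp
  next
    case 2
    then show ?thesis using sh by (intro exI[of _ 2]) simp
  next
    case 3
    then show ?thesis using sh by (intro exI[of _ 3]) simp
  qed
qed

context
  fixes x w
  assumes x: "x \<in> W" and w: "w \<in> W" and le: "bruhat_le x w"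
    and smooth: "smooth_point (schubert_variety w) (W_flag x)"
begin

lemma below_xw: "below (win x) (win w)"
  using bruhat_imp_below[OF le x] by simp

lemma sum_xw: "win x t + win x (t + 1) + win x (t + 2) = win w t + win w (t + 1) + win w (t + 2)"
  unfolding window_sum[OF x] window_sum[OF w] ..

lemma few_reflections: "many_reflections (win x) (win w) n \<Longrightarrow> n \<le> inversions (win w)"
proof -
  assume "many_reflections (win x) (win w) n"
  then obtain F where F: "finite F" "F \<subseteq> reflections_below (win x) (win w)" "n \<le> int (card F)"
    unfolding many_reflections_def by (elim exE conjE)
  have "card F \<le> len w" using smooth_point_bound[OF x w le smooth F(1,2)] by simp
  then show ?thesis using F(3) len_inversions[OF w] by linarith
qed

text \<open>The real root vectors alone already fill the dimension \<open>len w\<close>, leaving no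
  room for a vector of imaginary weight.\<close>

lemma not_repeated:
  assumes "many_reflections (win x) (win w) (inversions (win w))"
  shows "\<not> repeated_root (win x) (win w)"
proof
  assume r: "repeated_root (win x) (win w)"
  obtain F where F: "finite F" "F \<subseteq> reflections_below (win x) (win w)" "inversions (win w) \<le> int (card F)"
    using assms unfolding many_reflections_def by (elim exE conjE)
  have "card F + 1 \<le> len w" using smooth_point_bound[OF x w le smooth F(1,2)] r by simp
  then show False using F(3) len_inversions[OF w] by linarith
qed

lemma len_diff: "int (len w) - int (len x) = inversions (win w) - inversions (win x)"
  unfolding len_inversions[OF x] len_inversions[OF w] ..

lemma bound_6: "int (len w) - int (len x) \<le> 6"
proof (cases "win w = id")
  case True
  then have "inversions (win w) = 0" by (simp add: inversions_def)
  then show ?thesis unfolding len_diff using inversions_nonneg[of "win x"] by simp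
next
  case False
  note a = win_affine[OF x] win_affine[OF w] below_xw sum_xw
  show ?thesis unfolding len_diff
  proof (rule normal_form[OF win_affine[OF w] rep_sum[OF rep_win[OF w]] False])
    fix t assume d: "win w (t + 2) < win w (t + 1)" "win w (t + 1) < win w t"
    show "inversions (win w) - inversions (win x) \<le> 6"
      by (rule dec_reflections(2)[OF a d not_repeated[OF dec_reflections(1)[OF a d]]])
  next
    fix t assume d: "win w t < win w (t + 1)" "win w (t + 1) < win w (t + 2)" "win w t + 3 < win w (t + 2)"
    show "inversions (win w) - inversions (win x) \<le> 6"
      by (rule inc_reflections(2)[OF a d not_repeated[OF inc_reflections(1)[OF a d]]])
  qed
qed

lemma even_bound:
  assumes "in_even_chamber w" "has_type w 2"
  shows "int (len w) - int (len x) \<le> 5"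
proof -
  note a = win_affine[OF x] win_affine[OF w] below_xw sum_xw
  obtain t where d: "win w (t + 2) < win w (t + 1)" "win w (t + 1) < win w t"
    using even_window[OF w assms(1)] by (elim exE conjE)
  show ?thesis unfolding len_diff
    by (rule dec_reflections(3)[OF a d not_repeated[OF dec_reflections(1)[OF a d]] type_2_gap(1)[OF w assms(2) d]])
qed

text \<open>Residue step 1 gives 5 directly. For step 2, which is that of Type 2 by
  \<open>type_2_gap\<close>, the alternative with one reflection too many contradicts
  \<open>few_reflections\<close>, and 4 remains.\<close>

lemma odd_bound:
  assumes "in_odd_chamber w"
  shows "int (len w) - int (len x) \<le> 5" "has_type w 2 \<Longrightarrow> int (len w) - int (len x) \<le> 4"
proof -
  note a = win_affine[OF x] win_affine[OF w] below_xw sum_xw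
  obtain t where d: "win w t + 3 < win w (t + 1)" "win w (t + 1) + 3 < win w (t + 2)"
    using odd_window[OF w assms] by (elim exE conjE)
  have d': "win w t < win w (t + 1)" "win w (t + 1) < win w (t + 2)" "win w t + 3 < win w (t + 2)" using d by simp_all
  note nr = not_repeated[OF inc_reflections(1)[OF a d']]
  have gap2: "inversions (win w) - inversions (win x) \<le> 4" if "(win w (t + 1) - win w t) mod 3 = 2"
    using odd_reflections(2)[OF a d nr that] few_reflections[of "inversions (win w) + 1"] by auto
  show "has_type w 2 \<Longrightarrow> int (len w) - int (len x) \<le> 4"
    unfolding len_diff by (rule gap2) (rule type_2_gap(2)[OF w _ d])
  have "\<not> 3 dvd win w (t + 1) - win w t" unfolding affine_dvd[OF a(2)] by simp
  then have "(win w (t + 1) - win w t) mod 3 = 1 \<or> (win w (t + 1) - win w t) mod 3 = 2" by presburger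
  then show "int (len w) - int (len x) \<le> 5"
    unfolding len_diff using odd_reflections(1)[OF a d nr] gap2 by (elim disjE) auto
qed

end

end

theorem corollary9p7:
  fixes \<alpha>\<^sub>1 \<alpha>\<^sub>2 :: "'v::euclidean_space" and x w :: "'v \<Rightarrow> 'v"
  assumes "A2_plane \<alpha>\<^sub>1 \<alpha>\<^sub>2"
    and "x \<in> A2_plane.W \<alpha>\<^sub>1 \<alpha>\<^sub>2" and "w \<in> A2_plane.W \<alpha>\<^sub>1 \<alpha>\<^sub>2"
    and "A2_plane.bruhat_le \<alpha>\<^sub>1 \<alpha>\<^sub>2 x w"
    and "smooth_point (A2_plane.schubert_variety \<alpha>\<^sub>1 \<alpha>\<^sub>2 w) (A2_plane.W_flag \<alpha>\<^sub>1 \<alpha>\<^sub>2 x)"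
  shows "int (A2_plane.len \<alpha>\<^sub>1 \<alpha>\<^sub>2 x) \<ge> int (A2_plane.len \<alpha>\<^sub>1 \<alpha>\<^sub>2 w) - 6 \<and>
    (\<not> A2_plane.spiral \<alpha>\<^sub>1 \<alpha>\<^sub>2 w \<longrightarrow>
      (A2_plane.has_type \<alpha>\<^sub>1 \<alpha>\<^sub>2 w 1 \<and> A2_plane.in_even_chamber \<alpha>\<^sub>1 \<alpha>\<^sub>2 w \<longrightarrow>
         int (A2_plane.len \<alpha>\<^sub>1 \<alpha>\<^sub>2 x) \<ge> int (A2_plane.len \<alpha>\<^sub>1 \<alpha>\<^sub>2 w) - 6) \<and>
      (A2_plane.has_type \<alpha>\<^sub>1 \<alpha>\<^sub>2 w 1 \<and> A2_plane.in_odd_chamber \<alpha>\<^sub>1 \<alpha>\<^sub>2 w \<longrightarrow>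
         int (A2_plane.len \<alpha>\<^sub>1 \<alpha>\<^sub>2 x) \<ge> int (A2_plane.len \<alpha>\<^sub>1 \<alpha>\<^sub>2 w) - 5) \<and>
      (A2_plane.has_type \<alpha>\<^sub>1 \<alpha>\<^sub>2 w 2 \<and> A2_plane.in_even_chamber \<alpha>\<^sub>1 \<alpha>\<^sub>2 w \<longrightarrow>
         int (A2_plane.len \<alpha>\<^sub>1 \<alpha>\<^sub>2 x) \<ge> int (A2_plane.len \<alpha>\<^sub>1 \<alpha>\<^sub>2 w) - 5) \<and>
      (A2_plane.has_type \<alpha>\<^sub>1 \<alpha>\<^sub>2 w 2 \<and> A2_plane.in_odd_chamber \<alpha>\<^sub>1 \<alpha>\<^sub>2 w \<longrightarrow>
         int (A2_plane.len \<alpha>\<^sub>1 \<alpha>\<^sub>2 x) \<ge> int (A2_plane.len \<alpha>\<^sub>1 \<alpha>\<^sub>2 w) - 4))"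
proof -
  interpret A2_plane \<alpha>\<^sub>1 \<alpha>\<^sub>2 by (rule assms(1))
  note a = assms(2-5)
  have e: "int m \<ge> int n - k \<longleftrightarrow> int n - int m \<le> k" for m n k by linarith
  show ?thesis unfolding e using bound_6[OF a] even_bound[OF a] odd_bound[OF a] by blast
qed

end
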